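(* Assume complete randomization with vector potential outcomes and $\boldsymbol V_{\hat\gamma}$ nonsingular; let $\tilde\gamma=\boldsymbol V_{\hat\gamma}^{-1/2}(\hat\gamma-\mathbb E\hat\gamma)$. There is a universal constant $C>0$ such that: (i) for every $b\in\mathbb R^H$ with $\|b\|_2=1$, $$\sup_{t\in\mathbb R}|\mathbb P\{b^\top\tilde\gamma\le t\}-\Phi(t)|\le C\max_{i\in[N],q\in[Q]}\big|b^\top\boldsymbol V_{\hat\gamma}^{-1/2}N_q^{-1}\boldsymbol F_q\breve{\boldsymbol Y}_i(q)\big|;$$ (ii) if all $\boldsymbol S(q,q)$ are nonsingular and there is $\sigma_F\ge1$ with $\sum_{q=1}^QN_q^{-1}\boldsymbol F_q\boldsymbol S(q,q)\boldsymbol F_q^\top\preceq\sigma_F^2\boldsymbol V_{\hat\gamma}$, then $$\sup_{\|b\|_2=1}\sup_t|\mathbb P\{b^\top\tilde\gamma\le t\}-\Phi(t)|\le C\max_{i,q}\min\Big\{2\sigma_F\sqrt{N_q^{-1}\breve{\boldsymbol Y}_i(q)^\top\boldsymbol S(q,q)^{-1}\breve{\boldsymbol Y}_i(q)},\ \frac{\|\boldsymbol F_q\|_{2,1}N_q^{-1}\|\breve{\boldsymbol Y}_i(q)\|_\infty}{\sqrt{\varrho_{\min}(\boldsymbol V_{\hat\gamma})}}\Big\}.$$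
   Context: Randomization model with $N$ units, $Q$ treatment levels and group sizes $N_1,\dots,N_Q\ge1$, $\sum_qN_q=N$; unit $i$ has fixed vector potential outcomes $\boldsymbol Y_i(q)\in\mathbb R^p$. Under complete randomization $Z$ is uniform over all vectors in $[Q]^N$ with exactly $N_q$ coordinates equal to $q$. $\overline{\boldsymbol Y}(q)=N^{-1}\sum_i\boldsymbol Y_i(q)$, $\hat{\boldsymbol Y}_q=N_q^{-1}\sum_{i:Z_i=q}\boldsymbol Y_i(q)$, $\breve{\boldsymbol Y}_i(q)=\boldsymbol Y_i(q)-\overline{\boldsymbol Y}(q)$, $\boldsymbol S(q,q')=(N-1)^{-1}\sum_i\breve{\boldsymbol Y}_i(q)\breve{\boldsymbol Y}_i(q')^\top$. Fixed coefficient matrices $\boldsymbol F_1,\dots,\boldsymbol F_Q\in\mathbb R^{H\times p}$; $\hat\gamma=\sum_q\boldsymbol F_q\hat{\boldsymbol Y}_q$; $\gamma_i=\sum_q\boldsymbol F_q\boldsymbol Y_i(q)$, $\overline\gamma=N^{-1}\sum_i\gamma_i$, $\boldsymbol S_{\boldsymbol F}=(N-1)^{-1}\sum_i(\gamma_i-\overline\gamma)(\gamma_i-\overline\gamma)^\top$, and $\boldsymbol V_{\hat\gamma}=\sum_qN_q^{-1}\boldsymbol F_q\boldsymbol S(q,q)\boldsymbol F_q^\top-N^{-1}\boldsymbol S_{\boldsymbol F}$ (the covariance of $\hat\gamma$). $\|\boldsymbol F_q\|_{2,1}=\sum_{k=1}^p\|\boldsymbol F_q(\cdot,k)\|_2$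 (sum of Euclidean norms of columns); $\|x\|_\infty$ is the max absolute coordinate; $\varrho_{\min}$ the smallest eigenvalue; $\Phi$ the standard normal cdf. *)

theory Defs
  imports "Jordan_Normal_Form.Char_Poly" "HOL-Probability.Distributions"
begin

hide_type (open) Finite_Cartesian_Product.vec
hide_const (open) Finite_Cartesian_Product.vec Finite_Cartesian_Product.vec_nth Finite_Cartesian_Product.mat Finite_Cartesian_Product.transpose Finite_Cartesian_Product.row Finite_Cartesian_Product.column
no_notation Finite_Cartesian_Product.vec_nth (infixl "$" 90)

(* Conventions: units are 0..N-1, treatment levels are 0..Q-1 (paper: [N], [Q]).
   Y i q :: real vec of dimension p; F q :: H x p real matrix; Nq q group sizes. *)

definition assignments :: "nat \<Rightarrow> nat \<Rightarrow> (nat \<Rightarrow> nat) \<Rightarrow> (nat \<Rightarrow> nat) set" where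
  "assignments N Q Nq = {z. (\<forall>i<N. z i < Q) \<and> (\<forall>i. N \<le> i \<longrightarrow> z i = 0)
      \<and> (\<forall>q<Q. card {i. i < N \<and> z i = q} = Nq q)}"

definition Ybar :: "nat \<Rightarrow> nat \<Rightarrow> (nat \<Rightarrow> nat \<Rightarrow> real vec) \<Rightarrow> nat \<Rightarrow> real vec" where
  "Ybar N p Y q = vec p (\<lambda>k. (\<Sum>i<N. Y i q $ k) / real N)"

definition Ybreve :: "nat \<Rightarrow> nat \<Rightarrow> (nat \<Rightarrow> nat \<Rightarrow> real vec) \<Rightarrow> nat \<Rightarrow> nat \<Rightarrow> real vec" where
  "Ybreve N p Y i q = vec p (\<lambda>k. Y i q $ k - Ybar N p Y q $ k)"

definition Smat :: "nat \<Rightarrow> nat \<Rightarrow> (nat \<Rightarrow> nat \<Rightarrow> real vec) \<Rightarrow> nat \<Rightarrow> nat \<Rightarrow> real mat" where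
  "Smat N p Y q q' = mat p p (\<lambda>(k,l).
      (\<Sum>i<N. Ybreve N p Y i q $ k * Ybreve N p Y i q' $ l) / (real N - 1))"

definition Yhat :: "nat \<Rightarrow> nat \<Rightarrow> (nat \<Rightarrow> nat) \<Rightarrow> (nat \<Rightarrow> nat \<Rightarrow> real vec) \<Rightarrow> (nat \<Rightarrow> nat) \<Rightarrow> nat \<Rightarrow> real vec" where
  "Yhat N p Nq Y z q = vec p (\<lambda>k. (\<Sum>i\<in>{i. i < N \<and> z i = q}. Y i q $ k) / real (Nq q))"

definition gamma_hat :: "nat \<Rightarrow> nat \<Rightarrow> nat \<Rightarrow> nat \<Rightarrow> (nat \<Rightarrow> nat) \<Rightarrow> (nat \<Rightarrow> nat \<Rightarrow> real vec)
     \<Rightarrow> (nat \<Rightarrow> real mat) \<Rightarrow> (nat \<Rightarrow> nat) \<Rightarrow> real vec" where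
  "gamma_hat N Q p H Nq Y F z = vec H (\<lambda>h. \<Sum>q<Q. (F q *\<^sub>v Yhat N p Nq Y z q) $ h)"

definition gamma_hat_mean :: "nat \<Rightarrow> nat \<Rightarrow> nat \<Rightarrow> nat \<Rightarrow> (nat \<Rightarrow> nat) \<Rightarrow> (nat \<Rightarrow> nat \<Rightarrow> real vec)
     \<Rightarrow> (nat \<Rightarrow> real mat) \<Rightarrow> real vec" where
  "gamma_hat_mean N Q p H Nq Y F = vec H (\<lambda>h.
      (\<Sum>z\<in>assignments N Q Nq. gamma_hat N Q p H Nq Y F z $ h) / real (card (assignments N Q Nq)))"

definition gamma_unit :: "nat \<Rightarrow> nat \<Rightarrow> (nat \<Rightarrow> nat \<Rightarrow> real vec) \<Rightarrow> (nat \<Rightarrow> real mat) \<Rightarrow> nat \<Rightarrow> real vec" where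
  "gamma_unit Q H Y F i = vec H (\<lambda>h. \<Sum>q<Q. (F q *\<^sub>v Y i q) $ h)"

definition gamma_bar :: "nat \<Rightarrow> nat \<Rightarrow> nat \<Rightarrow> (nat \<Rightarrow> nat \<Rightarrow> real vec) \<Rightarrow> (nat \<Rightarrow> real mat) \<Rightarrow> real vec" where
  "gamma_bar N Q H Y F = vec H (\<lambda>h. (\<Sum>i<N. gamma_unit Q H Y F i $ h) / real N)"

definition S_F :: "nat \<Rightarrow> nat \<Rightarrow> nat \<Rightarrow> (nat \<Rightarrow> nat \<Rightarrow> real vec) \<Rightarrow> (nat \<Rightarrow> real mat) \<Rightarrow> real mat" where
  "S_F N Q H Y F = mat H H (\<lambda>(h,h').
      (\<Sum>i<N. (gamma_unit Q H Y F i $ h - gamma_bar N Q H Y F $ h)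
             * (gamma_unit Q H Y F i $ h' - gamma_bar N Q H Y F $ h')) / (real N - 1))"

definition SumFSF :: "nat \<Rightarrow> nat \<Rightarrow> nat \<Rightarrow> nat \<Rightarrow> (nat \<Rightarrow> nat) \<Rightarrow> (nat \<Rightarrow> nat \<Rightarrow> real vec)
     \<Rightarrow> (nat \<Rightarrow> real mat) \<Rightarrow> real mat" where
  "SumFSF N Q p H Nq Y F = mat H H (\<lambda>(h,h').
      \<Sum>q<Q. (F q * Smat N p Y q q * transpose_mat (F q)) $$ (h,h') / real (Nq q))"

definition V_gamma :: "nat \<Rightarrow> nat \<Rightarrow> nat \<Rightarrow> nat \<Rightarrow> (nat \<Rightarrow> nat) \<Rightarrow> (nat \<Rightarrow> nat \<Rightarrow> real vec)
     \<Rightarrow> (nat \<Rightarrow> real mat) \<Rightarrow> real mat" where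
  "V_gamma N Q p H Nq Y F = mat H H (\<lambda>(h,h').
      SumFSF N Q p H Nq Y F $$ (h,h') - S_F N Q H Y F $$ (h,h') / real N)"

definition pos_def_mat :: "nat \<Rightarrow> real mat \<Rightarrow> bool" where
  "pos_def_mat n A \<longleftrightarrow> (\<forall>x \<in> carrier_vec n. x \<noteq> 0\<^sub>v n \<longrightarrow> x \<bullet> (A *\<^sub>v x) > 0)"

definition loewner_le :: "nat \<Rightarrow> real mat \<Rightarrow> real mat \<Rightarrow> bool" where
  "loewner_le n A B \<longleftrightarrow> (\<forall>x \<in> carrier_vec n. x \<bullet> (A *\<^sub>v x) \<le> x \<bullet> (B *\<^sub>v x))"

definition mat_inv :: "nat \<Rightarrow> real mat \<Rightarrow> real mat" where
  "mat_inv n A = (THE M. M \<in> carrier_mat n n \<and> M * A = 1\<^sub>m n \<and> A * M = 1\<^sub>m n)"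

definition mat_inv_sqrt :: "nat \<Rightarrow> real mat \<Rightarrow> real mat" where
  "mat_inv_sqrt n A = (THE W. W \<in> carrier_mat n n \<and> transpose_mat W = W \<and> pos_def_mat n W
                          \<and> W * W = mat_inv n A)"

definition min_eig :: "real mat \<Rightarrow> real" where
  "min_eig A = Min {k. eigenvalue A k}"

definition norm21 :: "real mat \<Rightarrow> real" where
  "norm21 M = (\<Sum>k<dim_col M. sqrt (\<Sum>h<dim_row M. (M $$ (h,k))\<^sup>2))"

definition norm_inf_vec :: "real vec \<Rightarrow> real" where
  "norm_inf_vec v = Max (insert 0 ((\<lambda>k. \<bar>v $ k\<bar>) ` {..<dim_vec v}))"

definition norm2_vec :: "real vec \<Rightarrow> real" where
  "norm2_vec v = sqrt (v \<bullet> v)"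

definition Phi :: "real \<Rightarrow> real" where
  "Phi t = (LBINT x:{..t}. std_normal_density x)"

definition prob_le :: "nat \<Rightarrow> nat \<Rightarrow> nat \<Rightarrow> nat \<Rightarrow> (nat \<Rightarrow> nat) \<Rightarrow> (nat \<Rightarrow> nat \<Rightarrow> real vec)
     \<Rightarrow> (nat \<Rightarrow> real mat) \<Rightarrow> real vec \<Rightarrow> real \<Rightarrow> real" where
  "prob_le N Q p H Nq Y F b t =
     real (card {z \<in> assignments N Q Nq.
        b \<bullet> (mat_inv_sqrt H (V_gamma N Q p H Nq Y F) *\<^sub>v
               (gamma_hat N Q p H Nq Y F z - gamma_hat_mean N Q p H Nq Y F)) \<le> t})
     / real (card (assignments N Q Nq))"

end

theory Submission
  imports Defs
    "HOL-Probability.Characteristic_Functions"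
    "HOL-Real_Asymp.Real_Asymp"
    "HOL-Combinatorics.Permutations"
    "Jordan_Normal_Form.Spectral_Radius"
begin

text \<open>
  For a unit vector \<open>b\<close> put \<open>u = V\<^bsup>-1/2\<^esup> b\<close>. The statistic \<open>b \<bullet> V\<^bsup>-1/2\<^esup> (G - E G)\<close>, with \<open>G\<close> the estimator, equals
  \<open>\<Sum>i. a i (z i)\<close> with column-centred scores \<open>a i q = u \<bullet> (F q Z i q) / N q\<close>, where \<open>Z\<close> are the
  centred outcomes, and has variance
  \<open>u \<bullet> V u = 1\<close>; writing a random assignment as a fixed labelling composed with a uniform
  permutation, it becomes a combinatorial sum \<open>W = \<Sum>i. A i (p i)\<close> with \<open>\<bar>A\<bar> \<le> \<delta>\<close>.

  Composing \<open>p\<close> with a random transposition gives an exchangeable pair whose increment \<open>\<Delta>\<close> satisfies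
  \<open>E(\<Delta> | p) = - \<lambda> W\<close>. Monotonicity of \<open>w \<mapsto> w f(w)\<close> for the solution \<open>f\<close> of Stein's equation and
  antisymmetry of the pair bound the Kolmogorov distance by
  \<open>2 E\<bar>1 - E(\<Delta>\<^sup>2 | p) / (2 \<lambda>)\<bar> + E\<bar>E(\<Delta> \<bar>\<Delta>\<bar> | p)\<bar> / \<lambda>\<close>, without any concentration inequality
  (Shao and Zhang). Both terms are mean deviations of functions \<open>\<Sum>k l. \<phi>(\<Delta> k l)\<close> with
  \<open>\<bar>\<phi>(x)\<bar> \<le> x\<^sup>2\<close>, and the Poincare inequality for random transpositions shows that they are \<open>O(\<delta>)\<close>.
  The second bound follows from the first by Cauchy-Schwarz and the spectral theorem.
\<close>

(* merging the imports re-exposes the names hidden in Defs *)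
hide_type (open) Finite_Cartesian_Product.vec
hide_const (open) Finite_Cartesian_Product.vec Finite_Cartesian_Product.vec_nth
  Finite_Cartesian_Product.mat Finite_Cartesian_Product.transpose
  Finite_Cartesian_Product.row Finite_Cartesian_Product.column
no_notation Finite_Cartesian_Product.vec_nth (infixl "$" 90)
no_notation inner (infix "\<bullet>" 70)

section \<open>Stein's method for the normal distribution\<close>

text \<open>The obstacle is the jump of the derivative of Stein's solution at \<open>z\<close>: a
  second-order expansion would leave the probability that W falls near \<open>z\<close>, the term
  usually handled by concentration. Here that derivative is split into the increasing function w
  f(w) and a decreasing indicator, so the remainder of a first-order expansion is caught between
  differences of monotone functions at the two ends of the pair. Weighted by an even function of the
  increment such differences average to zero, and weighted by an odd one they reduce to conditional
  means. The resulting error terms must be of order \<delta>, not merely bounded. A transposition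
  touches only O(n) of the n^2 terms of \<Sum>k l. \<phi>(\<Delta> k l), and its effect is bounded
  by squared increments, whose mean is fixed by Var W = 1; no higher moments of the scores enter.
  The scores are centred over units only, not over levels. Stein's argument uses just a vanishing
  total; the row sums enter the variance, where they become exactly the term -S_F / N of the
  covariance.\<close>

lemma nonneg_if_DERIV_nonneg_at_bot:
  fixes f f' :: "real \<Rightarrow> real"
  assumes "\<And>x. x \<le> w \<Longrightarrow> (f has_real_derivative f' x) (at x)"
    and "\<And>x. x \<le> w \<Longrightarrow> 0 \<le> f' x"
    and lim: "(f \<longlongrightarrow> 0) at_bot"
  shows "0 \<le> f w"
proof (rule tendsto_upperbound[OF lim])
  have "f x \<le> f w" if "x \<le> w" for x
    using assms(1,2) by (intro DERIV_nonneg_imp_nondecreasing[OF that]) (auto intro!: exI)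
  then show "\<forall>\<^sub>F x in at_bot. f x \<le> f w"
    by (auto simp: eventually_at_bot_linorder)
qed simp

section \<open>The normal distribution function and Mills' ratio\<close>

lemma std_normal_density_DERIV:
  "(std_normal_density has_real_derivative - x * std_normal_density x) (at x)"
  unfolding std_normal_density_def
  by (auto intro!: derivative_eq_intros simp: field_simps)

text \<open>Identifies \<open>Phi\<close> with the distribution function of a probability measure,
  from which its range and its limits at both ends follow.\<close>

lemma Phi_eq_cdf: "Phi t = cdf std_normal_distribution t"
proof -
  have "cdf std_normal_distribution t = integral\<^sup>L std_normal_distribution (indicator {..t})"
    by (simp add: cdf_def)
  also have "\<dots> = (\<integral>x. std_normal_density x * indicator {..t} x \<partial>lborel)"
    by (subst integral_density) auto
  also have "\<dots> = Phi t"
    by (simp add: Phi_def set_lebesgue_integral_def mult.commute)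
  finally show ?thesis ..
qed

lemma real_distribution_std_normal: "real_distribution std_normal_distribution"
  using prob_space_normal_density[of 1 0]
  by (simp add: real_distribution_def real_distribution_axioms_def)

lemma Phi_nonneg: "0 \<le> Phi t"
  by (simp add: Phi_eq_cdf cdf_def)

lemma Phi_le_1: "Phi t \<le> 1"
  by (simp add: Phi_eq_cdf cdf_def prob_space.prob_le_1[OF prob_space_normal_density[of 1 0, simplified]])

lemma Phi_at_bot: "(Phi \<longlongrightarrow> 0) at_bot"
proof -
  interpret real_distribution std_normal_distribution by (rule real_distribution_std_normal)
  show ?thesis unfolding Phi_eq_cdf[abs_def] by (rule cdf_lim_at_bot)
qed

lemma Phi_at_top: "(Phi \<longlongrightarrow> 1) at_top"
proof -
  interpret real_distribution std_normal_distribution by (rule real_distribution_std_normal)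
  show ?thesis unfolding Phi_eq_cdf[abs_def] using cdf_lim_at_top_prob .
qed

lemma Phi_DERIV: "(Phi has_real_derivative std_normal_density t) (at t)"
proof -
  let ?I = "\<lambda>x. integral {t - 1..x} std_normal_density"
  have cont: "continuous_on A std_normal_density" for A
    unfolding std_normal_density_def by (intro continuous_intros) auto
  have int: "set_integrable lborel A std_normal_density" if "A \<in> sets lborel" for A
    using integrable_normal_density[of 1 0] that unfolding set_integrable_def
    by (intro integrable_mult_indicator) auto
  \<comment> \<open>Splitting at \<open>t - 1\<close> leaves an integral over a compact interval, to
    which the fundamental theorem of calculus applies; letting the interval reach
    \<open>t + 1\<close> makes \<open>t\<close> an interior point.\<close>
  have eq: "Phi x = Phi (t - 1) + ?I x" if "t - 1 \<le> x" for x
  proof -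
    have "{..x} = {..t - 1} \<union> {t - 1<..x}" using that by auto
    then have "Phi x = Phi (t - 1) + (LBINT x:{t - 1<..x}. std_normal_density x)"
      unfolding Phi_def by (simp add: set_integral_Un int disjoint_iff)
    also have "(LBINT x:{t - 1<..x}. std_normal_density x) = integral {t - 1<..x} std_normal_density"
      by (rule set_borel_integral_eq_integral) (simp add: int)
    also have "\<dots> = ?I x"
      by (rule integral_spike_set; rule negligible_subset[OF negligible_sing[of "t - 1"]]) auto
    finally show ?thesis .
  qed
  have "(?I has_real_derivative std_normal_density t) (at t within {t - 1..t + 1})"
    by (rule integral_has_real_derivative) (auto intro: cont)
  then have "((\<lambda>x. Phi (t - 1) + ?I x) has_real_derivative std_normal_density t) (at t within {t - 1..t + 1})"
    by (auto intro!: derivative_eq_intros)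
  then have "(Phi has_real_derivative std_normal_density t) (at t within {t - 1..t + 1})"
    by (rule has_field_derivative_transform_within[where d = 1]) (auto intro: eq[symmetric])
  then show ?thesis
    by (simp add: at_within_interior[of t "{t - 1..t + 1}"])
qed

lemmas Phi_DERIV'[derivative_intros] = DERIV_chain2[OF Phi_DERIV]
lemmas std_normal_density_DERIV'[derivative_intros] = DERIV_chain2[OF std_normal_density_DERIV]

text \<open>The density is even, so \<open>Phi (- x) + Phi x\<close> has derivative 0; the limit at
  infinity shows that the constant is 1.\<close>

lemma Phi_minus: "Phi (- t) = 1 - Phi t"
proof -
  have d: "((\<lambda>x. Phi (- x) + Phi x) has_real_derivative 0) (at x)" for x
    by (auto intro!: derivative_eq_intros simp: std_normal_density_def)
  have eq: "(\<lambda>x. Phi (- x) + Phi x) = (\<lambda>x. Phi (- t) + Phi t)"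
    using DERIV_isconst_all[OF allI, OF d] by metis
  have "((\<lambda>x. Phi (- x) + Phi x) \<longlongrightarrow> 0 + 1) at_top"
    by (intro tendsto_add Phi_at_top filterlim_compose[OF Phi_at_bot filterlim_uminus_at_bot_at_top])
  then show ?thesis
    unfolding eq by (simp add: tendsto_const_iff)
qed

text \<open>Division by \<open>1 + w\<^sup>2\<close> turns the expression into a function that
  vanishes at minus infinity and has the positive derivative
  \<open>2 * std_normal_density x / (1 + x\<^sup>2)\<^sup>2\<close>. The expression itself is the
  numerator of a derivative in \<open>mono_mills\<close>.\<close>

lemma Mills_lower: "0 \<le> Phi w * (1 + w\<^sup>2) + w * std_normal_density w"
proof -
  have pos: "1 + x\<^sup>2 \<noteq> 0" for x :: real using zero_le_power2[of x] by linarith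
  let ?h = "\<lambda>w. Phi w + w * std_normal_density w / (1 + w\<^sup>2)"
  have "0 \<le> ?h w"
  proof (rule nonneg_if_DERIV_nonneg_at_bot[where f = ?h])
    fix x :: real
    show "(?h has_real_derivative 2 * std_normal_density x / (1 + x\<^sup>2)\<^sup>2) (at x)"
    proof (rule DERIV_cong)
      show "(?h has_real_derivative std_normal_density x * 1 +
          ((1 * std_normal_density x + - x * std_normal_density x * 1 * x) * (1 + x\<^sup>2)
            - x * std_normal_density x * (2 * x)) / ((1 + x\<^sup>2) * (1 + x\<^sup>2))) (at x)"
        using pos[of x] by (auto intro!: derivative_eq_intros)
      show "std_normal_density x * 1 +
          ((1 * std_normal_density x + - x * std_normal_density x * 1 * x) * (1 + x\<^sup>2)
            - x * std_normal_density x * (2 * x)) / ((1 + x\<^sup>2) * (1 + x\<^sup>2))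
          = 2 * std_normal_density x / (1 + x\<^sup>2)\<^sup>2"
        using pos[of x] by (simp add: divide_simps power2_eq_square) (simp add: algebra_simps)
    qed
    show "0 \<le> 2 * std_normal_density x / (1 + x\<^sup>2)\<^sup>2" by simp
  next
    have "((\<lambda>w. w * std_normal_density w / (1 + w\<^sup>2)) \<longlongrightarrow> 0) at_bot"
      unfolding std_normal_density_def by real_asymp
    then show "(?h \<longlongrightarrow> 0) at_bot"
      using tendsto_add[OF Phi_at_bot] by fastforce
  qed
  then have "0 \<le> ?h w * (1 + w\<^sup>2)" by simp
  also have "\<dots> = Phi w * (1 + w\<^sup>2) + w * std_normal_density w"
    using pos[of w] by (simp add: field_simps)
  finally show ?thesis .
qed

text \<open>For negative \<open>w\<close> the same method applies to the density over
  \<open>- w\<close>, minus \<open>Phi\<close>: its derivative is the density over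
  \<open>w\<^sup>2\<close>. For other \<open>w\<close> the left side is not positive.\<close>

lemma Mills_upper: "- w * Phi w \<le> std_normal_density w"
proof (cases "w < 0")
  case True
  let ?k = "\<lambda>w. std_normal_density w / (- w) - Phi w"
  have "0 \<le> ?k w"
  proof (rule nonneg_if_DERIV_nonneg_at_bot[where f = ?k])
    fix x :: real assume "x \<le> w"
    then show "(?k has_real_derivative std_normal_density x / x\<^sup>2) (at x)"
      using True by (auto intro!: derivative_eq_intros simp: field_simps power2_eq_square)
    show "0 \<le> std_normal_density x / x\<^sup>2" by simp
  next
    have "((\<lambda>w. std_normal_density w / (- w)) \<longlongrightarrow> 0) at_bot"
      unfolding std_normal_density_def by real_asymp
    then show "(?k \<longlongrightarrow> 0) at_bot"
      using tendsto_diff[OF _ Phi_at_bot] by fastforce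
  qed
  then show ?thesis using True by (simp add: field_simps)
next
  case False
  then have "- w * Phi w \<le> 0" by (simp add: Phi_nonneg)
  then show ?thesis using normal_density_nonneg[of 0 1 w] by linarith
qed

section \<open>Stein's equation for a half-line\<close>

text \<open>The bounded solution f of f'(w) - w f(w) = 1{w \<le> z} - Phi(z), in closed form. It is
  continuous but has a kink at \<open>z\<close>.\<close>

definition stein_solution :: "real \<Rightarrow> real \<Rightarrow> real" where
  "stein_solution z w =
     (if w \<le> z then (1 - Phi z) * Phi w else Phi z * (1 - Phi w)) / std_normal_density w"

text \<open>Multiplied by \<open>1 - Phi z\<close> and by \<open>Phi z\<close>, these formulas are
  Stein's equation to the left and to the right of \<open>z\<close>.\<close>

lemma mills_ratio_DERIV:
  "((\<lambda>x. Phi x / std_normal_density x) has_real_derivative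
     1 + w * (Phi w / std_normal_density w)) (at w)"
  "((\<lambda>x. (1 - Phi x) / std_normal_density x) has_real_derivative
     w * ((1 - Phi w) / std_normal_density w) - 1) (at w)"
proof -
  have "std_normal_density w \<noteq> 0" using normal_density_pos[of 1 0 w] by simp
  then show "((\<lambda>x. Phi x / std_normal_density x) has_real_derivative
     1 + w * (Phi w / std_normal_density w)) (at w)"
    "((\<lambda>x. (1 - Phi x) / std_normal_density x) has_real_derivative
     w * ((1 - Phi w) / std_normal_density w) - 1) (at w)"
    by (auto intro!: derivative_eq_intros simp: field_simps)
qed

text \<open>By \<open>mills_ratio_DERIV\<close> the derivative of the first function is the
  expression in \<open>Mills_lower\<close> over the density. The second function is the first one
  reflected through the origin, so \<open>Mills_lower\<close> at \<open>- w\<close> controls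
  it.\<close>

lemma mono_mills:
  "mono (\<lambda>w. w * (Phi w / std_normal_density w))"
  "mono (\<lambda>w. w * ((1 - Phi w) / std_normal_density w))"
proof -
  have pos: "0 < std_normal_density w" for w using normal_density_pos[of 1 0 w] by simp
  show "mono (\<lambda>w. w * (Phi w / std_normal_density w))"
  proof (rule monoI)
    fix x y :: real assume "x \<le> y"
    then show "x * (Phi x / std_normal_density x) \<le> y * (Phi y / std_normal_density y)"
    proof (rule DERIV_nonneg_imp_nondecreasing)
      fix w :: real
      have "0 \<le> (Phi w * (1 + w\<^sup>2) + w * std_normal_density w) / std_normal_density w"
        using Mills_lower[of w] pos[of w] by (intro divide_nonneg_nonneg) auto
      also have "\<dots> = Phi w / std_normal_density w + (1 + w * (Phi w / std_normal_density w)) * w"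
        using pos[of w] by (simp add: field_simps power2_eq_square)
      finally show "\<exists>d. ((\<lambda>w. w * (Phi w / std_normal_density w)) has_real_derivative d) (at w) \<and> 0 \<le> d"
        using DERIV_mult[OF DERIV_ident mills_ratio_DERIV(1)] by fastforce
    qed
  qed
  show "mono (\<lambda>w. w * ((1 - Phi w) / std_normal_density w))"
  proof (rule monoI)
    fix x y :: real assume "x \<le> y"
    then show "x * ((1 - Phi x) / std_normal_density x) \<le> y * ((1 - Phi y) / std_normal_density y)"
    proof (rule DERIV_nonneg_imp_nondecreasing)
      fix w :: real
      have "0 \<le> ((1 - Phi w) * (1 + w\<^sup>2) - w * std_normal_density w) / std_normal_density w"
        using Mills_lower[of "- w"] pos[of w]
        by (intro divide_nonneg_nonneg) (auto simp: Phi_minus std_normal_density_def)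
      also have "\<dots> = (1 - Phi w) / std_normal_density w + (w * ((1 - Phi w) / std_normal_density w) - 1) * w"
        using pos[of w] by (simp add: field_simps power2_eq_square)
      finally show "\<exists>d. ((\<lambda>w. w * ((1 - Phi w) / std_normal_density w)) has_real_derivative d) (at w) \<and> 0 \<le> d"
        using DERIV_mult[OF DERIV_ident mills_ratio_DERIV(2)] by fastforce
    qed
  qed
qed

lemma mono_stein_solution: "mono (\<lambda>w. w * stein_solution z w)"
proof (rule monoI)
  let ?a = "\<lambda>w. (1 - Phi z) * (w * (Phi w / std_normal_density w))"
  let ?b = "\<lambda>w. Phi z * (w * ((1 - Phi w) / std_normal_density w))"
  fix x y :: real assume xy: "x \<le> y"
  have a: "?a u \<le> ?a v" if "u \<le> v" for u v
    by (intro mult_left_mono monoD[OF mono_mills(1) that]) (simp add: Phi_le_1)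
  have b: "?b u \<le> ?b v" if "u \<le> v" for u v
    by (intro mult_left_mono monoD[OF mono_mills(2) that]) (simp add: Phi_nonneg)
  have eq: "w * stein_solution z w = (if w \<le> z then ?a w else ?b w)" for w
    by (simp add: stein_solution_def)
  have ab: "?a z = ?b z" by simp
  consider "y \<le> z" | "z < x" | "x \<le> z" "z < y" using xy by linarith
  then show "x * stein_solution z x \<le> y * stein_solution z y"
  proof cases
    case 3
    then have "x * stein_solution z x = ?a x" "y * stein_solution z y = ?b y"
      using eq[of x] eq[of y] by auto
    then show ?thesis using a[of x z] b[of z y] ab 3 by linarith
  qed (use xy a b in \<open>auto simp: eq\<close>)
qed

text \<open>In both branches the numerator is at most \<open>Phi w\<close> and at most
  \<open>1 - Phi w\<close>, so \<open>Mills_upper\<close> applies at \<open>w\<close> or at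
  \<open>- w\<close>, according to the sign.\<close>

lemma abs_stein_solution_le: "\<bar>w * stein_solution z w\<bar> \<le> 1"
proof -
  have pos: "0 < std_normal_density w" for w using normal_density_pos[of 1 0 w] by simp
  have mono: "Phi x \<le> Phi y" if "x \<le> y" for x y
    using that by (rule DERIV_nonneg_imp_nondecreasing) (intro exI conjI, rule Phi_DERIV, simp)
  define n where "n = (if w \<le> z then (1 - Phi z) * Phi w else Phi z * (1 - Phi w))"
  have n: "0 \<le> n \<and> n \<le> Phi w \<and> n \<le> 1 - Phi w"
  proof (cases "w \<le> z")
    case True
    have "(1 - Phi z) * Phi w \<le> 1 * Phi w" "(1 - Phi z) * Phi w \<le> (1 - Phi w) * 1"
      using mono[OF True] Phi_nonneg Phi_le_1 by (intro mult_mono; simp)+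
    then show ?thesis using True Phi_nonneg Phi_le_1 by (simp add: n_def)
  next
    case False
    have "Phi z * (1 - Phi w) \<le> Phi w * 1" "Phi z * (1 - Phi w) \<le> 1 * (1 - Phi w)"
      using mono[of z w] False Phi_nonneg Phi_le_1 by (intro mult_mono; simp)+
    then show ?thesis using False Phi_nonneg Phi_le_1 by (simp add: n_def)
  qed
  have "\<bar>w\<bar> * n \<le> std_normal_density w"
  proof (cases "w \<le> 0")
    case True
    then have "\<bar>w\<bar> * n \<le> - w * Phi w"
      using n unfolding abs_of_nonpos[OF True] by (intro mult_left_mono) auto
    then show ?thesis using Mills_upper[of w] by linarith
  next
    case False
    have "\<bar>w\<bar> * n \<le> \<bar>w\<bar> * Phi (- w)"
      using n unfolding Phi_minus by (intro mult_left_mono) auto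
    also have "\<dots> = - (- w) * Phi (- w)" using False by simp
    also have "\<dots> \<le> std_normal_density (- w)" by (rule Mills_upper)
    finally show ?thesis by (simp add: std_normal_density_def)
  qed
  then have "\<bar>w\<bar> * n / std_normal_density w \<le> 1" using pos[of w] by simp
  moreover have "w * stein_solution z w = w * n / std_normal_density w"
    unfolding stein_solution_def n_def by simp
  ultimately show ?thesis
    using n pos[of w] by (simp only: abs_mult abs_divide abs_of_nonneg abs_of_pos)
qed

text \<open>An integrated Stein equation. The derivative is an increasing function plus a decreasing
  indicator, so it is bounded by mixing values from opposite endpoints; the kink at \<open>z\<close>
  forces a separate mean value argument on each side.\<close>

lemma stein_solution_increment:
  fixes x y z :: real
  assumes "x < y"
  shows "(y - x) * (x * stein_solution z x + of_bool (y \<le> z) - Phi z)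
           \<le> stein_solution z y - stein_solution z x"
    and "stein_solution z y - stein_solution z x
           \<le> (y - x) * (y * stein_solution z y + of_bool (x \<le> z) - Phi z)"
proof -
  let ?f = "stein_solution z" and ?g = "\<lambda>w. w * stein_solution z w"
  have left: "\<exists>c. u < c \<and> c < v \<and> ?f v - ?f u = (v - u) * (?g c + 1 - Phi z)" if "u < v" "v \<le> z" for u v
  proof -
    have f: "?f w = (1 - Phi z) * (Phi w / std_normal_density w)" if "w \<le> z" for w
      using that by (simp add: stein_solution_def)
    have "\<exists>c>u. c < v \<and> (1 - Phi z) * (Phi v / std_normal_density v) - (1 - Phi z) * (Phi u / std_normal_density u)
       = (v - u) * ((1 - Phi z) * (1 + c * (Phi c / std_normal_density c)))"
      by (intro MVT2 DERIV_cmult mills_ratio_DERIV that)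
    then obtain c where c: "u < c" "c < v" and
      eq: "(1 - Phi z) * (Phi v / std_normal_density v) - (1 - Phi z) * (Phi u / std_normal_density u)
       = (v - u) * ((1 - Phi z) * (1 + c * (Phi c / std_normal_density c)))" by blast
    have "?f v - ?f u = (v - u) * (?g c + 1 - Phi z)"
      unfolding f[OF that(2)] f[OF order_trans[OF less_imp_le[OF that(1)] that(2)]]
        f[OF order_trans[OF less_imp_le[OF c(2)] that(2)]] eq by (simp add: algebra_simps)
    then show ?thesis using c by blast
  qed
  have right: "\<exists>c. u < c \<and> c < v \<and> ?f v - ?f u = (v - u) * (?g c - Phi z)" if "u < v" "z \<le> u" for u v
  proof -
    have f: "?f w = Phi z * ((1 - Phi w) / std_normal_density w)" if "z \<le> w" for w
      using that by (cases "w = z") (auto simp: stein_solution_def)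
    have "\<exists>c>u. c < v \<and> Phi z * ((1 - Phi v) / std_normal_density v) - Phi z * ((1 - Phi u) / std_normal_density u)
       = (v - u) * (Phi z * (c * ((1 - Phi c) / std_normal_density c) - 1))"
      by (intro MVT2 DERIV_cmult mills_ratio_DERIV that)
    then obtain c where c: "u < c" "c < v" and
      eq: "Phi z * ((1 - Phi v) / std_normal_density v) - Phi z * ((1 - Phi u) / std_normal_density u)
       = (v - u) * (Phi z * (c * ((1 - Phi c) / std_normal_density c) - 1))" by blast
    have "?f v - ?f u = (v - u) * (?g c - Phi z)"
      unfolding f[OF that(2)] f[OF order_trans[OF that(2) less_imp_le[OF that(1)]]]
        f[OF order_trans[OF that(2) less_imp_le[OF c(1)]]] eq by (simp add: algebra_simps)
    then show ?thesis using c by blast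
  qed
  have g: "?g u \<le> ?g v" if "u \<le> v" for u v
    using monoD[OF mono_stein_solution that] .
  have bnd: "(v - u) * a \<le> (v - u) * b" if "u < v" "a \<le> b" for u v a b :: real
    using that by (intro mult_left_mono) auto
  consider "y \<le> z" | "z \<le> x" | "x < z" "z < y" using assms by linarith
  then have "(y - x) * (?g x + of_bool (y \<le> z) - Phi z) \<le> ?f y - ?f x \<and>
     ?f y - ?f x \<le> (y - x) * (?g y + of_bool (x \<le> z) - Phi z)"
  proof cases
    case 1
    then obtain c where c: "x < c" "c < y" "?f y - ?f x = (y - x) * (?g c + 1 - Phi z)"
      using left[of x y] assms by auto
    show ?thesis unfolding c(3) using 1 assms g[of x c] g[of c y] c
      by (intro conjI bnd) auto
  next
    case 2
    then obtain c where c: "x < c" "c < y" "?f y - ?f x = (y - x) * (?g c - Phi z)"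
      using right[of x y] assms by auto
    show ?thesis unfolding c(3) using 2 assms g[of x c] g[of c y] c
      by (intro conjI bnd) auto
  next
    case 3
    obtain c where c: "x < c" "c < z" "?f z - ?f x = (z - x) * (?g c + 1 - Phi z)"
      using left[of x z] 3 by auto
    obtain d where d: "z < d" "d < y" "?f y - ?f z = (y - z) * (?g d - Phi z)"
      using right[of z y] 3 by auto
    have eq: "?f y - ?f x = (z - x) * (?g c + 1 - Phi z) + (y - z) * (?g d - Phi z)"
      using c(3) d(3) by linarith
    \<comment> \<open>On a segment straddling \<open>z\<close> the indicator is 0 in the lower bound
      and 1 in the upper one, and both pieces satisfy each bound.\<close>
    have "(z - x) * (?g x - Phi z) + (y - z) * (?g x - Phi z) \<le> ?f y - ?f x"
      unfolding eq using 3 g[of x c] g[of x d] c d by (intro add_mono bnd) auto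
    moreover have "?f y - ?f x \<le> (z - x) * (?g y + 1 - Phi z) + (y - z) * (?g y + 1 - Phi z)"
      unfolding eq using 3 g[of c y] g[of d y] c d by (intro add_mono bnd) auto
    ultimately show ?thesis using 3 by (simp add: algebra_simps)
  qed
  then show "(y - x) * (?g x + of_bool (y \<le> z) - Phi z) \<le> ?f y - ?f x"
    "?f y - ?f x \<le> (y - x) * (?g y + of_bool (x \<le> z) - Phi z)" by auto
qed

text \<open>The error \<open>R\<close> of using the derivative at \<open>x\<close> lies between
  \<open>d * (I y - I x)\<close> and \<open>d * (g y - g x)\<close>. Multiplying by \<open>d\<close>
  reverses the order when \<open>d < 0\<close>. Each weight equals \<open>d\<^sup>2\<close> for one
  sign of \<open>d\<close> and 0 for the other, which covers both cases and at the same time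
  displays an even and an odd part.\<close>

lemma stein_remainder_bounds:
  fixes x y z :: real
  defines "f \<equiv> stein_solution z"
  defines "g \<equiv> \<lambda>w. w * f w"
  defines "I \<equiv> \<lambda>w. of_bool (w \<le> z) :: real"
  defines "d \<equiv> y - x"
  defines "R \<equiv> f y - f x - d * (g x + I x - Phi z)"
  shows "d * R \<le> (d\<^sup>2 + d * \<bar>d\<bar>) / 2 * (g y - g x) + (d\<^sup>2 - d * \<bar>d\<bar>) / 2 * (I y - I x)"
    and "(d\<^sup>2 - d * \<bar>d\<bar>) / 2 * (g y - g x) + (d\<^sup>2 + d * \<bar>d\<bar>) / 2 * (I y - I x) \<le> d * R"
proof -
  have R: "d * (I y - I x) \<le> R \<and> R \<le> d * (g y - g x)"
  proof (cases x y rule: linorder_cases)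
    case less
    show ?thesis
      using stein_solution_increment[OF less, of z] unfolding R_def d_def g_def I_def f_def
      by (simp add: algebra_simps)
  next
    case equal
    then show ?thesis by (simp add: R_def d_def)
  next
    case greater
    show ?thesis
      using stein_solution_increment[OF greater, of z] unfolding R_def d_def g_def I_def f_def
      by (simp add: algebra_simps)
  qed
  have "d * R \<le> (d\<^sup>2 + d * \<bar>d\<bar>) / 2 * (g y - g x) + (d\<^sup>2 - d * \<bar>d\<bar>) / 2 * (I y - I x) \<and>
    (d\<^sup>2 - d * \<bar>d\<bar>) / 2 * (g y - g x) + (d\<^sup>2 + d * \<bar>d\<bar>) / 2 * (I y - I x) \<le> d * R"
  proof (cases "0 \<le> d")
    case True
    then have "d * (d * (I y - I x)) \<le> d * R" "d * R \<le> d * (d * (g y - g x))"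
      using R by (auto intro: mult_left_mono)
    then show ?thesis using True by (simp add: power2_eq_square algebra_simps)
  next
    case False
    then have "d * R \<le> d * (d * (I y - I x))" "d * (d * (g y - g x)) \<le> d * R"
      using R by (auto intro: mult_left_mono_neg)
    then show ?thesis using False by (simp add: power2_eq_square algebra_simps)
  qed
  then show "d * R \<le> (d\<^sup>2 + d * \<bar>d\<bar>) / 2 * (g y - g x) + (d\<^sup>2 - d * \<bar>d\<bar>) / 2 * (I y - I x)"
    "(d\<^sup>2 - d * \<bar>d\<bar>) / 2 * (g y - g x) + (d\<^sup>2 + d * \<bar>d\<bar>) / 2 * (I y - I x) \<le> d * R"
    by auto
qed

section \<open>An abstract bound for exchangeable pairs\<close>

text \<open>Exchangeability of the pair for uniform \<open>w\<close>: reindexing by the involution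
  \<open>s j\<close> swaps the two arguments.\<close>

lemma sum_involutions_swap:
  fixes K :: "'c \<Rightarrow> 'c \<Rightarrow> real"
  assumes "\<And>j w. j \<in> J \<Longrightarrow> w \<in> Om \<Longrightarrow> s j w \<in> Om"
    and "\<And>j w. j \<in> J \<Longrightarrow> w \<in> Om \<Longrightarrow> s j (s j w) = w"
  shows "(\<Sum>w\<in>Om. \<Sum>j\<in>J. K (W w) (W (s j w))) = (\<Sum>w\<in>Om. \<Sum>j\<in>J. K (W (s j w)) (W w))"
proof -
  have "(\<Sum>w\<in>Om. K (W w) (W (s j w))) = (\<Sum>w\<in>Om. K (W (s j w)) (W w))" if "j \<in> J" for j
    by (rule sum.reindex_bij_witness[of _ "s j" "s j"]) (use assms that in auto)
  then show ?thesis
    by (subst (1 2) sum.swap) simp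
qed

text \<open>Unnormalised sums over \<open>Om\<close> and \<open>J\<close> take the place of
  expectations. The \<lambda> of the pair is \<open>c\<close> divided by the size of
  \<open>J\<close>, which cancels from the bound.\<close>

theorem stein_exchangeable_involutions:
  fixes Om :: "'a set" and J :: "'b set" and s :: "'b \<Rightarrow> 'a \<Rightarrow> 'a" and W :: "'a \<Rightarrow> real"
  assumes s: "\<And>j w. j \<in> J \<Longrightarrow> w \<in> Om \<Longrightarrow> s j w \<in> Om"
    "\<And>j w. j \<in> J \<Longrightarrow> w \<in> Om \<Longrightarrow> s j (s j w) = w"
    and c: "c > 0"
    and lin: "\<And>w. w \<in> Om \<Longrightarrow> (\<Sum>j\<in>J. W (s j w) - W w) = - c * W w"
  shows "\<bar>\<Sum>w\<in>Om. of_bool (W w \<le> z) - Phi z\<bar>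
    \<le> 2 * (\<Sum>w\<in>Om. \<bar>1 - (\<Sum>j\<in>J. (W (s j w) - W w)\<^sup>2) / (2 * c)\<bar>)
      + (\<Sum>w\<in>Om. \<bar>\<Sum>j\<in>J. (W (s j w) - W w) * \<bar>W (s j w) - W w\<bar>\<bar>) / c"
proof -
  define f where "f = stein_solution z"
  define g where "g = (\<lambda>w. w * f w)"
  define I where "I = (\<lambda>w. of_bool (w \<le> z) :: real)"
  define Psi where "Psi = (\<lambda>w. g w + I w - Phi z)"
  define D where "D = (\<lambda>w j. W (s j w) - W w)"
  define R where "R = (\<lambda>w j. f (W (s j w)) - f (W w) - D w j * Psi (W w))"
  define B where "B = (\<Sum>w\<in>Om. (I (W w) - g (W w)) * (\<Sum>j\<in>J. D w j * \<bar>D w j\<bar>))"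
  note swap = sum_involutions_swap[of J Om s _ W, OF s]
  \<comment> \<open>The swap reverses the difference of \<open>h\<close> and keeps an even weight,
    so the sum equals its own negative.\<close>
  have even: "(\<Sum>w\<in>Om. \<Sum>j\<in>J. k (D w j) * (h (W (s j w)) - h (W w))) = 0"
    if "\<And>x. k (- x) = k x" for k h :: "real \<Rightarrow> real"
  proof -
    have "k (W w - W (s j w)) = k (W (s j w) - W w)" for w j
      by (metis that minus_diff_eq)
    then have "(\<Sum>w\<in>Om. \<Sum>j\<in>J. k (D w j) * h (W w)) = (\<Sum>w\<in>Om. \<Sum>j\<in>J. k (D w j) * h (W (s j w)))"
      using swap[of "\<lambda>x y. k (y - x) * h x"] by (simp only: D_def)
    then show ?thesis by (simp add: right_diff_distrib sum_subtractf)
  qed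
  \<comment> \<open>For an odd weight the two halves of the difference contribute equally, and
    \<open>h (W w)\<close> factors out of the inner sum: conditional means of functions of the
    increment appear.\<close>
  have odd: "(\<Sum>w\<in>Om. \<Sum>j\<in>J. k (D w j) * (h (W (s j w)) - h (W w)))
      = - 2 * (\<Sum>w\<in>Om. h (W w) * (\<Sum>j\<in>J. k (D w j)))"
    if "\<And>x. k (- x) = - k x" for k h :: "real \<Rightarrow> real"
  proof -
    have "k (W w - W (s j w)) = - k (W (s j w) - W w)" for w j
      by (metis that minus_diff_eq)
    then have "(\<Sum>w\<in>Om. \<Sum>j\<in>J. k (D w j) * h (W (s j w))) = - (\<Sum>w\<in>Om. \<Sum>j\<in>J. k (D w j) * h (W w))"
      using swap[of "\<lambda>x y. k (y - x) * h x"] by (simp only: D_def sum_negf mult_minus_left)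
    then show ?thesis by (simp add: right_diff_distrib sum_subtractf sum_distrib_left mult.commute)
  qed
  \<comment> \<open>With the increment itself as odd weight, \<open>lin\<close> evaluates the
    conditional mean; this is where the factor w in w f(w) comes from.\<close>
  have "(\<Sum>w\<in>Om. \<Sum>j\<in>J. D w j * (f (W (s j w)) - f (W w))) = 2 * c * (\<Sum>w\<in>Om. g (W w))"
    using odd[of "\<lambda>x. x" f] lin
    by (simp add: D_def g_def sum_distrib_left mult_ac sum_negf)
  moreover have "(\<Sum>w\<in>Om. \<Sum>j\<in>J. D w j * (f (W (s j w)) - f (W w)))
      = (\<Sum>w\<in>Om. Psi (W w) * (\<Sum>j\<in>J. (D w j)\<^sup>2)) + (\<Sum>w\<in>Om. \<Sum>j\<in>J. D w j * R w j)"
    unfolding sum_distrib_left sum.distrib[symmetric]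
    by (intro sum.cong refl) (simp add: R_def power2_eq_square algebra_simps)
  ultimately have g: "(\<Sum>w\<in>Om. g (W w)) = (\<Sum>w\<in>Om. Psi (W w) * (\<Sum>j\<in>J. (D w j)\<^sup>2)) / (2 * c)
      + (\<Sum>w\<in>Om. \<Sum>j\<in>J. D w j * R w j) / (2 * c)"
    using c by (simp add: field_simps)
  have "(\<Sum>w\<in>Om. I (W w) - Phi z) = (\<Sum>w\<in>Om. Psi (W w)) - (\<Sum>w\<in>Om. g (W w))"
    by (simp add: Psi_def sum_subtractf sum.distrib)
  also have "\<dots> = (\<Sum>w\<in>Om. Psi (W w) * (1 - (\<Sum>j\<in>J. (D w j)\<^sup>2) / (2 * c)))
      - (\<Sum>w\<in>Om. \<Sum>j\<in>J. D w j * R w j) / (2 * c)"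
    unfolding g by (simp add: right_diff_distrib sum_subtractf flip: sum_divide_distrib)
  finally have main: "(\<Sum>w\<in>Om. I (W w) - Phi z) = (\<Sum>w\<in>Om. Psi (W w) * (1 - (\<Sum>j\<in>J. (D w j)\<^sup>2) / (2 * c)))
      - (\<Sum>w\<in>Om. \<Sum>j\<in>J. D w j * R w j) / (2 * c)" .
  have gb: "\<bar>g x\<bar> \<le> 1" for x unfolding g_def f_def by (rule abs_stein_solution_le)
  have Psi: "\<bar>Psi x\<bar> \<le> 2" for x
    using gb[of x] Phi_nonneg[of z] Phi_le_1[of z] unfolding Psi_def I_def by (auto simp: abs_le_iff)
  have Ig: "\<bar>I x - g x\<bar> \<le> 2" for x
    using gb[of x] unfolding I_def by (auto simp: abs_le_iff)
  have e: "(\<Sum>w\<in>Om. \<Sum>j\<in>J. (D w j)\<^sup>2 * (h (W (s j w)) - h (W w))) = 0" for h :: "real \<Rightarrow> real"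
    using even[of "\<lambda>x. x\<^sup>2" h] by simp
  have o: "(\<Sum>w\<in>Om. \<Sum>j\<in>J. D w j * \<bar>D w j\<bar> * (h (W (s j w)) - h (W w)))
      = - 2 * (\<Sum>w\<in>Om. h (W w) * (\<Sum>j\<in>J. D w j * \<bar>D w j\<bar>))" for h :: "real \<Rightarrow> real"
    using odd[of "\<lambda>x. x * \<bar>x\<bar>" h] by simp
  \<comment> \<open>\<open>a = 1\<close> and \<open>a = - 1\<close> give the two bounds of
    \<open>stein_remainder_bounds\<close>. The even parts vanish by \<open>e\<close>, the odd ones
    combine to a multiple of \<open>B\<close> by \<open>o\<close>.\<close>
  have cmb: "(\<Sum>w\<in>Om. \<Sum>j\<in>J. ((D w j)\<^sup>2 + a * (D w j * \<bar>D w j\<bar>)) / 2 * (g (W (s j w)) - g (W w))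
      + ((D w j)\<^sup>2 - a * (D w j * \<bar>D w j\<bar>)) / 2 * (I (W (s j w)) - I (W w))) = a * B" for a :: real
  proof -
    have "(\<Sum>w\<in>Om. \<Sum>j\<in>J. ((D w j)\<^sup>2 + a * (D w j * \<bar>D w j\<bar>)) / 2 * (g (W (s j w)) - g (W w))
      + ((D w j)\<^sup>2 - a * (D w j * \<bar>D w j\<bar>)) / 2 * (I (W (s j w)) - I (W w)))
      = (\<Sum>w\<in>Om. \<Sum>j\<in>J. (D w j)\<^sup>2 * (g (W (s j w)) - g (W w))) / 2
      + a / 2 * (\<Sum>w\<in>Om. \<Sum>j\<in>J. D w j * \<bar>D w j\<bar> * (g (W (s j w)) - g (W w)))
      + (\<Sum>w\<in>Om. \<Sum>j\<in>J. (D w j)\<^sup>2 * (I (W (s j w)) - I (W w))) / 2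
      - a / 2 * (\<Sum>w\<in>Om. \<Sum>j\<in>J. D w j * \<bar>D w j\<bar> * (I (W (s j w)) - I (W w)))"
      unfolding sum_distrib_left sum_divide_distrib sum.distrib[symmetric] sum_subtractf[symmetric]
      by (intro sum.cong refl) (simp add: field_simps)
    also have "\<dots> = a * B"
      unfolding e o B_def by (simp add: left_diff_distrib sum_subtractf right_diff_distrib)
    finally show ?thesis .
  qed
  have "(\<Sum>w\<in>Om. \<Sum>j\<in>J. D w j * R w j) \<le> 1 * B"
    unfolding cmb[symmetric]
    by (intro sum_mono)
      (use stein_remainder_bounds(1)[where z = z] in \<open>simp add: R_def D_def Psi_def g_def f_def I_def\<close>)
  moreover have "- 1 * B \<le> (\<Sum>w\<in>Om. \<Sum>j\<in>J. D w j * R w j)"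
    unfolding cmb[symmetric]
    by (intro sum_mono)
      (use stein_remainder_bounds(2)[where z = z] in \<open>simp add: R_def D_def Psi_def g_def f_def I_def\<close>)
  ultimately have R: "\<bar>\<Sum>w\<in>Om. \<Sum>j\<in>J. D w j * R w j\<bar> \<le> \<bar>B\<bar>" by linarith
  also have "\<dots> \<le> (\<Sum>w\<in>Om. 2 * \<bar>\<Sum>j\<in>J. D w j * \<bar>D w j\<bar>\<bar>)"
    unfolding B_def by (rule order_trans[OF sum_abs]) (intro sum_mono, simp add: abs_mult mult_right_mono Ig)
  finally have R: "\<bar>\<Sum>w\<in>Om. \<Sum>j\<in>J. D w j * R w j\<bar> / (2 * c) \<le> (\<Sum>w\<in>Om. \<bar>\<Sum>j\<in>J. D w j * \<bar>D w j\<bar>\<bar>) / c"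
    using c by (simp add: sum_distrib_left[symmetric] divide_simps)
  have "\<bar>\<Sum>w\<in>Om. Psi (W w) * (1 - (\<Sum>j\<in>J. (D w j)\<^sup>2) / (2 * c))\<bar>
      \<le> (\<Sum>w\<in>Om. 2 * \<bar>1 - (\<Sum>j\<in>J. (D w j)\<^sup>2) / (2 * c)\<bar>)"
    by (rule order_trans[OF sum_abs]) (intro sum_mono, simp add: abs_mult mult_right_mono Psi)
  then have "\<bar>\<Sum>w\<in>Om. I (W w) - Phi z\<bar> \<le> 2 * (\<Sum>w\<in>Om. \<bar>1 - (\<Sum>j\<in>J. (D w j)\<^sup>2) / (2 * c)\<bar>)
      + \<bar>\<Sum>w\<in>Om. \<Sum>j\<in>J. D w j * R w j\<bar> / (2 * c)"
    unfolding main sum_distrib_left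
    using c by (intro order_trans[OF abs_triangle_ineq4] add_mono) (simp_all add: abs_divide)
  with R show ?thesis unfolding I_def D_def by linarith
qed

section \<open>Poincare inequality for random transpositions\<close>

abbreviation perms :: "'a set \<Rightarrow> ('a \<Rightarrow> 'a) set" where
  "perms S \<equiv> {p. p permutes S}"

text \<open>The law of total variance for two samples of equal size: within-sample parts plus the
  squared difference of the sums.\<close>

lemma sum_cross_squares:
  fixes a b :: "'a \<Rightarrow> real"
  shows "(\<Sum>x\<in>X. \<Sum>y\<in>X. (a x - b y)\<^sup>2) =
    (\<Sum>x\<in>X. \<Sum>y\<in>X. (a x - a y)\<^sup>2) / 2 + (\<Sum>x\<in>X. \<Sum>y\<in>X. (b x - b y)\<^sup>2) / 2
      + (\<Sum>x\<in>X. b x - a x)\<^sup>2"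
proof -
  have *: "(\<Sum>x\<in>X. \<Sum>y\<in>X. (f x - g y)\<^sup>2) =
    real (card X) * (\<Sum>x\<in>X. (f x)\<^sup>2) + real (card X) * (\<Sum>x\<in>X. (g x)\<^sup>2)
      - 2 * ((\<Sum>x\<in>X. f x) * (\<Sum>x\<in>X. g x))" for f g :: "'a \<Rightarrow> real"
    by (simp add: power2_diff sum.distrib sum_subtractf mult.assoc flip: sum_distrib_left sum_distrib_right)
  show ?thesis
    unfolding * by (simp add: sum_subtractf power2_diff power2_eq_square[of "sum _ _"] field_simps)
qed

text \<open>Exchanges a swap of values, which conditioning produces, for a swap of positions, which
  defines the Dirichlet form.\<close>

lemma permutes_comp_transpose:
  assumes "p permutes S"
  shows "p \<circ> transpose i j = transpose (p i) (p j) \<circ> p"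
  by (rule ext) (simp add: Transposition.transpose_def inj_eq[OF permutes_inj[OF assms]])

text \<open>Conditioning on the value of the permutation at \<open>k\<close>: the conditional means are compared by
  swapping \<open>k\<close> with the current preimage of the other value.\<close>

lemma permutation_conditioning:
  fixes G :: "('a \<Rightarrow> 'a) \<Rightarrow> real"
  assumes fin: "finite S" and k: "k \<in> S"
  defines "S' \<equiv> S - {k}"
  shows "(\<Sum>p\<in>perms S. \<Sum>p'\<in>perms S. (G p - G p')\<^sup>2)
    \<le> real (card S) * (\<Sum>l\<in>S. \<Sum>q\<in>perms S'. \<Sum>q'\<in>perms S'.
          (G (transpose k l \<circ> q) - G (transpose k l \<circ> q'))\<^sup>2)
      + real (card (perms S')) * (\<Sum>i\<in>S. \<Sum>p\<in>perms S. (G (p \<circ> transpose k i) - G p)\<^sup>2)"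
proof -
  let ?G = "\<lambda>l q. G (transpose k l \<circ> q)"
  let ?V = "\<lambda>l. \<Sum>q\<in>perms S'. \<Sum>q'\<in>perms S'. (?G l q - ?G l q')\<^sup>2"
  have S: "S = insert k S'" and k': "k \<notin> S'" and fin': "finite S'" "finite (perms S')"
    using k fin by (auto simp: S'_def intro: finite_permutations)
  have split: "(\<Sum>p\<in>perms S. h p) = (\<Sum>l\<in>S. \<Sum>q\<in>perms S'. h (transpose k l \<circ> q))"
    for h :: "('a \<Rightarrow> 'a) \<Rightarrow> real"
    unfolding S by (rule sum_over_permutations_insert[OF fin'(1) k'])
  have couple: "(\<Sum>q\<in>perms S'. ?G m q) = (\<Sum>q\<in>perms S'. G (transpose l m \<circ> (transpose k l \<circ> q)))"
    if "l \<in> S" "m \<in> S" for l m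
  proof -
    \<comment> \<open>Composition with \<open>s\<close> makes a single left transposition change the
      value at \<open>k\<close> from \<open>l\<close> to \<open>m\<close>. As \<open>s\<close> fixes
      \<open>k\<close>, it merely reindexes the permutations of \<open>S'\<close>.\<close>
    define s where "s = transpose k m \<circ> transpose l m \<circ> transpose k l"
    have "s permutes S"
      unfolding s_def using that k by (intro permutes_compose permutes_swap_id)
    moreover have "s k = k" by (simp add: s_def)
    ultimately have "s permutes S'"
      by (simp add: permutes_def S'_def) (metis permutes_def)
    then have "(\<Sum>q\<in>perms S'. ?G m q) = (\<Sum>q\<in>perms S'. ?G m (s \<circ> q))"
      by (rule setum_permutations_compose_left)
    moreover have "transpose k m \<circ> (s \<circ> q) = transpose l m \<circ> (transpose k l \<circ> q)" for q :: "'a \<Rightarrow> 'a"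
      by (simp add: s_def fun_eq_iff)
    ultimately show ?thesis by (simp only:)
  qed
  have "(\<Sum>p\<in>perms S. \<Sum>p'\<in>perms S. (G p - G p')\<^sup>2)
      = (\<Sum>l\<in>S. \<Sum>m\<in>S. \<Sum>q\<in>perms S'. \<Sum>q'\<in>perms S'. (?G l q - ?G m q')\<^sup>2)"
    unfolding split by (rule sum.cong[OF refl], rule sum.swap)
  also have "\<dots> = (\<Sum>l\<in>S. \<Sum>m\<in>S. ?V l / 2 + ?V m / 2 + (\<Sum>q\<in>perms S'. ?G m q - ?G l q)\<^sup>2)"
    by (intro sum.cong refl sum_cross_squares)
  also have "\<dots> = real (card S) * (\<Sum>l\<in>S. ?V l) + (\<Sum>l\<in>S. \<Sum>m\<in>S. (\<Sum>q\<in>perms S'. ?G m q - ?G l q)\<^sup>2)"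
    by (simp add: sum.distrib sum_divide_distrib[symmetric] sum_distrib_left[symmetric])
  finally have decomp: "(\<Sum>p\<in>perms S. \<Sum>p'\<in>perms S. (G p - G p')\<^sup>2)
      = real (card S) * (\<Sum>l\<in>S. ?V l) + (\<Sum>l\<in>S. \<Sum>m\<in>S. (\<Sum>q\<in>perms S'. ?G m q - ?G l q)\<^sup>2)" .
  have "(\<Sum>l\<in>S. \<Sum>m\<in>S. (\<Sum>q\<in>perms S'. ?G m q - ?G l q)\<^sup>2)
      \<le> (\<Sum>l\<in>S. \<Sum>m\<in>S. real (card (perms S')) *
          (\<Sum>q\<in>perms S'. (G (transpose l m \<circ> (transpose k l \<circ> q)) - G (transpose k l \<circ> q))\<^sup>2))"
  proof (intro sum_mono)
    fix l m assume lm: "l \<in> S" "m \<in> S"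
    \<comment> \<open>Cauchy-Schwarz against the constant 1 replaces the difference of conditional
      means by squared increments along the coupling.\<close>
    have "(\<Sum>q\<in>perms S'. ?G m q - ?G l q)\<^sup>2
       = (\<Sum>q\<in>perms S'. (G (transpose l m \<circ> (transpose k l \<circ> q)) - G (transpose k l \<circ> q)) * 1)\<^sup>2"
      by (simp add: sum_subtractf couple[OF lm])
    also have "\<dots> \<le> (\<Sum>q\<in>perms S'. (G (transpose l m \<circ> (transpose k l \<circ> q)) - G (transpose k l \<circ> q))\<^sup>2)
       * (\<Sum>q\<in>perms S'. 1\<^sup>2)"
      by (rule Cauchy_Schwarz_ineq_sum)
    finally show "(\<Sum>q\<in>perms S'. ?G m q - ?G l q)\<^sup>2 \<le> real (card (perms S')) *
          (\<Sum>q\<in>perms S'. (G (transpose l m \<circ> (transpose k l \<circ> q)) - G (transpose k l \<circ> q))\<^sup>2)"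
      by (simp add: mult.commute)
  qed
  also have "\<dots> = real (card (perms S')) * (\<Sum>l\<in>S. \<Sum>q\<in>perms S'. \<Sum>m\<in>S.
      (G (transpose l m \<circ> (transpose k l \<circ> q)) - G (transpose k l \<circ> q))\<^sup>2)"
    unfolding sum_distrib_left by (rule sum.cong[OF refl], rule sum.swap)
  \<comment> \<open>Since \<open>q\<close> fixes \<open>k\<close>, the permutation
    \<open>transpose k l \<circ> q\<close> sends \<open>k\<close> to \<open>l\<close>. Hence
    \<open>l\<close> can be read off it, and the sums over \<open>l\<close> and \<open>q\<close>
    recombine into one over \<open>perms S\<close>.\<close>
  also have "(\<Sum>l\<in>S. \<Sum>q\<in>perms S'. \<Sum>m\<in>S. (G (transpose l m \<circ> (transpose k l \<circ> q)) - G (transpose k l \<circ> q))\<^sup>2)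
     = (\<Sum>l\<in>S. \<Sum>q\<in>perms S'. \<Sum>m\<in>S. (G (transpose ((transpose k l \<circ> q) k) m \<circ> (transpose k l \<circ> q)) - G (transpose k l \<circ> q))\<^sup>2)"
  proof (intro sum.cong refl)
    fix l q m assume "q \<in> perms S'"
    then have "q k = k" using k' by (auto simp: permutes_def)
    then show "(G (transpose l m \<circ> (transpose k l \<circ> q)) - G (transpose k l \<circ> q))\<^sup>2
      = (G (transpose ((transpose k l \<circ> q) k) m \<circ> (transpose k l \<circ> q)) - G (transpose k l \<circ> q))\<^sup>2"
      by simp
  qed
  also have "\<dots> = (\<Sum>p\<in>perms S. \<Sum>m\<in>S. (G (transpose (p k) m \<circ> p) - G p)\<^sup>2)"
    by (rule split[symmetric])
  also have "\<dots> = (\<Sum>p\<in>perms S. \<Sum>i\<in>S. (G (p \<circ> transpose k i) - G p)\<^sup>2)"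
  proof (rule sum.cong[OF refl])
    fix p assume "p \<in> perms S"
    then have p: "p permutes S" by simp
    have "(\<Sum>m\<in>S. (G (transpose (p k) m \<circ> p) - G p)\<^sup>2) = (\<Sum>i\<in>S. (G (transpose (p k) (p i) \<circ> p) - G p)\<^sup>2)"
      by (rule sum.reindex_bij_betw[OF permutes_imp_bij[OF p], symmetric])
    then show "(\<Sum>m\<in>S. (G (transpose (p k) m \<circ> p) - G p)\<^sup>2) = (\<Sum>i\<in>S. (G (p \<circ> transpose k i) - G p)\<^sup>2)"
      by (simp only: permutes_comp_transpose[OF p])
  qed
  also have "\<dots> = (\<Sum>i\<in>S. \<Sum>p\<in>perms S. (G (p \<circ> transpose k i) - G p)\<^sup>2)"
    by (rule sum.swap)
  finally show ?thesis unfolding decomp by (simp add: comp_def)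
qed

text \<open>With \<open>card S = n + 1\<close>, conditioning at a single \<open>k\<close>
  overweights the transpositions that avoid \<open>k\<close>: they get the factor n + 1 in place of
  n. Summing over all \<open>k\<close> repairs this, and the induction closes because (n + 1) (n -
  1) + n \<le> n (n + 1).\<close>

theorem permutation_poincare:
  fixes G :: "('a \<Rightarrow> 'a) \<Rightarrow> real"
  assumes "finite S"
  shows "real (card S) * (\<Sum>p\<in>perms S. \<Sum>p'\<in>perms S. (G p - G p')\<^sup>2)
    \<le> real (card (perms S)) * (\<Sum>i\<in>S. \<Sum>j\<in>S. \<Sum>p\<in>perms S. (G (p \<circ> transpose i j) - G p)\<^sup>2)"
  using assms
proof (induction "card S" arbitrary: S G)
  case 0
  then show ?case by simp
next
  case (Suc n)
  define T where "T = (\<Sum>p\<in>perms S. \<Sum>p'\<in>perms S. (G p - G p')\<^sup>2)"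
  define E where "E = (\<lambda>i j. \<Sum>p\<in>perms S. (G (p \<circ> transpose i j) - G p)\<^sup>2)"
  define E2 where "E2 = (\<Sum>i\<in>S. \<Sum>j\<in>S. E i j)"
  have card: "card S = Suc n" and fin: "finite S" using Suc by auto
  have E0: "E i i = 0" for i by (simp add: E_def)
  have Enn: "0 \<le> E i j" for i j by (simp add: E_def sum_nonneg)
  then have E2nn: "0 \<le> E2" by (simp add: E2_def sum_nonneg)
  have cP: "card (perms S) = fact (Suc n)" using card_permutations[OF card fin] .
  have goal: "real (Suc n) * T \<le> real (card (perms S)) * E2"
  \<comment> \<open>The last cancellation divides by \<open>n\<close>, so a one-point set is treated
    apart.\<close>
  proof (cases "n = 0")
    case True
    then have "card (perms S) = 1" using cP by simp
    then obtain p where "perms S = {p}" by (auto simp: card_1_singleton_iff)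
    then have "T = 0" by (simp add: T_def)
    then show ?thesis using E2nn by simp
  next
    case False
    have step: "real n * T \<le> real (Suc n) * (fact n * (\<Sum>i\<in>S - {k}. \<Sum>j\<in>S - {k}. E i j))
        + real n * (fact n * (\<Sum>i\<in>S. E k i))" if k: "k \<in> S" for k
    proof -
      let ?S = "S - {k}"
      have c': "card ?S = n" and fin': "finite ?S" using card fin k by auto
      have cP': "card (perms ?S) = fact n" by (rule card_permutations[OF c' fin'])
      have S: "insert k ?S = S" using k by auto
      have split: "(\<Sum>p\<in>perms S. h p) = (\<Sum>l\<in>S. \<Sum>q\<in>perms ?S. h (transpose k l \<circ> q))"
        for h :: "('a \<Rightarrow> 'a) \<Rightarrow> real"
        using sum_over_permutations_insert[OF fin', of k h] by (simp only: S Diff_iff singleton_iff simp_thms)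
      have ih: "real n * (\<Sum>q\<in>perms ?S. \<Sum>q'\<in>perms ?S. (G (transpose k l \<circ> q) - G (transpose k l \<circ> q'))\<^sup>2)
        \<le> fact n * (\<Sum>i\<in>?S. \<Sum>j\<in>?S. \<Sum>q\<in>perms ?S. (G ((transpose k l \<circ> q) \<circ> transpose i j) - G (transpose k l \<circ> q))\<^sup>2)" for l
        using Suc.hyps(1)[OF c'[symmetric] fin', of "\<lambda>q. G (transpose k l \<circ> q)"]
        unfolding c' cP' by (simp add: o_assoc)
      have "real n * (\<Sum>l\<in>S. \<Sum>q\<in>perms ?S. \<Sum>q'\<in>perms ?S. (G (transpose k l \<circ> q) - G (transpose k l \<circ> q'))\<^sup>2)
        \<le> (\<Sum>l\<in>S. fact n * (\<Sum>i\<in>?S. \<Sum>j\<in>?S. \<Sum>q\<in>perms ?S. (G ((transpose k l \<circ> q) \<circ> transpose i j) - G (transpose k l \<circ> q))\<^sup>2))"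
        unfolding sum_distrib_left[of "real n" _ S] by (intro sum_mono ih)
      also have "\<dots> = fact n * (\<Sum>i\<in>?S. \<Sum>j\<in>?S. \<Sum>l\<in>S. \<Sum>q\<in>perms ?S. (G ((transpose k l \<circ> q) \<circ> transpose i j) - G (transpose k l \<circ> q))\<^sup>2)"
        unfolding sum_distrib_left[symmetric]
        by (subst sum.swap) (simp only: sum.swap[of _ S ?S])
      also have "\<dots> = fact n * (\<Sum>i\<in>?S. \<Sum>j\<in>?S. E i j)"
        unfolding E_def split ..
      finally have *: "real n * (\<Sum>l\<in>S. \<Sum>q\<in>perms ?S. \<Sum>q'\<in>perms ?S. (G (transpose k l \<circ> q) - G (transpose k l \<circ> q'))\<^sup>2)
        \<le> fact n * (\<Sum>i\<in>?S. \<Sum>j\<in>?S. E i j)" .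
      have "real n * T \<le> real n * (real (Suc n) * (\<Sum>l\<in>S. \<Sum>q\<in>perms ?S. \<Sum>q'\<in>perms ?S.
          (G (transpose k l \<circ> q) - G (transpose k l \<circ> q'))\<^sup>2) + fact n * (\<Sum>i\<in>S. E k i))"
        unfolding T_def E_def using permutation_conditioning[OF fin k, of G] cP' card
        by (intro mult_left_mono) auto
      also have "\<dots> = real (Suc n) * (real n * (\<Sum>l\<in>S. \<Sum>q\<in>perms ?S. \<Sum>q'\<in>perms ?S.
          (G (transpose k l \<circ> q) - G (transpose k l \<circ> q'))\<^sup>2)) + real n * (fact n * (\<Sum>i\<in>S. E k i))"
        by (simp only: distrib_left mult_ac)
      also have "\<dots> \<le> real (Suc n) * (fact n * (\<Sum>i\<in>?S. \<Sum>j\<in>?S. E i j)) + real n * (fact n * (\<Sum>i\<in>S. E k i))"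
        by (intro add_mono mult_left_mono *) auto
      finally show ?thesis .
    qed
    \<comment> \<open>Inclusion-exclusion: a pair of distinct indices avoids \<open>n - 1\<close> of
      the \<open>n + 1\<close> choices of \<open>k\<close>, and the diagonal contributes nothing by
      \<open>E0\<close>.\<close>
    have rem: "(\<Sum>k\<in>S. \<Sum>i\<in>S - {k}. \<Sum>j\<in>S - {k}. E i j) = (real n - 1) * E2"
    proof -
      have "(\<Sum>i\<in>S - {k}. \<Sum>j\<in>S - {k}. E i j) = E2 - (\<Sum>i\<in>S. E i k) - (\<Sum>j\<in>S. E k j)" if "k \<in> S" for k
        using that fin E0 by (simp add: E2_def sum_diff1 sum_subtractf)
      then have "(\<Sum>k\<in>S. \<Sum>i\<in>S - {k}. \<Sum>j\<in>S - {k}. E i j)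
         = (\<Sum>k\<in>S. E2 - (\<Sum>i\<in>S. E i k) - (\<Sum>j\<in>S. E k j))" by simp
      also have "\<dots> = real (Suc n) * E2 - (\<Sum>k\<in>S. \<Sum>i\<in>S. E i k) - E2"
        by (simp add: sum_subtractf card E2_def)
      also have "(\<Sum>k\<in>S. \<Sum>i\<in>S. E i k) = E2" unfolding E2_def by (rule sum.swap)
      finally show ?thesis by (simp add: algebra_simps)
    qed
    have "real (Suc n) * (real n * T) = (\<Sum>k\<in>S. real n * T)" by (simp add: card)
    also have "\<dots> \<le> (\<Sum>k\<in>S. real (Suc n) * (fact n * (\<Sum>i\<in>S - {k}. \<Sum>j\<in>S - {k}. E i j))
        + real n * (fact n * (\<Sum>i\<in>S. E k i)))"
      by (intro sum_mono step)
    also have "\<dots> = real (Suc n) * (fact n * ((real n - 1) * E2)) + real n * (fact n * E2)"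
      unfolding sum.distrib sum_distrib_left[symmetric] rem E2_def ..
    also have "\<dots> \<le> real n * (real (Suc n) * (fact n * E2))"
    proof -
      have "0 \<le> fact n * E2" using E2nn by simp
      then show ?thesis by (simp add: algebra_simps)
    qed
    finally have "real n * (real (Suc n) * T) \<le> real n * (real (Suc n) * (fact n * E2))"
      by (simp only: mult_ac)
    then have "real (Suc n) * T \<le> real (Suc n) * (fact n * E2)"
      using False by simp
    then show ?thesis by (simp add: cP algebra_simps)
  qed
  then show ?case unfolding T_def E2_def E_def card .
qed

section \<open>Combinatorial Berry--Esseen bound\<close>

definition perm_stat :: "'a set \<Rightarrow> ('a \<Rightarrow> 'a \<Rightarrow> real) \<Rightarrow> ('a \<Rightarrow> 'a) \<Rightarrow> real" where
  "perm_stat S A p = (\<Sum>i\<in>S. A i (p i))"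

definition swap_diff :: "('a \<Rightarrow> 'a \<Rightarrow> real) \<Rightarrow> 'a \<Rightarrow> 'a \<Rightarrow> ('a \<Rightarrow> 'a) \<Rightarrow> real" where
  "swap_diff A i j p = A i (p j) + A j (p i) - A i (p i) - A j (p j)"

lemma perm_stat_transpose:
  assumes fin: "finite S" and "i \<in> S" "j \<in> S"
  shows "perm_stat S A (p \<circ> transpose i j) - perm_stat S A p = swap_diff A i j p"
proof (cases "i = j")
  case True
  then show ?thesis by (simp add: swap_diff_def)
next
  case False
  have "perm_stat S A q = A i (q i) + (A j (q j) + (\<Sum>k\<in>S - {i} - {j}. A k (q k)))" for q
    unfolding perm_stat_def using assms False by (simp add: sum.remove[of S i] sum.remove[of "S - {i}" j])
  moreover have "(\<Sum>k\<in>S - {i} - {j}. A k ((p \<circ> transpose i j) k)) = (\<Sum>k\<in>S - {i} - {j}. A k (p k))"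
    by (intro sum.cong refl) (auto simp: Transposition.transpose_def)
  ultimately show ?thesis by (simp add: swap_diff_def)
qed

section \<open>Moments of the permutation statistic\<close>

text \<open>The linearity hypothesis of the Stein bound, with \<open>c = 2 * real (card S)\<close>:
  the two crossed terms of \<open>swap_diff\<close> each sum to the total of \<open>A\<close>, which
  is 0.\<close>

lemma sum_swap_diff:
  assumes "finite S" "p permutes S" and A0: "(\<Sum>i\<in>S. \<Sum>j\<in>S. A i j) = 0"
  shows "(\<Sum>i\<in>S. \<Sum>j\<in>S. swap_diff A i j p) = - (2 * real (card S)) * perm_stat S A p"
proof -
  have p: "(\<Sum>j\<in>S. h (p j)) = (\<Sum>j\<in>S. h j)" for h :: "'a \<Rightarrow> real"
    by (rule sum.reindex_bij_betw[OF permutes_imp_bij[OF assms(2)]])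
  have "(\<Sum>i\<in>S. \<Sum>j\<in>S. A j (p i)) = (\<Sum>k\<in>S. \<Sum>j\<in>S. A j k)" by (rule p)
  also have "\<dots> = 0" using A0 by (subst sum.swap)
  finally have "(\<Sum>i\<in>S. \<Sum>j\<in>S. A j (p i)) = 0" .
  then show ?thesis
    using A0 by (simp add: swap_diff_def sum_subtractf sum.distrib p perm_stat_def sum_distrib_left mult.assoc)
qed

lemma perms_transpose_invariant:
  assumes "i \<in> S" "j \<in> S"
  shows "(\<Sum>p\<in>perms S. h (p \<circ> transpose i j)) = (\<Sum>p\<in>perms S. h p)"
  using sum_permutations_compose_right[OF permutes_swap_id[OF assms], of h] by simp

text \<open>The identity E \<Delta>^2 = 2 \<lambda> E W^2 of an exchangeable pair: invariance of the
  second moment under the swap gives E \<Delta>^2 = -2 E(W \<Delta>), and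
  \<open>sum_swap_diff\<close> evaluates the right side.\<close>

lemma sum_swap_diff_squares:
  assumes fin: "finite S" and A0: "(\<Sum>i\<in>S. \<Sum>j\<in>S. A i j) = 0"
  shows "(\<Sum>p\<in>perms S. \<Sum>i\<in>S. \<Sum>j\<in>S. (swap_diff A i j p)\<^sup>2)
    = 4 * real (card S) * (\<Sum>p\<in>perms S. (perm_stat S A p)\<^sup>2)"
proof -
  let ?W = "perm_stat S A"
  have "(\<Sum>p\<in>perms S. (swap_diff A i j p)\<^sup>2) = - 2 * (\<Sum>p\<in>perms S. ?W p * swap_diff A i j p)"
    if "i \<in> S" "j \<in> S" for i j
  proof -
    have "(\<Sum>p\<in>perms S. (?W (p \<circ> transpose i j))\<^sup>2) = (\<Sum>p\<in>perms S. (?W p)\<^sup>2)"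
      by (rule perms_transpose_invariant[OF that])
    moreover have "?W (p \<circ> transpose i j) = ?W p + swap_diff A i j p" for p
      using perm_stat_transpose[OF fin that, of A p] by simp
    ultimately have "(\<Sum>p\<in>perms S. (?W p + swap_diff A i j p)\<^sup>2) = (\<Sum>p\<in>perms S. (?W p)\<^sup>2)" by simp
    then show ?thesis by (simp add: power2_sum sum.distrib mult.assoc flip: sum_distrib_left)
  qed
  then have "(\<Sum>i\<in>S. \<Sum>j\<in>S. \<Sum>p\<in>perms S. (swap_diff A i j p)\<^sup>2)
     = (\<Sum>i\<in>S. \<Sum>j\<in>S. - 2 * (\<Sum>p\<in>perms S. ?W p * swap_diff A i j p))" by simp
  also have "\<dots> = - 2 * (\<Sum>p\<in>perms S. ?W p * (\<Sum>i\<in>S. \<Sum>j\<in>S. swap_diff A i j p))"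
    by (simp add: sum_distrib_left sum.swap[of _ "perms S" S])
  also have "\<dots> = 4 * real (card S) * (\<Sum>p\<in>perms S. (?W p)\<^sup>2)"
    by (simp add: sum_swap_diff[OF fin _ A0] sum_distrib_left power2_eq_square mult_ac sum_negf)
  finally show ?thesis by (simp add: sum.swap[of _ "perms S" S])
qed

text \<open>Each increment has mean zero by invariance, while together they add up to a nonzero
  multiple of the statistic.\<close>

lemma perm_stat_mean:
  assumes fin: "finite S" and ne: "S \<noteq> {}" and A0: "(\<Sum>i\<in>S. \<Sum>j\<in>S. A i j) = 0"
  shows "(\<Sum>p\<in>perms S. perm_stat S A p) = 0"
proof -
  have "(\<Sum>p\<in>perms S. swap_diff A i j p) = 0" if "i \<in> S" "j \<in> S" for i j
    using perms_transpose_invariant[OF that, of "perm_stat S A"]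
    by (simp add: sum_subtractf flip: perm_stat_transpose[OF fin that])
  then have "0 = (\<Sum>i\<in>S. \<Sum>j\<in>S. \<Sum>p\<in>perms S. swap_diff A i j p)" by simp
  also have "\<dots> = (\<Sum>p\<in>perms S. \<Sum>i\<in>S. \<Sum>j\<in>S. swap_diff A i j p)"
    by (simp only: sum.swap[of _ "perms S" S])
  also have "\<dots> = - (2 * real (card S)) * (\<Sum>p\<in>perms S. perm_stat S A p)"
    unfolding sum_distrib_left by (intro sum.cong refl sum_swap_diff[OF fin _ A0]) simp
  finally show ?thesis using fin ne by simp
qed

text \<open>The mean of the squared increments is known from \<open>sum_swap_diff_squares\<close>;
  expanding the squares gives a second expression, and equating the two yields a linear equation for
  the second moment. Only columns are centred, so squared row sums remain as a correction.\<close>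

theorem perm_stat_variance:
  assumes fin: "finite S" and ne: "S \<noteq> {}" and col: "\<And>k. k \<in> S \<Longrightarrow> (\<Sum>i\<in>S. A i k) = 0"
  shows "(real (card S) - 1) * (\<Sum>p\<in>perms S. (perm_stat S A p)\<^sup>2)
    = real (card (perms S)) * ((\<Sum>i\<in>S. \<Sum>k\<in>S. (A i k)\<^sup>2) - (\<Sum>i\<in>S. (\<Sum>k\<in>S. A i k)\<^sup>2) / real (card S))"
proof -
  let ?n = "real (card S)" and ?P = "real (card (perms S))" and ?W = "perm_stat S A"
  let ?E = "\<lambda>h. \<Sum>p\<in>perms S. h p :: real"
  let ?Q = "\<Sum>i\<in>S. \<Sum>k\<in>S. (A i k)\<^sup>2"
  define r where "r = (\<lambda>i. \<Sum>k\<in>S. A i k)"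
  have n0: "?n > 0" using fin ne by (simp add: card_gt_0_iff)
  have A0: "(\<Sum>i\<in>S. \<Sum>j\<in>S. A i j) = 0"
    using col by (subst sum.swap) simp
  have reidx: "(\<Sum>j\<in>S. h (p j)) = (\<Sum>j\<in>S. h j)" if "p \<in> perms S" for h :: "'a \<Rightarrow> real" and p
    using that by (intro sum.reindex_bij_betw permutes_imp_bij) simp
  have marg: "?E (\<lambda>p. h (p i)) = ?P * (\<Sum>k\<in>S. h k) / ?n" if "i \<in> S" for h :: "'a \<Rightarrow> real" and i
  proof -
    have "?E (\<lambda>p. h (p j)) = ?E (\<lambda>p. h (p i))" if "j \<in> S" for j
      using perms_transpose_invariant[OF that \<open>i \<in> S\<close>, of "\<lambda>p. h (p i)"] by simp
    then have "?n * ?E (\<lambda>p. h (p i)) = (\<Sum>j\<in>S. ?E (\<lambda>p. h (p j)))" by simp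
    also have "\<dots> = ?P * (\<Sum>k\<in>S. h k)"
      by (subst sum.swap) (simp add: reidx)
    finally show ?thesis using n0 by (simp add: field_simps)
  qed
  \<comment> \<open>Swapping \<open>i\<close> and \<open>j\<close> turns these products into
    \<open>A i (p i) * A j (p j)\<close>, so they return the second moment; this avoids the joint
    law of two values of \<open>p\<close>.\<close>
  have cross: "?E (\<lambda>p. \<Sum>i\<in>S. \<Sum>j\<in>S. A i (p j) * A j (p i)) = ?E (\<lambda>p. (?W p)\<^sup>2)"
  proof -
    have "?E (\<lambda>p. A i (p j) * A j (p i)) = ?E (\<lambda>p. A i (p i) * A j (p j))" if "i \<in> S" "j \<in> S" for i j
      using perms_transpose_invariant[OF that, of "\<lambda>p. A i (p i) * A j (p j)"] by simp
    then have "(\<Sum>i\<in>S. \<Sum>j\<in>S. ?E (\<lambda>p. A i (p j) * A j (p i))) = (\<Sum>i\<in>S. \<Sum>j\<in>S. ?E (\<lambda>p. A i (p i) * A j (p j)))"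
      by simp
    then show ?thesis
      by (simp add: sum.swap[of _ "perms S" S] perm_stat_def power2_eq_square sum_product)
  qed
  have expand: "(\<Sum>i\<in>S. \<Sum>j\<in>S. (swap_diff A i j p)\<^sup>2) = 2 * ?Q + 2 * ?n * (\<Sum>i\<in>S. (A i (p i))\<^sup>2)
      + 2 * (\<Sum>i\<in>S. \<Sum>j\<in>S. A i (p j) * A j (p i)) + 2 * (?W p)\<^sup>2 - 4 * (\<Sum>i\<in>S. A i (p i) * r i)"
    if p: "p \<in> perms S" for p
  proof -
    have pS: "p i \<in> S" if "i \<in> S" for i using p that by (simp add: permutes_in_image)
    have q1: "(\<Sum>i\<in>S. \<Sum>j\<in>S. (A i (p j))\<^sup>2) = ?Q" using reidx[OF p, of "\<lambda>k. (A _ k)\<^sup>2"] by simp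
    have q2: "(\<Sum>i\<in>S. \<Sum>j\<in>S. (A j (p i))\<^sup>2) = ?Q" using q1 by (subst sum.swap)
    have c1: "(\<Sum>i\<in>S. \<Sum>j\<in>S. A i (p j) * A i (p i)) = (\<Sum>i\<in>S. A i (p i) * r i)"
      unfolding sum_distrib_right[symmetric] by (simp add: reidx[OF p] r_def mult.commute)
    have c2: "(\<Sum>i\<in>S. \<Sum>j\<in>S. A j (p i) * A j (p j)) = (\<Sum>i\<in>S. A i (p i) * r i)"
      using c1 by (subst sum.swap)
    have c3: "(\<Sum>i\<in>S. \<Sum>j\<in>S. A j (p i) * A i (p i)) = 0"
      by (simp add: sum_distrib_right[symmetric] col pS)
    have c4: "(\<Sum>i\<in>S. \<Sum>j\<in>S. A i (p j) * A j (p j)) = 0"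
      using c3 by (subst sum.swap)
    have "(swap_diff A i j p)\<^sup>2 = (A i (p j))\<^sup>2 + (A j (p i))\<^sup>2 + (A i (p i))\<^sup>2 + (A j (p j))\<^sup>2
       + 2 * (A i (p j) * A j (p i)) + 2 * (A i (p i) * A j (p j))
       - 2 * (A i (p j) * A i (p i)) - 2 * (A i (p j) * A j (p j))
       - 2 * (A j (p i) * A i (p i)) - 2 * (A j (p i) * A j (p j))" for i j
      by (simp add: swap_diff_def power2_eq_square algebra_simps)
    then have "(\<Sum>i\<in>S. \<Sum>j\<in>S. (swap_diff A i j p)\<^sup>2) = (\<Sum>i\<in>S. \<Sum>j\<in>S. (A i (p j))\<^sup>2) + (\<Sum>i\<in>S. \<Sum>j\<in>S. (A j (p i))\<^sup>2)
       + (\<Sum>i\<in>S. \<Sum>j\<in>S. (A i (p i))\<^sup>2) + (\<Sum>i\<in>S. \<Sum>j\<in>S. (A j (p j))\<^sup>2)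
       + 2 * (\<Sum>i\<in>S. \<Sum>j\<in>S. A i (p j) * A j (p i)) + 2 * (\<Sum>i\<in>S. \<Sum>j\<in>S. A i (p i) * A j (p j))
       - 2 * (\<Sum>i\<in>S. \<Sum>j\<in>S. A i (p j) * A i (p i)) - 2 * (\<Sum>i\<in>S. \<Sum>j\<in>S. A i (p j) * A j (p j))
       - 2 * (\<Sum>i\<in>S. \<Sum>j\<in>S. A j (p i) * A i (p i)) - 2 * (\<Sum>i\<in>S. \<Sum>j\<in>S. A j (p i) * A j (p j))"
      by (simp only: sum.distrib sum_subtractf sum_distrib_left)
    then show ?thesis
      unfolding q1 q2 c1 c2 c3 c4
      by (simp add: perm_stat_def power2_eq_square[of "sum _ _"] sum_product sum_distrib_left[symmetric])
  qed
  have "4 * ?n * ?E (\<lambda>p. (?W p)\<^sup>2) = ?E (\<lambda>p. \<Sum>i\<in>S. \<Sum>j\<in>S. (swap_diff A i j p)\<^sup>2)"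
    by (rule sum_swap_diff_squares[OF fin A0, symmetric])
  also have "\<dots> = ?E (\<lambda>p. 2 * ?Q + 2 * ?n * (\<Sum>i\<in>S. (A i (p i))\<^sup>2)
      + 2 * (\<Sum>i\<in>S. \<Sum>j\<in>S. A i (p j) * A j (p i)) + 2 * (?W p)\<^sup>2 - 4 * (\<Sum>i\<in>S. A i (p i) * r i))"
    by (intro sum.cong refl expand)
  also have "\<dots> = 2 * ?P * ?Q + 2 * ?n * (\<Sum>i\<in>S. ?E (\<lambda>p. (A i (p i))\<^sup>2))
      + 4 * ?E (\<lambda>p. (?W p)\<^sup>2) - 4 * (\<Sum>i\<in>S. ?E (\<lambda>p. A i (p i)) * r i)"
    unfolding sum_subtractf sum.distrib sum_distrib_left[symmetric] cross
    by (simp add: sum.swap[of _ "perms S" S] sum_distrib_right)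
  also have "(\<Sum>i\<in>S. ?E (\<lambda>p. (A i (p i))\<^sup>2)) = ?P * ?Q / ?n"
    by (simp add: marg[of _ "\<lambda>k. (A _ k)\<^sup>2"] sum_divide_distrib[symmetric] sum_distrib_left[symmetric])
  also have "(\<Sum>i\<in>S. ?E (\<lambda>p. A i (p i)) * r i) = ?P * (\<Sum>i\<in>S. (r i)\<^sup>2) / ?n"
  proof -
    have "?E (\<lambda>p. A i (p i)) = ?P * r i / ?n" if "i \<in> S" for i
      using marg[OF that, of "A i"] by (simp add: r_def)
    then show ?thesis
      by (simp add: sum_divide_distrib sum_distrib_left power2_eq_square mult.assoc)
  qed
  finally have eq: "4 * ?n * ?E (\<lambda>p. (?W p)\<^sup>2) = 2 * ?P * ?Q + 2 * ?n * (?P * ?Q / ?n)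
      + 4 * ?E (\<lambda>p. (?W p)\<^sup>2) - 4 * (?P * (\<Sum>i\<in>S. (r i)\<^sup>2) / ?n)" .
  have "2 * ?n * (?P * ?Q / ?n) = 2 * ?P * ?Q" using n0 by simp
  with eq have "(?n - 1) * ?E (\<lambda>p. (?W p)\<^sup>2) = ?P * (?Q - (\<Sum>i\<in>S. (r i)\<^sup>2) / ?n)"
    unfolding left_diff_distrib right_diff_distrib times_divide_eq_right by linarith
  then show ?thesis unfolding r_def .
qed


section \<open>Mean deviation of functions of the increments\<close>

lemma abs_swap_diff_le:
  assumes "p permutes S" "i \<in> S" "j \<in> S" and "\<And>i k. i \<in> S \<Longrightarrow> k \<in> S \<Longrightarrow> \<bar>A i k\<bar> \<le> \<delta>"
  shows "\<bar>swap_diff A i j p\<bar> \<le> 4 * \<delta>"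
proof -
  have "p i \<in> S" "p j \<in> S" using assms(1-3) by (auto simp: permutes_in_image)
  then have "\<bar>A i (p j)\<bar> \<le> \<delta>" "\<bar>A j (p i)\<bar> \<le> \<delta>" "\<bar>A i (p i)\<bar> \<le> \<delta>" "\<bar>A j (p j)\<bar> \<le> \<delta>"
    using assms by auto
  then show ?thesis unfolding swap_diff_def by linarith
qed

text \<open>Each affected value of \<phi> is at most \<open>4 * \<delta>\<close> times an increment.
  Keeping squared increments on the right, rather than further powers of \<delta>, lets their mean
  be evaluated exactly later. The constant is 8^2 * 4: twice \<open>4 * \<delta>\<close> by symmetry
  in \<open>k\<close> and \<open>l\<close>, and 4 from squaring a sum of four terms.\<close>

lemma sum_quadratic_swap_diff_increment:
  fixes \<phi> :: "real \<Rightarrow> real"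
  assumes fin: "finite S" and ij: "i \<in> S" "j \<in> S" and p: "p permutes S"
    and A: "\<And>i k. i \<in> S \<Longrightarrow> k \<in> S \<Longrightarrow> \<bar>A i k\<bar> \<le> \<delta>"
    and \<phi>: "\<And>x. \<bar>\<phi> x\<bar> \<le> x\<^sup>2"
  defines "G \<equiv> \<lambda>p. \<Sum>k\<in>S. \<Sum>l\<in>S. \<phi> (swap_diff A k l p)"
  defines "p' \<equiv> p \<circ> transpose i j"
  shows "(G p' - G p)\<^sup>2 \<le> 256 * \<delta>\<^sup>2 * real (card S) * (\<Sum>l\<in>S. (swap_diff A i l p')\<^sup>2 + (swap_diff A i l p)\<^sup>2
     + (swap_diff A j l p')\<^sup>2 + (swap_diff A j l p)\<^sup>2)"
proof -
  let ?D = "swap_diff A"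
  have p': "p' permutes S" unfolding p'_def using p ij by (intro permutes_compose permutes_swap_id)
  have "0 \<le> \<bar>A i i\<bar>" by simp
  also have "\<dots> \<le> \<delta>" using A ij by blast
  finally have d0: "0 \<le> \<delta>" .
  have sym: "?D k l q = ?D l k q" for k l q by (simp add: swap_diff_def)
  define h where "h = (\<lambda>k l. \<bar>?D k l p'\<bar> + \<bar>?D k l p\<bar>)"
  have hs: "h k l = h l k" for k l unfolding h_def using sym[of k l] by simp
  have h0: "0 \<le> h k l" for k l by (simp add: h_def)
  have phi: "\<bar>\<phi> (?D k l q)\<bar> \<le> 4 * \<delta> * \<bar>?D k l q\<bar>" if "k \<in> S" "l \<in> S" "q permutes S" for k l q
  proof -
    have "\<bar>\<phi> (?D k l q)\<bar> \<le> \<bar>?D k l q\<bar> * \<bar>?D k l q\<bar>" using \<phi>[of "?D k l q"] by (simp add: power2_eq_square)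
    also have "\<dots> \<le> 4 * \<delta> * \<bar>?D k l q\<bar>"
      by (intro mult_right_mono abs_swap_diff_le[OF that(3,1,2)] A) auto
    finally show ?thesis .
  qed
  \<comment> \<open>Only pairs with an index in {\<open>i\<close>, \<open>j\<close>} change. The
    four indicators count some pairs more than once, which is harmless and splits the double sum
    into four single ones.\<close>
  have tm: "\<bar>\<phi> (?D k l p') - \<phi> (?D k l p)\<bar>
      \<le> 4 * \<delta> * (h k l * of_bool (k = i) + h k l * of_bool (k = j) + h k l * of_bool (l = i) + h k l * of_bool (l = j))"
    if kl: "k \<in> S" "l \<in> S" for k l
  proof (cases "k = i \<or> k = j \<or> l = i \<or> l = j")
    case True
    have "\<bar>\<phi> (?D k l p') - \<phi> (?D k l p)\<bar> \<le> 4 * \<delta> * h k l"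
      using phi[OF kl p] phi[OF kl p'] by (simp add: h_def distrib_left)
    also have "h k l \<le> h k l * of_bool (k = i) + h k l * of_bool (k = j) + h k l * of_bool (l = i) + h k l * of_bool (l = j)"
      using True h0[of k l] by auto
    finally show ?thesis using d0 by (simp add: mult_left_mono)
  next
    case False
    then have "?D k l p' = ?D k l p" by (simp add: p'_def swap_diff_def Transposition.transpose_def)
    then show ?thesis using d0 h0 by simp
  qed
  have "\<bar>G p' - G p\<bar> \<le> (\<Sum>k\<in>S. \<Sum>l\<in>S. \<bar>\<phi> (?D k l p') - \<phi> (?D k l p)\<bar>)"
    unfolding G_def sum_subtractf[symmetric] by (intro order_trans[OF sum_abs] sum_mono) simp
  also have "\<dots> \<le> (\<Sum>k\<in>S. \<Sum>l\<in>S. 4 * \<delta> * (h k l * of_bool (k = i) + h k l * of_bool (k = j)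
      + h k l * of_bool (l = i) + h k l * of_bool (l = j)))"
    by (intro sum_mono tm)
  also have "\<dots> = 4 * \<delta> * ((\<Sum>k\<in>S. \<Sum>l\<in>S. h k l * of_bool (k = i)) + (\<Sum>k\<in>S. \<Sum>l\<in>S. h k l * of_bool (k = j))
      + (\<Sum>k\<in>S. \<Sum>l\<in>S. h k l * of_bool (l = i)) + (\<Sum>k\<in>S. \<Sum>l\<in>S. h k l * of_bool (l = j)))"
    by (simp only: sum.distrib sum_distrib_left distrib_left)
  also have "\<dots> = 8 * \<delta> * (\<Sum>l\<in>S. h i l + h j l)"
  proof -
    have a: "(\<Sum>k\<in>S. \<Sum>l\<in>S. h k l * of_bool (k = m)) = (\<Sum>l\<in>S. h m l)" if "m \<in> S" for m
      using fin that by (subst sum.swap) (simp add: of_bool_def if_distrib[of "times _"] cong: if_cong)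
    have b: "(\<Sum>k\<in>S. \<Sum>l\<in>S. h k l * of_bool (l = m)) = (\<Sum>l\<in>S. h m l)" if "m \<in> S" for m
      using fin that by (simp add: of_bool_def if_distrib[of "times _"] hs[of _ m] cong: if_cong)
    show ?thesis unfolding a[OF ij(1)] a[OF ij(2)] b[OF ij(1)] b[OF ij(2)] by (simp add: sum.distrib algebra_simps)
  qed
  finally have "(G p' - G p)\<^sup>2 \<le> (8 * \<delta> * (\<Sum>l\<in>S. h i l + h j l))\<^sup>2"
    by (metis abs_ge_zero power2_abs power_mono)
  also have "\<dots> = 64 * \<delta>\<^sup>2 * (\<Sum>l\<in>S. (h i l + h j l) * 1)\<^sup>2" by (simp add: power_mult_distrib)
  also have "\<dots> \<le> 64 * \<delta>\<^sup>2 * ((\<Sum>l\<in>S. (h i l + h j l)\<^sup>2) * (\<Sum>l\<in>S. 1\<^sup>2))"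
    by (intro mult_left_mono Cauchy_Schwarz_ineq_sum) simp
  also have "\<dots> = 64 * \<delta>\<^sup>2 * real (card S) * (\<Sum>l\<in>S. (h i l + h j l)\<^sup>2)" by simp
  also have "\<dots> \<le> 64 * \<delta>\<^sup>2 * real (card S) * (\<Sum>l\<in>S. 4 * ((?D i l p')\<^sup>2 + (?D i l p)\<^sup>2 + (?D j l p')\<^sup>2 + (?D j l p)\<^sup>2))"
  proof (intro mult_left_mono sum_mono)
    have four: "(a + b + (c + d))\<^sup>2 \<le> 4 * (a\<^sup>2 + b\<^sup>2 + c\<^sup>2 + d\<^sup>2)" for a b c d :: real
    proof -
      have "0 \<le> (a - b)\<^sup>2 + (a - c)\<^sup>2 + (a - d)\<^sup>2 + (b - c)\<^sup>2 + (b - d)\<^sup>2 + (c - d)\<^sup>2" by simp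
      then show ?thesis by (simp add: power2_eq_square algebra_simps)
    qed
    fix l
    show "(h i l + h j l)\<^sup>2 \<le> 4 * ((?D i l p')\<^sup>2 + (?D i l p)\<^sup>2 + (?D j l p')\<^sup>2 + (?D j l p)\<^sup>2)"
      unfolding h_def using four[of "\<bar>?D i l p'\<bar>" "\<bar>?D i l p\<bar>" "\<bar>?D j l p'\<bar>" "\<bar>?D j l p\<bar>"] by simp
  qed simp
  also have "\<dots> = 256 * \<delta>\<^sup>2 * real (card S) * (\<Sum>l\<in>S. (?D i l p')\<^sup>2 + (?D i l p)\<^sup>2 + (?D j l p')\<^sup>2 + (?D j l p)\<^sup>2)"
    by (subst sum_distrib_left[symmetric]) simp
  finally show ?thesis .
qed

text \<open>The mean deviation is at most the standard deviation, which
  \<open>permutation_poincare\<close> bounds through the transposition increments of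
  \<open>G\<close>. These are controlled by squared increments of the statistic, whose mean is known
  from \<open>var\<close>. The outcome is 2048 = 256 * 16 / 2, and 46 is the least integer whose
  square, 2116, exceeds it.\<close>

lemma sum_quadratic_swap_diff_concentration:
  fixes \<phi> :: "real \<Rightarrow> real"
  assumes fin: "finite S" and ne: "S \<noteq> {}"
    and A: "\<And>i k. i \<in> S \<Longrightarrow> k \<in> S \<Longrightarrow> \<bar>A i k\<bar> \<le> \<delta>"
    and A0: "(\<Sum>i\<in>S. \<Sum>j\<in>S. A i j) = 0"
    and var: "(\<Sum>p\<in>perms S. (perm_stat S A p)\<^sup>2) = real (card (perms S))"
    and \<phi>: "\<And>x. \<bar>\<phi> x\<bar> \<le> x\<^sup>2"
  defines "G \<equiv> \<lambda>p. \<Sum>k\<in>S. \<Sum>l\<in>S. \<phi> (swap_diff A k l p)"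
  assumes mean: "(\<Sum>p\<in>perms S. G p) = real (card (perms S)) * \<mu>"
  shows "(\<Sum>p\<in>perms S. \<bar>G p - \<mu>\<bar>) \<le> 46 * \<delta> * real (card S) * real (card (perms S))"
proof -
  let ?D = "swap_diff A" and ?n = "real (card S)" and ?P = "real (card (perms S))"
  let ?t = "\<lambda>i j p. p \<circ> transpose i j"
  have n0: "?n > 0" using fin ne by (simp add: card_gt_0_iff)
  have P0: "?P > 0" by (simp add: card_permutations[OF refl fin])
  obtain i0 where i0: "i0 \<in> S" using ne by auto
  have "0 \<le> \<bar>A i0 i0\<bar>" by simp
  also have "\<dots> \<le> \<delta>" using A i0 by blast
  finally have d0: "0 \<le> \<delta>" .
  define E where "E = (\<Sum>p\<in>perms S. \<Sum>i\<in>S. \<Sum>l\<in>S. (?D i l p)\<^sup>2)"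
  have E: "E = 4 * ?n * ?P" unfolding E_def using sum_swap_diff_squares[OF fin A0] var by simp
  have swp: "(\<Sum>i\<in>S. \<Sum>l\<in>S. \<Sum>p\<in>perms S. (?D i l p)\<^sup>2) = E"
    unfolding E_def by (simp add: sum.swap[of _ "perms S" S])
  have "(\<Sum>i\<in>S. \<Sum>j\<in>S. \<Sum>p\<in>perms S. (G (?t i j p) - G p)\<^sup>2)
     \<le> (\<Sum>i\<in>S. \<Sum>j\<in>S. \<Sum>p\<in>perms S. 256 * \<delta>\<^sup>2 * ?n * (\<Sum>l\<in>S. (?D i l (?t i j p))\<^sup>2 + (?D i l p)\<^sup>2
     + (?D j l (?t i j p))\<^sup>2 + (?D j l p)\<^sup>2))"
    unfolding G_def by (intro sum_mono sum_quadratic_swap_diff_increment[OF fin _ _ _ A \<phi>]) auto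
  also have "\<dots> = 256 * \<delta>\<^sup>2 * ?n * (\<Sum>i\<in>S. \<Sum>j\<in>S. \<Sum>l\<in>S. \<Sum>p\<in>perms S. (?D i l (?t i j p))\<^sup>2 + (?D i l p)\<^sup>2
     + (?D j l (?t i j p))\<^sup>2 + (?D j l p)\<^sup>2)"
    unfolding sum_distrib_left[symmetric] by (simp only: sum.swap[of _ "perms S" S])
  also have "\<dots> = 256 * \<delta>\<^sup>2 * ?n * (\<Sum>i\<in>S. \<Sum>j\<in>S. \<Sum>l\<in>S. 2 * (\<Sum>p\<in>perms S. (?D i l p)\<^sup>2)
     + 2 * (\<Sum>p\<in>perms S. (?D j l p)\<^sup>2))"
    using perms_transpose_invariant[of _ S _ "\<lambda>p. (?D _ _ p)\<^sup>2"] by (simp add: sum.distrib)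
  also have "\<dots> = 256 * \<delta>\<^sup>2 * ?n * (2 * ?n * E + 2 * ?n * E)"
    by (simp add: sum.distrib sum_distrib_left[symmetric] swp)
  also have "\<dots> = 4096 * \<delta>\<^sup>2 * ?n ^ 3 * ?P"
    unfolding E by (simp add: power3_eq_cube)
  finally have dir: "(\<Sum>i\<in>S. \<Sum>j\<in>S. \<Sum>p\<in>perms S. (G (?t i j p) - G p)\<^sup>2) \<le> 4096 * \<delta>\<^sup>2 * ?n ^ 3 * ?P" .
  have pairs: "(\<Sum>p\<in>perms S. \<Sum>p'\<in>perms S. (G p - G p')\<^sup>2) = 2 * ?P * (\<Sum>p\<in>perms S. (G p - \<mu>)\<^sup>2)"
  proof -
    have "(\<Sum>p\<in>perms S. \<Sum>p'\<in>perms S. (G p - G p')\<^sup>2)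
      = (\<Sum>p\<in>perms S. \<Sum>p'\<in>perms S. (G p - \<mu>)\<^sup>2 + (G p' - \<mu>)\<^sup>2 - 2 * ((G p - \<mu>) * (G p' - \<mu>)))"
      by (intro sum.cong refl) (simp add: power2_eq_square algebra_simps)
    also have "\<dots> = 2 * ?P * (\<Sum>p\<in>perms S. (G p - \<mu>)\<^sup>2) - 2 * ((\<Sum>p\<in>perms S. G p - \<mu>) * (\<Sum>p\<in>perms S. G p - \<mu>))"
      unfolding sum_product by (simp add: sum.distrib sum_subtractf flip: sum_distrib_left)
    also have "(\<Sum>p\<in>perms S. G p - \<mu>) = 0" using mean by (simp add: sum_subtractf)
    finally show ?thesis by simp
  qed
  have "?n * (2 * ?P * (\<Sum>p\<in>perms S. (G p - \<mu>)\<^sup>2)) \<le> ?P * (4096 * \<delta>\<^sup>2 * ?n ^ 3 * ?P)"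
    using order_trans[OF permutation_poincare[OF fin, of G] mult_left_mono[OF dir]]
    unfolding pairs by simp
  also have "\<dots> = ?n * (2 * ?P * (2048 * \<delta>\<^sup>2 * ?n\<^sup>2 * ?P))"
    by (simp add: power3_eq_cube power2_eq_square)
  finally have var2: "(\<Sum>p\<in>perms S. (G p - \<mu>)\<^sup>2) \<le> 2048 * \<delta>\<^sup>2 * ?n\<^sup>2 * ?P"
    using n0 P0 by (simp add: mult_ac)
  have "(\<Sum>p\<in>perms S. \<bar>G p - \<mu>\<bar> * 1)\<^sup>2 \<le> (\<Sum>p\<in>perms S. \<bar>G p - \<mu>\<bar>\<^sup>2) * (\<Sum>p\<in>perms S. 1\<^sup>2)"
    by (rule Cauchy_Schwarz_ineq_sum)
  also have "\<dots> \<le> (2048 * \<delta>\<^sup>2 * ?n\<^sup>2 * ?P) * ?P" using var2 by (simp add: mult_right_mono)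
  also have "\<dots> \<le> (46 * \<delta> * ?n * ?P)\<^sup>2"
    using d0 by (simp add: power_mult_distrib power2_eq_square mult_right_mono)
  finally have "(\<Sum>p\<in>perms S. \<bar>G p - \<mu>\<bar>)\<^sup>2 \<le> (46 * \<delta> * ?n * ?P)\<^sup>2" by simp
  then show ?thesis by (rule power2_le_imp_le) (use d0 in simp)
qed

text \<open>Concentration is used twice, for the square with mean \<open>4 * real (card S)\<close>
  and for \<open>x * \<bar>x\<bar>\<close> with mean 0. In the Stein bound with
  \<open>c = 2 * real (card S)\<close> each use contributes 23 \<delta>.\<close>

theorem combinatorial_berry_esseen:
  assumes fin: "finite S" and ne: "S \<noteq> {}"
    and A: "\<And>i k. i \<in> S \<Longrightarrow> k \<in> S \<Longrightarrow> \<bar>A i k\<bar> \<le> \<delta>"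
    and A0: "(\<Sum>i\<in>S. \<Sum>j\<in>S. A i j) = 0"
    and var: "(\<Sum>p\<in>perms S. (perm_stat S A p)\<^sup>2) = real (card (perms S))"
  shows "\<bar>real (card {p \<in> perms S. perm_stat S A p \<le> z}) / real (card (perms S)) - Phi z\<bar> \<le> 46 * \<delta>"
proof -
  let ?D = "swap_diff A" and ?n = "real (card S)" and ?P = "real (card (perms S))" and ?W = "perm_stat S A"
  \<comment> \<open>Ordered pairs are used, including the diagonal, where the move is the identity;
    all sums then run over the full square.\<close>
  define s :: "'a \<times> 'a \<Rightarrow> ('a \<Rightarrow> 'a) \<Rightarrow> 'a \<Rightarrow> 'a" where "s = (\<lambda>(i, j) p. p \<circ> transpose i j)"
  have n0: "?n > 0" using fin ne by (simp add: card_gt_0_iff)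
  have finP: "finite (perms S)" by (rule finite_permutations[OF fin])
  have P0: "?P > 0" by (simp add: card_permutations[OF refl fin])
  have D: "?W (s ij p) - ?W p = ?D (fst ij) (snd ij) p" if "ij \<in> S \<times> S" for ij p
    using that perm_stat_transpose[OF fin, of "fst ij" "snd ij" A p] by (auto simp: s_def)
  have sumD: "(\<Sum>ij\<in>S \<times> S. h (?W (s ij p) - ?W p)) = (\<Sum>i\<in>S. \<Sum>j\<in>S. h (?D i j p))" for h :: "real \<Rightarrow> real" and p
    by (simp add: D sum.cartesian_product case_prod_beta)
  have "\<bar>\<Sum>p\<in>perms S. of_bool (?W p \<le> z) - Phi z\<bar>
    \<le> 2 * (\<Sum>p\<in>perms S. \<bar>1 - (\<Sum>ij\<in>S \<times> S. (?W (s ij p) - ?W p)\<^sup>2) / (2 * (2 * ?n))\<bar>)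
      + (\<Sum>p\<in>perms S. \<bar>\<Sum>ij\<in>S \<times> S. (?W (s ij p) - ?W p) * \<bar>?W (s ij p) - ?W p\<bar>\<bar>) / (2 * ?n)"
  proof (rule stein_exchangeable_involutions)
    show "s ij p \<in> perms S" if "ij \<in> S \<times> S" "p \<in> perms S" for ij p
      using that by (auto simp: s_def intro: permutes_compose permutes_swap_id)
    show "s ij (s ij p) = p" if "ij \<in> S \<times> S" "p \<in> perms S" for ij p
      by (simp add: s_def case_prod_beta fun_eq_iff)
    show "(\<Sum>ij\<in>S \<times> S. ?W (s ij p) - ?W p) = - (2 * ?n) * ?W p" if "p \<in> perms S" for p
      using sumD[of "\<lambda>x. x" p] sum_swap_diff[OF fin _ A0, of p] that by simp
  qed (use n0 in simp)
  also have "\<dots> = 2 * ((\<Sum>p\<in>perms S. \<bar>(\<Sum>i\<in>S. \<Sum>j\<in>S. (?D i j p)\<^sup>2) - 4 * ?n\<bar>) / (4 * ?n))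
      + (\<Sum>p\<in>perms S. \<bar>(\<Sum>i\<in>S. \<Sum>j\<in>S. ?D i j p * \<bar>?D i j p\<bar>) - 0\<bar>) / (2 * ?n)"
  proof -
    have "\<bar>1 - x / (2 * (2 * ?n))\<bar> = \<bar>x - 4 * ?n\<bar> / (4 * ?n)" for x :: real
      using n0 by (simp add: abs_if field_simps)
    then show ?thesis
      by (simp only: sumD[of "\<lambda>x. x\<^sup>2"] sumD[of "\<lambda>x. x * \<bar>x\<bar>"] sum_divide_distrib[symmetric] diff_0_right)
  qed
  also have "\<dots> \<le> 2 * ((46 * \<delta> * ?n * ?P) / (4 * ?n)) + (46 * \<delta> * ?n * ?P) / (2 * ?n)"
  proof (intro add_mono mult_left_mono divide_right_mono)
    show "(\<Sum>p\<in>perms S. \<bar>(\<Sum>i\<in>S. \<Sum>j\<in>S. (?D i j p)\<^sup>2) - 4 * ?n\<bar>) \<le> 46 * \<delta> * ?n * ?P"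
      by (rule sum_quadratic_swap_diff_concentration[OF fin ne A A0 var])
        (simp_all add: sum_swap_diff_squares[OF fin A0] var)
    \<comment> \<open>Swapping \<open>i\<close> and \<open>j\<close> negates this increment, so an
      odd function of it has mean zero.\<close>
    have "(\<Sum>p\<in>perms S. ?D i j p * \<bar>?D i j p\<bar>) = 0" if ij: "i \<in> S" "j \<in> S" for i j
    proof -
      have "?D i j (p \<circ> transpose i j) = - ?D i j p" for p by (simp add: swap_diff_def)
      then show ?thesis
        using perms_transpose_invariant[OF ij, of "\<lambda>p. ?D i j p * \<bar>?D i j p\<bar>"] by (simp add: sum_negf)
    qed
    moreover have "(\<Sum>p\<in>perms S. \<Sum>i\<in>S. \<Sum>j\<in>S. ?D i j p * \<bar>?D i j p\<bar>)
        = (\<Sum>i\<in>S. \<Sum>j\<in>S. \<Sum>p\<in>perms S. ?D i j p * \<bar>?D i j p\<bar>)"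
      by (subst sum.swap, rule sum.cong[OF refl], rule sum.swap)
    ultimately have "(\<Sum>p\<in>perms S. \<Sum>i\<in>S. \<Sum>j\<in>S. ?D i j p * \<bar>?D i j p\<bar>) = 0" by simp
    then show "(\<Sum>p\<in>perms S. \<bar>(\<Sum>i\<in>S. \<Sum>j\<in>S. ?D i j p * \<bar>?D i j p\<bar>) - 0\<bar>) \<le> 46 * \<delta> * ?n * ?P"
      by (intro sum_quadratic_swap_diff_concentration[OF fin ne A A0 var])
        (simp_all add: abs_mult power2_eq_square)
  qed (use n0 in auto)
  also have "\<dots> = 46 * \<delta> * ?P" using n0 by (simp add: field_simps)
  finally have "\<bar>\<Sum>p\<in>perms S. of_bool (?W p \<le> z) - Phi z\<bar> \<le> 46 * \<delta> * ?P" .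
  moreover have "(\<Sum>p\<in>perms S. of_bool (?W p \<le> z) - Phi z) = real (card {p \<in> perms S. ?W p \<le> z}) - ?P * Phi z"
    using finP by (simp add: sum_subtractf of_bool_def sum.If_cases Int_def)
  ultimately have "\<bar>real (card {p \<in> perms S. ?W p \<le> z}) - ?P * Phi z\<bar> / ?P \<le> 46 * \<delta>"
    using P0 by (simp add: divide_le_eq)
  moreover have "\<bar>real (card {p \<in> perms S. ?W p \<le> z}) - ?P * Phi z\<bar> / ?P
     = \<bar>real (card {p \<in> perms S. ?W p \<le> z}) / ?P - Phi z\<bar>"
    using P0 by (subst abs_of_pos[of ?P, symmetric], simp, subst abs_divide[symmetric]) (simp add: diff_divide_distrib)
  ultimately show ?thesis by simp
qed

section \<open>Assignments as images of permutations\<close>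

lemma sum_group_assignment:
  assumes z: "z \<in> assignments N Q Nq"
  shows "(\<Sum>i<N. h i) = (\<Sum>q<Q. \<Sum>i\<in>{i. i < N \<and> z i = q}. h i)"
proof -
  have "(\<Sum>q<Q. \<Sum>i\<in>{i \<in> {..<N}. z i = q}. h i) = (\<Sum>i<N. h i)"
    using z by (intro sum.group) (auto simp: assignments_def)
  then show ?thesis by simp
qed

lemma sum_over_assignment:
  fixes f :: "nat \<Rightarrow> real"
  assumes z: "z \<in> assignments N Q Nq"
  shows "(\<Sum>i<N. f (z i)) = (\<Sum>q<Q. real (Nq q) * f q)"
proof -
  have "(\<Sum>i\<in>{i. i < N \<and> z i = q}. f (z i)) = real (Nq q) * f q" if "q < Q" for q
  proof -
    have "(\<Sum>i\<in>{i. i < N \<and> z i = q}. f (z i)) = (\<Sum>i\<in>{i. i < N \<and> z i = q}. f q)" by simp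
    then show ?thesis using z that by (simp add: assignments_def)
  qed
  then show ?thesis unfolding sum_group_assignment[OF z] by (intro sum.cong[OF refl]) (simp only: lessThan_iff)
qed

lemma assignment_comp_permutation:
  assumes z: "z \<in> assignments N Q Nq" and p: "p permutes {..<N}"
  shows "z \<circ> p \<in> assignments N Q Nq"
proof -
  have lt: "p i < N \<longleftrightarrow> i < N" for i using permutes_in_image[OF p, of i] by simp
  have "card {i. i < N \<and> (z \<circ> p) i = q} = card {i. i < N \<and> z i = q}" for q
  proof (rule bij_betw_same_card)
    show "bij_betw p {i. i < N \<and> (z \<circ> p) i = q} {i. i < N \<and> z i = q}"
      unfolding bij_betw_def
    proof
      show "inj_on p {i. i < N \<and> (z \<circ> p) i = q}" using permutes_inj[OF p] by (rule inj_on_subset) simp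
      have "i \<in> p ` {i. i < N \<and> (z \<circ> p) i = q}" if "i < N" "z i = q" for i
        using that lt[of "inv_into UNIV p i"] by (intro image_eqI[of _ _ "inv_into UNIV p i"]) (auto simp: permutes_inverses[OF p])
      then show "p ` {i. i < N \<and> (z \<circ> p) i = q} = {i. i < N \<and> z i = q}" using lt by auto
    qed
  qed
  \<comment> \<open>The default value 0 outside the units survives because \<open>p\<close> fixes
    those indices.\<close>
  moreover have "(z \<circ> p) i = 0" if "N \<le> i" for i
    using z that permutes_not_in[OF p, of i] by (simp add: assignments_def)
  ultimately show ?thesis using z lt by (simp add: assignments_def)
qed

text \<open>Equal group sizes mean equal multisets of labels over the units, and such labellings
  differ by a permutation. Outside the units both are 0, so the equation holds between
  functions.\<close>

lemma assignments_transitive: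
  assumes z: "z \<in> assignments N Q Nq" and c: "c \<in> assignments N Q Nq"
  obtains p where "p permutes {..<N}" "z = c \<circ> p"
proof -
  have cnt: "card {i. i < N \<and> w i = q} = (if q < Q then Nq q else 0)" if w: "w \<in> assignments N Q Nq" for w q
  proof (cases "q < Q")
    case False
    then have "{i. i < N \<and> w i = q} = {}" using w by (auto simp: assignments_def)
    then show ?thesis using False by simp
  qed (use w in \<open>simp add: assignments_def\<close>)
  have "image_mset z (mset_set {..<N}) = image_mset c (mset_set {..<N})"
    by (rule multiset_eqI) (simp add: count_image_mset_eq_card_vimage cnt[OF z] cnt[OF c])
  then obtain p where p: "p permutes {..<N}" "\<forall>i\<in>{..<N}. z i = c (p i)"
    using image_mset_eq_implies_permutes[of "{..<N}" z c] by blast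
  have "z i = c (p i)" for i
  proof (cases "i < N")
    case False
    then show ?thesis using z c permutes_not_in[OF p(1), of i] by (simp add: assignments_def)
  qed (use p(2) in simp)
  then have "z = c \<circ> p" by auto
  then show ?thesis using p(1) that by blast
qed

text \<open>The disjoint union of blocks of sizes \<open>Nq q\<close> has \<open>N\<close> elements;
  a labelling is read off from an enumeration of it.\<close>

lemma assignments_nonempty:
  assumes "(\<Sum>q<Q. Nq q) = N"
  shows "assignments N Q Nq \<noteq> {}"
proof -
  let ?T = "SIGMA q:{..<Q}. {..<Nq q}"
  have "card {..<N} = card ?T" using assms by simp
  then obtain h where h: "bij_betw h {..<N} ?T"
    using finite_same_card_bij[of "{..<N}" ?T] by auto
  define c where "c = (\<lambda>i. if i < N then fst (h i) else 0)"
  have hT: "h i \<in> ?T" if "i < N" for i using bij_betwE[OF h] that by auto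
  have "card {i. i < N \<and> c i = q} = Nq q" if "q < Q" for q
  proof -
    have "bij_betw h {i. i < N \<and> c i = q} ({q} \<times> {..<Nq q})"
      unfolding bij_betw_def
    proof
      show "inj_on h {i. i < N \<and> c i = q}"
        using h by (auto simp: bij_betw_def intro: inj_on_subset)
      have "x \<in> h ` {i. i < N \<and> c i = q}" if x: "x \<in> {q} \<times> {..<Nq q}" for x
      proof -
        have "x \<in> h ` {..<N}" using h x \<open>q < Q\<close> by (auto simp: bij_betw_def)
        then obtain i where i: "i < N" "x = h i" by auto
        then have "c i = q" using x by (auto simp: c_def)
        then show ?thesis using i by blast
      qed
      then show "h ` {i. i < N \<and> c i = q} = {q} \<times> {..<Nq q}"
        using hT by (force simp: c_def)
    qed
    then show ?thesis by (auto dest!: bij_betw_same_card simp: card_cartesian_product)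
  qed
  moreover have "c i < Q" if "i < N" for i using hT[OF that] that by (auto simp: c_def)
  ultimately have "c \<in> assignments N Q Nq" by (auto simp: assignments_def c_def)
  then show ?thesis by blast
qed

lemma finite_assignments: "finite (assignments N Q Nq)"
proof (cases "assignments N Q Nq = {}")
  case False
  then obtain c where c: "c \<in> assignments N Q Nq" by blast
  have "assignments N Q Nq \<subseteq> (\<lambda>p. c \<circ> p) ` perms {..<N}"
    using assignments_transitive[OF _ c] by blast
  then show ?thesis by (rule finite_subset) (simp add: finite_permutations)
qed simp

text \<open>Double counting over pairs of an assignment and a permutation: in one order the inner
  sum is constant by transitivity, in the other because composition is bijective. This transfers
  uniform averages without counting stabilisers.\<close>

lemma sum_assignments_permutations:
  fixes h :: "(nat \<Rightarrow> nat) \<Rightarrow> real"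
  assumes c: "c \<in> assignments N Q Nq"
  shows "real (card (assignments N Q Nq)) * (\<Sum>p\<in>perms {..<N}. h (c \<circ> p))
    = real (card (perms {..<N})) * (\<Sum>z\<in>assignments N Q Nq. h z)"
proof -
  let ?O = "assignments N Q Nq" and ?P = "perms {..<N}"
  have "(\<Sum>p\<in>?P. h (z \<circ> p)) = (\<Sum>p\<in>?P. h (c \<circ> p))" if z: "z \<in> ?O" for z
  proof -
    obtain s where s: "s permutes {..<N}" "z = c \<circ> s" using assignments_transitive[OF z c] by blast
    have "(\<Sum>p\<in>?P. h (c \<circ> p)) = (\<Sum>p\<in>?P. h (c \<circ> (s \<circ> p)))"
      by (rule setum_permutations_compose_left[OF s(1)])
    then show ?thesis by (simp add: s(2) comp_assoc)
  qed
  then have "real (card ?O) * (\<Sum>p\<in>?P. h (c \<circ> p)) = (\<Sum>z\<in>?O. \<Sum>p\<in>?P. h (z \<circ> p))" by simp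
  also have "\<dots> = (\<Sum>p\<in>?P. \<Sum>z\<in>?O. h (z \<circ> p))" by (rule sum.swap)
  also have "\<dots> = (\<Sum>p\<in>?P. \<Sum>z\<in>?O. h z)"
  proof (rule sum.cong[OF refl])
    fix p assume "p \<in> ?P"
    then have p: "p permutes {..<N}" by simp
    show "(\<Sum>z\<in>?O. h (z \<circ> p)) = (\<Sum>z\<in>?O. h z)"
      by (rule sum.reindex_bij_witness[of _ "\<lambda>z. z \<circ> inv_into UNIV p" "\<lambda>z. z \<circ> p"])
        (auto simp: comp_assoc permutes_inv_o[OF p] assignment_comp_permutation p permutes_inv)
  qed
  finally show ?thesis by simp
qed

text \<open>In \<open>A i k = a i (c k)\<close> each level \<open>q\<close> occupies
  \<open>Nq q\<close> columns, which accounts for the weights in \<open>var\<close>; that hypothesis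
  then says that the permutation statistic has variance 1.\<close>

theorem assignment_berry_esseen:
  fixes a :: "nat \<Rightarrow> nat \<Rightarrow> real"
  assumes Nq: "(\<Sum>q<Q. Nq q) = N" and N: "N \<ge> 2"
    and col: "\<And>q. q < Q \<Longrightarrow> (\<Sum>i<N. a i q) = 0"
    and var: "(\<Sum>i<N. \<Sum>q<Q. real (Nq q) * (a i q)\<^sup>2) - (\<Sum>i<N. (\<Sum>q<Q. real (Nq q) * a i q)\<^sup>2) / real N = real N - 1"
    and bnd: "\<And>i q. i < N \<Longrightarrow> q < Q \<Longrightarrow> \<bar>a i q\<bar> \<le> \<delta>"
  shows "\<bar>real (card {z \<in> assignments N Q Nq. (\<Sum>i<N. a i (z i)) \<le> t}) / real (card (assignments N Q Nq)) - Phi t\<bar>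
      \<le> 46 * \<delta>"
proof -
  let ?O = "assignments N Q Nq" and ?S = "{..<N}"
  let ?P = "perms ?S"
  obtain c where c: "c \<in> ?O" using assignments_nonempty[OF Nq] by blast
  have cQ: "c k < Q" if "k < N" for k using c that by (simp add: assignments_def)
  define A where "A = (\<lambda>i k. a i (c k))"
  have W: "perm_stat ?S A p = (\<Sum>i<N. a i ((c \<circ> p) i))" for p by (simp add: perm_stat_def A_def)
  have ne: "?S \<noteq> {}" using N by (simp add: lessThan_empty_iff)
  have colA: "(\<Sum>i\<in>?S. A i k) = 0" if "k \<in> ?S" for k using col cQ that by (simp add: A_def)
  have A0: "(\<Sum>i\<in>?S. \<Sum>k\<in>?S. A i k) = 0" by (subst sum.swap) (simp add: colA)
  have Ab: "\<bar>A i k\<bar> \<le> \<delta>" if "i \<in> ?S" "k \<in> ?S" for i k using bnd cQ that by (simp add: A_def)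
  have "(real (card ?S) - 1) * (\<Sum>p\<in>?P. (perm_stat ?S A p)\<^sup>2) = real (card ?P) * (real N - 1)"
  proof -
    have "(\<Sum>k<N. (A i k)\<^sup>2) = (\<Sum>q<Q. real (Nq q) * (a i q)\<^sup>2)"
      "(\<Sum>k<N. A i k) = (\<Sum>q<Q. real (Nq q) * a i q)" for i
      unfolding A_def
      by (rule sum_over_assignment[OF c, of "\<lambda>q. (a i q)\<^sup>2"], rule sum_over_assignment[OF c, of "a i"])
    then show ?thesis
      using perm_stat_variance[OF finite_lessThan ne colA] var by simp
  qed
  then have v: "(\<Sum>p\<in>?P. (perm_stat ?S A p)\<^sup>2) = real (card ?P)" using N by simp
  have P0: "0 < card ?P" by (simp add: card_permutations[OF refl])
  have O0: "0 < card ?O" using c finite_assignments by (auto simp: card_gt_0_iff)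
  have cnt: "real (card {x \<in> X. R x}) = (\<Sum>x\<in>X. of_bool (R x))" if "finite X" for X :: "'x set" and R
    using that by (simp add: of_bool_def sum.If_cases Int_def)
  have "real (card ?O) * real (card {p \<in> ?P. perm_stat ?S A p \<le> t})
     = real (card ?P) * real (card {z \<in> ?O. (\<Sum>i<N. a i (z i)) \<le> t})"
    unfolding W cnt[OF finite_permutations[OF finite_lessThan]] cnt[OF finite_assignments]
    by (rule sum_assignments_permutations[OF c, of "\<lambda>z. of_bool ((\<Sum>i<N. a i (z i)) \<le> t)"])
  then have "real (card {z \<in> ?O. (\<Sum>i<N. a i (z i)) \<le> t}) / real (card ?O)
     = real (card {p \<in> ?P. perm_stat ?S A p \<le> t}) / real (card ?P)"
    using P0 O0 by (simp add: field_simps)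
  then show ?thesis using combinatorial_berry_esseen[OF finite_lessThan ne Ab A0 v, of t] by simp
qed

lemma assignment_sum_mean:
  fixes a :: "nat \<Rightarrow> nat \<Rightarrow> real"
  assumes Nq: "(\<Sum>q<Q. Nq q) = N" and N: "N \<ge> 1"
    and col: "\<And>q. q < Q \<Longrightarrow> (\<Sum>i<N. a i q) = 0"
  shows "(\<Sum>z\<in>assignments N Q Nq. \<Sum>i<N. a i (z i)) = 0"
proof -
  obtain c where c: "c \<in> assignments N Q Nq" using assignments_nonempty[OF Nq] by blast
  define A where "A = (\<lambda>i k. a i (c k))"
  have "(\<Sum>k<N. \<Sum>i<N. A i k) = 0"
    using col c by (simp add: A_def assignments_def)
  then have A0: "(\<Sum>i<N. \<Sum>k<N. A i k) = 0" by (subst sum.swap)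
  have "(\<Sum>p\<in>perms {..<N}. perm_stat {..<N} A p) = 0"
    by (rule perm_stat_mean[OF _ _ A0]) (use N in \<open>simp_all add: lessThan_empty_iff\<close>)
  then show ?thesis
    using sum_assignments_permutations[OF c, of "\<lambda>z. \<Sum>i<N. a i (z i)"]
    by (simp add: perm_stat_def A_def card_permutations[OF refl])
qed

section \<open>Spectral theorem and inverse square roots\<close>

lemma symmetric_scalar_prod_swap:
  fixes A :: "'a :: comm_semiring_0 mat"
  assumes "A \<in> carrier_mat n n" "transpose_mat A = A" "x \<in> carrier_vec n" "y \<in> carrier_vec n"
  shows "x \<bullet> (A *\<^sub>v y) = y \<bullet> (A *\<^sub>v x)"
proof -
  have "x \<bullet> (A *\<^sub>v y) = (A *\<^sub>v x) \<bullet> y"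
    using transpose_vec_mult_scalar[OF assms(1,4,3)] assms(2) by simp
  also have "\<dots> = y \<bullet> (A *\<^sub>v x)"
    using assms by (intro comm_scalar_prod[of _ n]) auto
  finally show ?thesis .
qed

lemma real_scalar_prod_self_eq_0:
  fixes x :: "real vec"
  assumes "x \<in> carrier_vec n"
  shows "x \<bullet> x = 0 \<longleftrightarrow> x = 0\<^sub>v n"
  using assms by (auto simp: scalar_prod_def sum_nonneg_eq_0_iff intro!: eq_vecI)

lemma real_scalar_prod_self_nonneg: "0 \<le> (x :: real vec) \<bullet> x"
  by (simp add: scalar_prod_def sum_nonneg)

text \<open>A complex eigenvector is split into real and imaginary parts \<open>x\<close> and
  \<open>y\<close>. Symmetry equates \<open>x \<bullet> (A *\<^sub>v y)\<close> with
  \<open>y \<bullet> (A *\<^sub>v x)\<close>, which forces the eigenvalue to be real; a nonzero part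
  is then a real eigenvector.\<close>

lemma symmetric_mat_has_eigenvector:
  fixes A :: "real mat"
  assumes A: "A \<in> carrier_mat n n" and sym: "transpose_mat A = A" and n: "n > 0"
  obtains v k where "v \<in> carrier_vec n" "v \<bullet> v = 1" "A *\<^sub>v v = k \<cdot>\<^sub>v v"
proof -
  define Ac where "Ac = map_mat complex_of_real A"
  have Ac: "Ac \<in> carrier_mat n n" using A by (simp add: Ac_def)
  obtain c where "eigenvalue Ac c"
    using spectrum_non_empty[OF Ac n] by (auto simp: spectrum_def)
  then obtain w where w: "w \<in> carrier_vec n" "w \<noteq> 0\<^sub>v n" "Ac *\<^sub>v w = c \<cdot>\<^sub>v w"
    using Ac by (auto simp: eigenvalue_def eigenvector_def)
  define x where "x = map_vec Re w"
  define y where "y = map_vec Im w"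
  have xy: "x \<in> carrier_vec n" "y \<in> carrier_vec n" using w by (auto simp: x_def y_def)
  have comp: "(\<Sum>j<n. complex_of_real (A $$ (i, j)) * w $ j) = c * w $ i" if "i < n" for i
  proof -
    have "(Ac *\<^sub>v w) $ i = (c \<cdot>\<^sub>v w) $ i" by (simp add: w(3))
    then show ?thesis using that A w(1) by (simp add: Ac_def scalar_prod_def atLeast0LessThan)
  qed
  have Ax: "A *\<^sub>v x = Re c \<cdot>\<^sub>v x - Im c \<cdot>\<^sub>v y"
  proof (rule eq_vecI)
    fix i assume "i < dim_vec (Re c \<cdot>\<^sub>v x - Im c \<cdot>\<^sub>v y)"
    then have i: "i < n" using xy by simp
    show "(A *\<^sub>v x) $ i = (Re c \<cdot>\<^sub>v x - Im c \<cdot>\<^sub>v y) $ i"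
      using arg_cong[OF comp[OF i], of Re] A w(1) i xy
      by (simp add: scalar_prod_def atLeast0LessThan x_def y_def)
  qed (use A xy in simp)
  have Ay: "A *\<^sub>v y = Re c \<cdot>\<^sub>v y + Im c \<cdot>\<^sub>v x"
  proof (rule eq_vecI)
    fix i assume "i < dim_vec (Re c \<cdot>\<^sub>v y + Im c \<cdot>\<^sub>v x)"
    then have i: "i < n" using xy by simp
    show "(A *\<^sub>v y) $ i = (Re c \<cdot>\<^sub>v y + Im c \<cdot>\<^sub>v x) $ i"
      using arg_cong[OF comp[OF i], of Im] A w(1) i xy
      by (simp add: scalar_prod_def atLeast0LessThan x_def y_def)
  qed (use A xy in simp)
  have nz: "x \<noteq> 0\<^sub>v n \<or> y \<noteq> 0\<^sub>v n"
  proof (rule ccontr)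
    assume "\<not> (x \<noteq> 0\<^sub>v n \<or> y \<noteq> 0\<^sub>v n)"
    then have "x $ i = 0 \<and> y $ i = 0" if "i < n" for i using that by simp
    then have "w $ i = 0" if "i < n" for i
      using that w(1) by (auto simp: x_def y_def complex_eq_iff)
    then have "w = 0\<^sub>v n" using w(1) by (intro eq_vecI) auto
    then show False using w(2) by simp
  qed
  have "x \<bullet> (A *\<^sub>v y) = Re c * (x \<bullet> y) + Im c * (x \<bullet> x)"
    unfolding Ay using xy by (simp add: scalar_prod_add_distrib[of _ n])
  moreover have "y \<bullet> (A *\<^sub>v x) = Re c * (y \<bullet> x) - Im c * (y \<bullet> y)"
    unfolding Ax using xy by (simp add: scalar_prod_minus_distrib[of _ n])
  moreover have "x \<bullet> y = y \<bullet> x" using xy by (rule comm_scalar_prod)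
  ultimately have "Im c * (x \<bullet> x + y \<bullet> y) = 0"
    using symmetric_scalar_prod_swap[OF A sym xy] by (simp add: algebra_simps)
  moreover have "x \<bullet> x + y \<bullet> y \<noteq> 0"
    using nz real_scalar_prod_self_eq_0[OF xy(1)] real_scalar_prod_self_eq_0[OF xy(2)]
      real_scalar_prod_self_nonneg[of x] real_scalar_prod_self_nonneg[of y] by linarith
  ultimately have c: "Im c = 0" by simp
  have "A *\<^sub>v x = Re c \<cdot>\<^sub>v x" "A *\<^sub>v y = Re c \<cdot>\<^sub>v y"
    unfolding Ax Ay c using xy by (auto intro!: eq_vecI)
  then obtain u where u: "u \<in> carrier_vec n" "u \<noteq> 0\<^sub>v n" "A *\<^sub>v u = Re c \<cdot>\<^sub>v u"
    using nz xy by blast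
  define r where "r = 1 / sqrt (u \<bullet> u)"
  have "u \<bullet> u > 0"
    using real_scalar_prod_self_eq_0[OF u(1)] u(2) real_scalar_prod_self_nonneg[of u] by linarith
  then have "r * r * (u \<bullet> u) = 1" by (simp add: r_def)
  then show ?thesis
    using u(1) u(3) A
    by (intro that[of "r \<cdot>\<^sub>v u" "Re c"]) (auto simp: mult_mat_vec[of _ n n] smult_smult_assoc mult_ac)
qed

text \<open>The reflection along u = e - v, where e is the first unit vector. The squared length of
  u is 2 c, so 2 u u^T / (u . u) has the entries \<open>u i * u j / c\<close>.\<close>

lemma householder_reflection:
  fixes v :: "real vec"
  assumes v: "v \<in> carrier_vec n" "v \<bullet> v = 1" and n: "n > 0"
  obtains R where "R \<in> carrier_mat n n" "transpose_mat R = R" "R * R = 1\<^sub>m n"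
    "R *\<^sub>v unit_vec n 0 = v"
proof -
  define c where "c = 1 - v $ 0"
  define u where "u = (\<lambda>i. of_bool (i = 0) - v $ i)"
  define R where "R = mat n n (\<lambda>(i, j). of_bool (i = j) - u i * u j / c)"
  have R: "R \<in> carrier_mat n n" by (simp add: R_def)
  have vv: "(\<Sum>i<n. v $ i * v $ i) = 1"
    using v by (simp add: scalar_prod_def atLeast0LessThan)
  have "(\<Sum>i<n. u i * u i) = (\<Sum>i<n. of_bool (i = 0)) - 2 * (\<Sum>i<n. of_bool (i = 0) * v $ i) + (\<Sum>i<n. v $ i * v $ i)"
    unfolding sum_distrib_left sum_subtractf[symmetric] sum.distrib[symmetric]
    by (intro sum.cong refl) (auto simp: u_def algebra_simps)
  also have "\<dots> = 2 * c"
    using n by (simp add: vv c_def of_bool_def if_distrib[of "\<lambda>x. x * _"] cong: if_cong)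
  finally have uu: "(\<Sum>i<n. u i * u i) = 2 * c" .
  have "transpose_mat R = R"
    by (rule eq_matI) (auto simp: R_def mult.commute)
  moreover have "R * R = 1\<^sub>m n"
  proof (rule eq_matI)
    fix i j assume "i < dim_row (1\<^sub>m n :: real mat)" "j < dim_col (1\<^sub>m n :: real mat)"
    then have ij: "i < n" "j < n" by auto
    have "(R * R) $$ (i, j) = (\<Sum>k<n. (of_bool (i = k) - u i * u k / c) * (of_bool (k = j) - u k * u j / c))"
      using ij by (simp add: R_def scalar_prod_def atLeast0LessThan)
    also have "\<dots> = (\<Sum>k<n. of_bool (i = k) * of_bool (k = j)) - u j / c * (\<Sum>k<n. of_bool (k = i) * u k)
        - u i / c * (\<Sum>k<n. of_bool (k = j) * u k) + u i * u j / c\<^sup>2 * (\<Sum>k<n. u k * u k)"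
      unfolding sum_distrib_left sum_subtractf[symmetric] sum.distrib[symmetric]
      by (intro sum.cong refl) (auto simp: algebra_simps power2_eq_square)
    also have "\<dots> = of_bool (i = j)"
      using ij unfolding uu
      by (simp add: of_bool_def if_distrib[of "\<lambda>x. x * _"] power2_eq_square cong: if_cong)
    finally show "(R * R) $$ (i, j) = 1\<^sub>m n $$ (i, j)" using ij by simp
  qed (auto simp: R_def)
  moreover have "R *\<^sub>v unit_vec n 0 = v"
  proof (rule eq_vecI)
    fix i assume "i < dim_vec v"
    then have i: "i < n" using v by simp
    have "(R *\<^sub>v unit_vec n 0) $ i = of_bool (i = 0) - u i * u 0 / c"
      using i n by (simp add: R_def)
    also have "\<dots> = v $ i"
    proof (cases "c = 0")
      case False
      then show ?thesis by (simp add: u_def c_def)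
    next
      \<comment> \<open>For \<open>c = 0\<close> the vector \<open>u\<close> vanishes and the
        quotient is 0 by convention, so \<open>R\<close> is the identity and \<open>v\<close> is
        already the first unit vector.\<close>
      case True
      then have "(\<Sum>i<n. u i * u i) = 0" using uu by simp
      then have "u i * u i = 0" using i by (subst (asm) sum_nonneg_eq_0_iff) auto
      then show ?thesis using True by (simp add: u_def)
    qed
    finally show "(R *\<^sub>v unit_vec n 0) $ i = v $ i" .
  qed (use v R in auto)
  ultimately show ?thesis using R that by blast
qed

lemma mult_carrier_square:
  "A \<in> carrier_mat n n \<Longrightarrow> B \<in> carrier_mat n n \<Longrightarrow> A * B \<in> carrier_mat n n"
  by simp

lemma block_diag_mult:
  fixes A1 A2 B1 B2 :: "'a :: semiring_0 mat"
  assumes "A1 \<in> carrier_mat m m" "A2 \<in> carrier_mat m m" "B1 \<in> carrier_mat n n" "B2 \<in> carrier_mat n n"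
  shows "four_block_mat A1 (0\<^sub>m m n) (0\<^sub>m n m) B1 * four_block_mat A2 (0\<^sub>m m n) (0\<^sub>m n m) B2
    = four_block_mat (A1 * A2) (0\<^sub>m m n) (0\<^sub>m n m) (B1 * B2)"
proof -
  have "A1 * A2 + 0\<^sub>m m n * 0\<^sub>m n m = A1 * A2" "A1 * 0\<^sub>m m n + 0\<^sub>m m n * B2 = 0\<^sub>m m n"
    "0\<^sub>m n m * A2 + B1 * 0\<^sub>m n m = 0\<^sub>m n m" "0\<^sub>m n m * 0\<^sub>m m n + B1 * B2 = B1 * B2"
    using assms by (auto intro!: eq_matI simp: scalar_prod_def)
  then show ?thesis
    using assms by (subst mult_four_block_mat[of _ m m _ n _ n _ _ m _ n]) simp_all
qed

text \<open>Deflation: conjugation by a reflection that takes the first unit vector to an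
  eigenvector isolates the eigenvalue in the first column, by symmetry also in the first row, and
  induction handles the remaining block.\<close>

theorem real_spectral_theorem:
  fixes A :: "real mat"
  assumes "A \<in> carrier_mat n n" "transpose_mat A = A"
  shows "\<exists>U d. U \<in> carrier_mat n n \<and> transpose_mat U * U = 1\<^sub>m n \<and> U * transpose_mat U = 1\<^sub>m n
    \<and> A = U * mat_diag n d * transpose_mat U"
  using assms
proof (induction n arbitrary: A)
  case 0
  then show ?case by (intro exI[of _ "1\<^sub>m 0"] exI[of _ "\<lambda>_. 0"]) (auto intro!: eq_matI)
next
  case (Suc m)
  let ?n = "Suc m"
  note A = Suc.prems(1) and sym = Suc.prems(2)
  obtain v k where v: "v \<in> carrier_vec ?n" "v \<bullet> v = 1" "A *\<^sub>v v = k \<cdot>\<^sub>v v"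
    using symmetric_mat_has_eigenvector[OF A sym] by blast
  obtain R where R: "R \<in> carrier_mat ?n ?n" "transpose_mat R = R" "R * R = 1\<^sub>m ?n" "R *\<^sub>v unit_vec ?n 0 = v"
    using householder_reflection[OF v(1,2)] by blast
  define B where "B = R * A * R"
  have B: "B \<in> carrier_mat ?n ?n" unfolding B_def using R A by auto
  have Bs: "transpose_mat B = B"
    unfolding B_def using R A sym
    by (simp add: transpose_mult[of _ ?n ?n _ ?n] assoc_mult_mat[of _ ?n ?n _ ?n _ ?n])
  have "B *\<^sub>v unit_vec ?n 0 = R *\<^sub>v (A *\<^sub>v v)"
    unfolding B_def using R A by (simp add: assoc_mult_mat_vec[of _ ?n ?n _ ?n])
  also have "\<dots> = k \<cdot>\<^sub>v (R *\<^sub>v (R *\<^sub>v unit_vec ?n 0))"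
    unfolding v(3) using R v by (simp add: mult_mat_vec[of _ ?n ?n])
  also have "R *\<^sub>v (R *\<^sub>v unit_vec ?n 0) = unit_vec ?n 0"
    using assoc_mult_mat_vec[OF R(1) R(1), of "unit_vec ?n 0"] R(3) by simp
  finally have Be: "B *\<^sub>v unit_vec ?n 0 = k \<cdot>\<^sub>v unit_vec ?n 0" .
  have B0: "B $$ (i, 0) = (if i = 0 then k else 0)" if "i < ?n" for i
    using arg_cong[OF Be, of "\<lambda>x. x $ i"] that B by simp
  have B0': "B $$ (0, j) = (if j = 0 then k else 0)" if "j < ?n" for j
    using B0[OF that] B that Bs by (metis carrier_matD index_transpose_mat(1) zero_less_Suc)
  define B3 where "B3 = mat m m (\<lambda>(i, j). B $$ (Suc i, Suc j))"
  have B3: "B3 \<in> carrier_mat m m" by (simp add: B3_def)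
  have "transpose_mat B3 = B3"
  proof (rule eq_matI)
    fix i j assume "i < dim_row B3" "j < dim_col B3"
    then have ij: "i < m" "j < m" by (auto simp: B3_def)
    then have "B $$ (Suc j, Suc i) = B $$ (Suc i, Suc j)"
      using B Bs by (metis Suc_mono carrier_matD index_transpose_mat(1))
    then show "transpose_mat B3 $$ (i, j) = B3 $$ (i, j)" using ij by (simp add: B3_def)
  qed (auto simp: B3_def)
  then obtain U3 d where U3: "U3 \<in> carrier_mat m m" "transpose_mat U3 * U3 = 1\<^sub>m m"
    "U3 * transpose_mat U3 = 1\<^sub>m m" "B3 = U3 * mat_diag m d * transpose_mat U3"
    using Suc.IH[OF B3] by blast
  define U4 where "U4 = four_block_mat (1\<^sub>m 1) (0\<^sub>m 1 m) (0\<^sub>m m 1) U3"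
  define d4 where "d4 = case_nat k d"
  have U4: "U4 \<in> carrier_mat ?n ?n" unfolding U4_def using U3 four_block_carrier_mat[of "1\<^sub>m 1" 1 1 U3 m m] by simp
  have U4T: "transpose_mat U4 = four_block_mat (1\<^sub>m 1) (0\<^sub>m 1 m) (0\<^sub>m m 1) (transpose_mat U3)"
    unfolding U4_def using U3 by (subst transpose_four_block_mat[of _ 1 1 _ m _ m]) auto
  have D4: "mat_diag ?n d4 = four_block_mat (mat_diag 1 (\<lambda>_. k)) (0\<^sub>m 1 m) (0\<^sub>m m 1) (mat_diag m d)"
    by (rule eq_matI) (auto simp: mat_diag_def d4_def split: nat.splits)
  have o4: "transpose_mat U4 * U4 = 1\<^sub>m ?n" "U4 * transpose_mat U4 = 1\<^sub>m ?n"
    unfolding U4T unfolding U4_def using U3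
    by (subst block_diag_mult[of _ 1 _ _ m]; simp)+
  have "B = four_block_mat (mat_diag 1 (\<lambda>_. k)) (0\<^sub>m 1 m) (0\<^sub>m m 1) B3"
    using B B0 B0' by (intro eq_matI) (auto simp: mat_diag_def B3_def)
  also have "\<dots> = U4 * mat_diag ?n d4 * transpose_mat U4"
    unfolding D4 U4T unfolding U4_def using U3
    by (simp add: block_diag_mult[of _ "Suc 0" _ _ m] mult_carrier_square
        left_mult_one_mat[of _ "Suc 0" "Suc 0"] right_mult_one_mat[of _ "Suc 0" "Suc 0"])
  finally have BU: "B = U4 * mat_diag ?n d4 * transpose_mat U4" .
  define U where "U = R * U4"
  have U: "U \<in> carrier_mat ?n ?n" using R U4 by (simp add: U_def)
  have UT: "transpose_mat U = transpose_mat U4 * R"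
    unfolding U_def using R U4 by (simp add: transpose_mult[of _ ?n ?n _ ?n])
  note as = assoc_mult_mat[of _ ?n ?n _ ?n _ ?n]
  have "transpose_mat U * U = transpose_mat U4 * (R * R) * U4"
    unfolding UT unfolding U_def using R(1) U4 by (simp add: as)
  then have 1: "transpose_mat U * U = 1\<^sub>m ?n" using U4 o4 R by simp
  have "A = R * R * A * (R * R)" using R A by simp
  also have "\<dots> = R * B * R" unfolding B_def using R(1) A by (simp add: as)
  also have "\<dots> = U * mat_diag ?n d4 * transpose_mat U"
    unfolding BU UT unfolding U_def using R(1) U4 by (simp add: as mult_carrier_square)
  finally have 2: "A = U * mat_diag ?n d4 * transpose_mat U" .
  have "U * transpose_mat U = 1\<^sub>m ?n"
    using mat_mult_left_right_inverse[OF _ U 1] U by simp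
  then show ?case using U 1 2 by blast
qed

text \<open>Functional calculus: in a fixed orthogonal frame, inverses and square roots reduce to
  scalar identities between diagonal entries.\<close>

lemma spectral_mult:
  fixes U :: "real mat"
  assumes U: "U \<in> carrier_mat n n" "transpose_mat U * U = 1\<^sub>m n"
  shows "(U * mat_diag n d * transpose_mat U) * (U * mat_diag n e * transpose_mat U)
    = U * mat_diag n (\<lambda>i. d i * e i) * transpose_mat U"
proof -
  note as = assoc_mult_mat[of _ n n _ n _ n]
  have "(U * mat_diag n d * transpose_mat U) * (U * mat_diag n e * transpose_mat U)
    = U * mat_diag n d * (transpose_mat U * U) * mat_diag n e * transpose_mat U"
    using U(1) by (simp add: as mult_carrier_square)
  also have "\<dots> = U * (mat_diag n d * mat_diag n e) * transpose_mat U"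
    unfolding U(2) using U(1) by (simp add: as mult_carrier_square left_mult_one_mat[of _ n n] del: mat_diag_diag)
  finally show ?thesis by simp
qed

lemma spectral_quadratic_form:
  fixes U :: "real mat"
  assumes U: "U \<in> carrier_mat n n" and x: "x \<in> carrier_vec n"
  shows "x \<bullet> ((U * mat_diag n d * transpose_mat U) *\<^sub>v x) = (\<Sum>i<n. d i * ((transpose_mat U *\<^sub>v x) $ i)\<^sup>2)"
proof -
  define y where "y = transpose_mat U *\<^sub>v x"
  have y: "y \<in> carrier_vec n" using U x by (simp add: y_def)
  have dy: "mat_diag n d *\<^sub>v y \<in> carrier_vec n" by (rule mult_mat_vec_carrier[OF mat_diag_dim y])
  have "(U * mat_diag n d * transpose_mat U) *\<^sub>v x = U *\<^sub>v (mat_diag n d *\<^sub>v y)"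
    unfolding y_def using U x by (simp add: assoc_mult_mat_vec[of _ n n _ n] assoc_mult_mat[of _ n n _ n _ n] mult_carrier_square)
  then have "x \<bullet> ((U * mat_diag n d * transpose_mat U) *\<^sub>v x) = y \<bullet> (mat_diag n d *\<^sub>v y)"
    using transpose_vec_mult_scalar[OF U dy x] by (simp add: y_def)
  also have "\<dots> = (\<Sum>i<n. y $ i * (d i * y $ i))"
  proof -
    have "(mat_diag n d *\<^sub>v y) $ i = d i * y $ i" if "i < n" for i
      using that y by (simp add: mat_diag_def scalar_prod_def if_distrib[of "\<lambda>x. x * _"] cong: if_cong)
    then show ?thesis using y by (simp add: scalar_prod_def atLeast0LessThan mat_diag_def)
  qed
  finally show ?thesis by (simp add: y_def power2_eq_square mult_ac)
qed

lemma spectral_eigenvector: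
  fixes U :: "real mat"
  assumes U: "U \<in> carrier_mat n n" "transpose_mat U * U = 1\<^sub>m n" and i: "i < n"
  shows "(U * mat_diag n d * transpose_mat U) *\<^sub>v (U *\<^sub>v unit_vec n i) = d i \<cdot>\<^sub>v (U *\<^sub>v unit_vec n i)"
    and "(U *\<^sub>v unit_vec n i) \<bullet> (U *\<^sub>v unit_vec n i) = 1"
proof -
  note asv = assoc_mult_mat_vec[of _ n n _ n]
  have e: "transpose_mat U *\<^sub>v (U *\<^sub>v unit_vec n i) = unit_vec n i"
    using asv[of "transpose_mat U" U "unit_vec n i"] U by simp
  have d: "mat_diag n d *\<^sub>v unit_vec n i = d i \<cdot>\<^sub>v unit_vec n i"
    using i by (intro eq_vecI) (auto simp: mat_diag_def)
  have "(U * mat_diag n d * transpose_mat U) *\<^sub>v (U *\<^sub>v unit_vec n i)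
     = U *\<^sub>v (mat_diag n d *\<^sub>v (transpose_mat U *\<^sub>v (U *\<^sub>v unit_vec n i)))"
    using U by (simp add: asv assoc_mult_mat[of _ n n _ n _ n] mult_carrier_square)
  then show "(U * mat_diag n d * transpose_mat U) *\<^sub>v (U *\<^sub>v unit_vec n i) = d i \<cdot>\<^sub>v (U *\<^sub>v unit_vec n i)"
    unfolding e d using U by (simp add: mult_mat_vec[of _ n n])
  have "(U *\<^sub>v unit_vec n i) \<bullet> (U *\<^sub>v unit_vec n i) = (transpose_mat U *\<^sub>v (U *\<^sub>v unit_vec n i)) \<bullet> unit_vec n i"
    by (rule transpose_vec_mult_scalar[symmetric]) (use U in auto)
  then show "(U *\<^sub>v unit_vec n i) \<bullet> (U *\<^sub>v unit_vec n i) = 1" unfolding e using i by simp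
qed

section \<open>Inverse, inverse square root and smallest eigenvalue\<close>

text \<open>\<open>mat_inv\<close> is a definite description, so evaluating it requires uniqueness
  of the two-sided inverse.\<close>

lemma mat_inv_eqI:
  assumes "A \<in> carrier_mat n n" "M \<in> carrier_mat n n" "M * A = 1\<^sub>m n" "A * M = 1\<^sub>m n"
  shows "mat_inv n A = M"
  unfolding mat_inv_def
proof (rule the_equality)
  fix M' assume M': "M' \<in> carrier_mat n n \<and> M' * A = 1\<^sub>m n \<and> A * M' = 1\<^sub>m n"
  then have "M' = M' * (A * M)" using assms right_mult_one_mat[of M' n n] by simp
  also have "\<dots> = (M' * A) * M" using assms M' by (metis assoc_mult_mat)
  finally show "M' = M" using assms M' by (metis left_mult_one_mat)
qed (use assms in auto)

lemma mat_inv_invertible: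
  assumes A: "A \<in> carrier_mat n n" "invertible_mat A"
  shows "mat_inv n A \<in> carrier_mat n n" "mat_inv n A * A = 1\<^sub>m n" "A * mat_inv n A = 1\<^sub>m n"
proof -
  obtain B where B: "A * B = 1\<^sub>m n" "B * A = 1\<^sub>m (dim_row B)"
    using A unfolding invertible_mat_def inverts_mat_def by auto
  have "dim_col B = n" using arg_cong[OF B(1), of dim_col] by simp
  moreover have "dim_row B = n" using arg_cong[OF B(2), of dim_col] A by simp
  ultimately have "B \<in> carrier_mat n n" "B * A = 1\<^sub>m n" using B by auto
  then show "mat_inv n A \<in> carrier_mat n n" "mat_inv n A * A = 1\<^sub>m n" "A * mat_inv n A = 1\<^sub>m n"
    using mat_inv_eqI[OF A(1), of B] B by auto
qed

text \<open>With \<open>D = W - W'\<close> one has \<open>W D + D W' = 0\<close>, and the trace of \<open>D (W D + D W')\<close> is the sum of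
  the values of the two positive definite forms on the columns of \<open>D\<close>.\<close>

lemma pos_def_sqrt_unique:
  assumes W: "W \<in> carrier_mat n n" "transpose_mat W = W" "pos_def_mat n W"
    and W': "W' \<in> carrier_mat n n" "transpose_mat W' = W'" "pos_def_mat n W'"
    and eq: "W * W = W' * W'"
  shows "W = W'"
proof -
  define D where "D = W - W'"
  have D: "D \<in> carrier_mat n n" using W W' unfolding D_def by (intro minus_carrier_mat)
  have DT: "transpose_mat D = D" using W W' by (simp add: D_def transpose_minus[of _ n n])
  note as = assoc_mult_mat[of _ n n _ n _ n]
  have "W * D + D * W' = W * W - W * W' + (W * W' - W' * W')"
    unfolding D_def using W W' 
    by (simp add: mult_minus_distrib_mat[of _ n n _ n] minus_mult_distrib_mat[of _ n n _ _ n] mult_carrier_square)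
  also have "\<dots> = 0\<^sub>m n n" unfolding eq using W W' by (intro eq_matI) auto
  finally have Z: "W * D + D * W' = 0\<^sub>m n n" .
  have col: "col D j \<bullet> (W *\<^sub>v col D j) + (D * (D * W')) $$ (j, j) = 0" if j: "j < n" for j
  proof -
    have "(D * (W * D + D * W')) $$ (j, j) = 0" unfolding Z using D j by simp
    moreover have "D * (W * D + D * W') = D * (W * D) + D * (D * W')"
      using D W W' by (simp add: mult_add_distrib_mat[of _ n n _ n] mult_carrier_square)
    moreover have "(D * (W * D)) $$ (j, j) = row D j \<bullet> col (W * D) j"
      using D W j by simp
    moreover have "row D j = col D j" using Matrix.row_transpose[of j D] DT D j by simp
    moreover have "col (W * D) j = W *\<^sub>v col D j" by (rule col_mult2[OF W(1) D j])
    ultimately show ?thesis using D W W' j by simp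
  qed
  \<comment> \<open>Cyclicity of the trace moves one factor \<open>D\<close> to the end; the
    diagonal of \<open>D * W' * D\<close> consists of values of a quadratic form because
    \<open>D\<close> is symmetric.\<close>
  have tr: "(\<Sum>j<n. (D * (D * W')) $$ (j, j)) = (\<Sum>j<n. col D j \<bullet> (W' *\<^sub>v col D j))"
  proof -
    have "(\<Sum>j<n. (D * (D * W')) $$ (j, j)) = (\<Sum>j<n. \<Sum>k<n. D $$ (j, k) * (D * W') $$ (k, j))"
      using D W' by (intro sum.cong refl) (simp add: scalar_prod_def atLeast0LessThan)
    also have "\<dots> = (\<Sum>k<n. \<Sum>j<n. (D * W') $$ (k, j) * D $$ (j, k))"
      by (subst sum.swap) (simp add: mult.commute)
    also have "\<dots> = (\<Sum>k<n. ((D * W') * D) $$ (k, k))"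
      using D W' by (intro sum.cong refl) (simp add: scalar_prod_def atLeast0LessThan del: assoc_mult_mat)
    also have "\<dots> = (\<Sum>k<n. col D k \<bullet> (W' *\<^sub>v col D k))"
    proof (intro sum.cong refl)
      fix k assume "k \<in> {..<n}"
      then have k: "k < n" by simp
      have "((D * W') * D) $$ (k, k) = (D * (W' * D)) $$ (k, k)" using D W' by (simp add: as)
      also have "\<dots> = row D k \<bullet> col (W' * D) k" using D W' k by simp
      also have "row D k = col D k" using Matrix.row_transpose[of k D] DT D k by simp
      also have "col (W' * D) k = W' *\<^sub>v col D k" by (rule col_mult2[OF W'(1) D k])
      finally show "((D * W') * D) $$ (k, k) = col D k \<bullet> (W' *\<^sub>v col D k)" .
    qed
    finally show ?thesis .
  qed
  have nn: "0 \<le> x \<bullet> (M *\<^sub>v x)" if "pos_def_mat n M" "M \<in> carrier_mat n n" "x \<in> carrier_vec n" for M x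
    using that by (cases "x = 0\<^sub>v n") (auto simp: pos_def_mat_def less_imp_le)
  have "(\<Sum>j<n. col D j \<bullet> (W *\<^sub>v col D j) + col D j \<bullet> (W' *\<^sub>v col D j)) = 0"
  proof -
    have "(\<Sum>j<n. col D j \<bullet> (W *\<^sub>v col D j) + (D * (D * W')) $$ (j, j)) = 0" using col by simp
    then show ?thesis unfolding sum.distrib tr .
  qed
  then have z: "col D j \<bullet> (W *\<^sub>v col D j) + col D j \<bullet> (W' *\<^sub>v col D j) = 0" if "j < n" for j
    using that nn[OF W(3,1)] nn[OF W'(3,1)] D
    by (subst (asm) sum_nonneg_eq_0_iff) (auto intro!: add_nonneg_nonneg)
  have "col D j = 0\<^sub>v n" if "j < n" for j
  proof (rule ccontr)
    assume "col D j \<noteq> 0\<^sub>v n"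
    moreover have c: "col D j \<in> carrier_vec n" using D by auto
    ultimately have "0 < col D j \<bullet> (W *\<^sub>v col D j)" using W(3) by (simp add: pos_def_mat_def)
    then show False using z[OF that] nn[OF W'(3,1) c] by linarith
  qed
  then have D0: "D = 0\<^sub>m n n"
    using D by (intro mat_col_eqI) auto
  have "W $$ (i, j) = W' $$ (i, j)" if "i < n" "j < n" for i j
  proof -
    have "D $$ (i, j) = W $$ (i, j) - W' $$ (i, j)" using that W W' by (simp add: D_def)
    then show ?thesis unfolding D0 using that by simp
  qed
  then show ?thesis using W W' by (intro eq_matI) auto
qed

text \<open>A covariance is only semidefinite a priori; a zero eigenvalue would put a unit vector in
  the kernel, against invertibility.\<close>

lemma pos_semidef_invertible_spectral:
  fixes V :: "real mat"
  assumes V: "V \<in> carrier_mat n n" "transpose_mat V = V" "invertible_mat V"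
    and psd: "\<forall>x\<in>carrier_vec n. 0 \<le> x \<bullet> (V *\<^sub>v x)"
  obtains U d where "U \<in> carrier_mat n n" "transpose_mat U * U = 1\<^sub>m n" "U * transpose_mat U = 1\<^sub>m n"
    "V = U * mat_diag n d * transpose_mat U" "\<And>i. i < n \<Longrightarrow> 0 < d i"
proof -
  obtain U d where U: "U \<in> carrier_mat n n" "transpose_mat U * U = 1\<^sub>m n" "U * transpose_mat U = 1\<^sub>m n"
    "V = U * mat_diag n d * transpose_mat U"
    using real_spectral_theorem[OF V(1,2)] by blast
  have "0 < d i" if i: "i < n" for i
  proof -
    define x where "x = U *\<^sub>v unit_vec n i"
    have x: "x \<in> carrier_vec n" using U by (simp add: x_def)
    have Vx: "V *\<^sub>v x = d i \<cdot>\<^sub>v x" and xx: "x \<bullet> x = 1"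
      using spectral_eigenvector[OF U(1,2) i] unfolding U(4) x_def by auto
    have "0 \<le> d i" using bspec[OF psd x] xx x by (simp add: Vx)
    moreover have "d i \<noteq> 0"
    proof
      assume "d i = 0"
      then have "V *\<^sub>v x = 0\<^sub>v n" using Vx x by (auto intro!: eq_vecI)
      then have "mat_inv n V *\<^sub>v 0\<^sub>v n = (mat_inv n V * V) *\<^sub>v x"
        using assoc_mult_mat_vec[OF mat_inv_invertible(1)[OF V(1,3)] V(1) x] by simp
      also have "\<dots> = x" unfolding mat_inv_invertible(2)[OF V(1,3)] using x by simp
      finally have "x = 0\<^sub>v n"
        using mat_inv_invertible(1)[OF V(1,3)] by (auto intro!: eq_vecI)
      then show False using xx by simp
    qed
    ultimately show ?thesis by simp
  qed
  then show ?thesis using U that by blast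
qed

text \<open>\<open>mat_inv_sqrt\<close> is a definite description: the spectral square root is the
  witness and \<open>pos_def_sqrt_unique\<close> identifies it. The last identity normalises the
  variance in every direction.\<close>

lemma mat_inv_sqrt_props:
  fixes V :: "real mat"
  assumes V: "V \<in> carrier_mat n n" "transpose_mat V = V" "invertible_mat V"
    and psd: "\<forall>x\<in>carrier_vec n. 0 \<le> x \<bullet> (V *\<^sub>v x)"
  shows "mat_inv_sqrt n V \<in> carrier_mat n n" "transpose_mat (mat_inv_sqrt n V) = mat_inv_sqrt n V"
    "mat_inv_sqrt n V * V * mat_inv_sqrt n V = 1\<^sub>m n"
proof -
  obtain U d where U: "U \<in> carrier_mat n n" "transpose_mat U * U = 1\<^sub>m n" "U * transpose_mat U = 1\<^sub>m n"
    "V = U * mat_diag n d * transpose_mat U" and d: "\<And>i. i < n \<Longrightarrow> 0 < d i"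
    using pos_semidef_invertible_spectral[OF V psd] by blast
  let ?M = "\<lambda>e. U * mat_diag n e * transpose_mat U"
  have M: "?M e \<in> carrier_mat n n" for e using U by (simp add: mult_carrier_square)
  have M1: "?M e = 1\<^sub>m n" if "\<And>i. i < n \<Longrightarrow> e i = 1" for e
  proof -
    have "mat_diag n e = 1\<^sub>m n" using that by (intro eq_matI) (auto simp: mat_diag_def)
    then show ?thesis using U by simp
  qed
  have cong: "?M e = ?M f" if "\<And>i. i < n \<Longrightarrow> e i = f i" for e f
  proof -
    have "mat_diag n e = mat_diag n f" using that by (intro eq_matI) (auto simp: mat_diag_def)
    then show ?thesis by simp
  qed
  have MT: "transpose_mat (?M e) = ?M e" for e
  proof -
    have "transpose_mat (mat_diag n e) = mat_diag n e" by (intro eq_matI) (auto simp: mat_diag_def)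
    then show ?thesis
      using U by (simp add: transpose_mult[of _ n n _ n] assoc_mult_mat[of _ n n _ n _ n] mult_carrier_square)
  qed
  have d0: "d i \<noteq> 0" if "i < n" for i using d[OF that] by simp
  define W where "W = ?M (\<lambda>i. 1 / sqrt (d i))"
  have inv: "mat_inv n V = ?M (\<lambda>i. 1 / d i)"
    unfolding U(4) by (rule mat_inv_eqI) (use M d0 in \<open>auto simp: spectral_mult[OF U(1,2)] intro!: M1\<close>)
  have WW: "W * W = mat_inv n V"
    unfolding W_def inv spectral_mult[OF U(1,2)]
    by (rule cong) (use d in \<open>auto simp: less_imp_le\<close>)
  have pd: "pos_def_mat n W"
    unfolding pos_def_mat_def
  proof (intro ballI impI)
    fix x :: "real vec" assume x: "x \<in> carrier_vec n" "x \<noteq> 0\<^sub>v n"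
    let ?y = "transpose_mat U *\<^sub>v x"
    have "x \<bullet> (W *\<^sub>v x) = (\<Sum>i<n. 1 / sqrt (d i) * (?y $ i)\<^sup>2)"
      unfolding W_def by (rule spectral_quadratic_form[OF U(1) x(1)])
    moreover have "\<exists>i<n. ?y $ i \<noteq> 0"
    proof (rule ccontr)
      assume "\<not> (\<exists>i<n. ?y $ i \<noteq> 0)"
      then have "?y = 0\<^sub>v n" using U x by (intro eq_vecI) auto
      then have "(U * transpose_mat U) *\<^sub>v x = U *\<^sub>v 0\<^sub>v n"
        using U(1) x by (simp add: assoc_mult_mat_vec[of _ n n _ n])
      then have "x = 0\<^sub>v n" unfolding U(3) using x U by (auto intro!: eq_vecI)
      then show False using x by simp
    qed
    then obtain i where "i < n" "?y $ i \<noteq> 0" by blast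
    ultimately show "0 < x \<bullet> (W *\<^sub>v x)"
      using d by (auto intro!: sum_pos2[of _ i] simp: less_imp_le)
  qed
  have W: "W \<in> carrier_mat n n" "transpose_mat W = W" using M MT by (auto simp: W_def)
  have eq: "mat_inv_sqrt n V = W"
    unfolding mat_inv_sqrt_def
  proof (rule the_equality)
    fix W' assume "W' \<in> carrier_mat n n \<and> transpose_mat W' = W' \<and> pos_def_mat n W' \<and> W' * W' = mat_inv n V"
    then show "W' = W" using pos_def_sqrt_unique[OF _ _ _ W pd, of W'] WW by simp
  qed (use W WW pd in auto)
  show "mat_inv_sqrt n V \<in> carrier_mat n n" "transpose_mat (mat_inv_sqrt n V) = mat_inv_sqrt n V"
    unfolding eq by (fact W)+
  show "mat_inv_sqrt n V * V * mat_inv_sqrt n V = 1\<^sub>m n"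
    unfolding eq unfolding W_def U(4) spectral_mult[OF U(1,2)]
    by (rule M1) (use d d0 in \<open>auto simp: field_simps less_imp_le\<close>)
qed

text \<open>\<open>min_eig\<close> is a \<open>Min\<close>, so finiteness and nonemptiness of the
  spectrum come first; \<open>n > 0\<close> supplies an eigenvalue. Positivity follows by evaluating
  the form at an eigenvector, the bound because every \<open>d i\<close> is an eigenvalue.\<close>

lemma min_eig_quadratic_form:
  fixes V :: "real mat"
  assumes V: "V \<in> carrier_mat n n" "transpose_mat V = V" "invertible_mat V" and n: "n > 0"
    and psd: "\<forall>x\<in>carrier_vec n. 0 \<le> x \<bullet> (V *\<^sub>v x)"
  shows "0 < min_eig V" "\<And>x. x \<in> carrier_vec n \<Longrightarrow> min_eig V * (x \<bullet> x) \<le> x \<bullet> (V *\<^sub>v x)"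
proof -
  obtain U d where U: "U \<in> carrier_mat n n" "transpose_mat U * U = 1\<^sub>m n" "U * transpose_mat U = 1\<^sub>m n"
    "V = U * mat_diag n d * transpose_mat U" and d: "\<And>i. i < n \<Longrightarrow> 0 < d i"
    using pos_semidef_invertible_spectral[OF V psd] by blast
  have fin: "finite {k. eigenvalue V k}"
    using card_finite_spectrum(1)[OF V(1)] by (simp add: spectrum_def)
  have ev: "eigenvalue V (d i)" if i: "i < n" for i
  proof -
    have "(U *\<^sub>v unit_vec n i) \<bullet> (U *\<^sub>v unit_vec n i) = 1" by (rule spectral_eigenvector(2)[OF U(1,2) i])
    then have "U *\<^sub>v unit_vec n i \<noteq> 0\<^sub>v n" by auto
    then have "eigenvector V (U *\<^sub>v unit_vec n i) (d i)"
      using spectral_eigenvector(1)[OF U(1,2) i, of d] U(1) V(1)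
      unfolding U(4)[symmetric] eigenvector_def by auto
    then show ?thesis unfolding eigenvalue_def ..
  qed
  have quad: "x \<bullet> (V *\<^sub>v x) = (\<Sum>i<n. d i * ((transpose_mat U *\<^sub>v x) $ i)\<^sup>2)"
    "x \<bullet> x = (\<Sum>i<n. ((transpose_mat U *\<^sub>v x) $ i)\<^sup>2)" if x: "x \<in> carrier_vec n" for x
  proof -
    show "x \<bullet> (V *\<^sub>v x) = (\<Sum>i<n. d i * ((transpose_mat U *\<^sub>v x) $ i)\<^sup>2)"
      unfolding U(4) by (rule spectral_quadratic_form[OF U(1) x])
    show "x \<bullet> x = (\<Sum>i<n. ((transpose_mat U *\<^sub>v x) $ i)\<^sup>2)"
      using spectral_quadratic_form[OF U(1) x, of "\<lambda>_. 1"] U x by simp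
  qed
  have "min_eig V \<in> {k. eigenvalue V k}"
    unfolding min_eig_def using fin ev[OF n] by (intro Min_in) auto
  then obtain v where v: "v \<in> carrier_vec n" "v \<noteq> 0\<^sub>v n" "V *\<^sub>v v = min_eig V \<cdot>\<^sub>v v"
    using V(1) by (auto simp: eigenvalue_def eigenvector_def)
  have vv: "0 < v \<bullet> v"
    using real_scalar_prod_self_eq_0[OF v(1)] v(2) real_scalar_prod_self_nonneg[of v] by linarith
  have nz: "\<exists>i<n. (transpose_mat U *\<^sub>v v) $ i \<noteq> 0"
    using vv unfolding quad(2)[OF v(1)] by (metis (no_types, lifting) lessThan_iff less_irrefl power_zero_numeral sum.neutral)
  then obtain i where "i < n" "(transpose_mat U *\<^sub>v v) $ i \<noteq> 0" by blast
  then have "0 < v \<bullet> (V *\<^sub>v v)"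
    unfolding quad(1)[OF v(1)] using d by (intro sum_pos2[of _ i]) (auto simp: less_imp_le)
  also have "\<dots> = min_eig V * (v \<bullet> v)" unfolding v(3) using v(1) by simp
  finally show "0 < min_eig V" using vv by (simp add: zero_less_mult_iff)
  show "min_eig V * (x \<bullet> x) \<le> x \<bullet> (V *\<^sub>v x)" if "x \<in> carrier_vec n" for x
    unfolding quad[OF that] sum_distrib_left
    using ev fin by (intro sum_mono mult_right_mono) (auto simp: min_eig_def)
qed

section \<open>The standardized estimator\<close>

lemma scalar_prod_lessThan: "y \<in> carrier_vec n \<Longrightarrow> x \<bullet> y = (\<Sum>i<n. x $ i * y $ i)"
  by (auto simp: scalar_prod_def atLeast0LessThan)

lemma mult_mat_vec_entry:
  assumes "M \<in> carrier_mat m n" "u \<in> carrier_vec n" "h < m"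
  shows "(M *\<^sub>v u) $ h = (\<Sum>k<n. M $$ (h, k) * u $ k)"
  using assms by (simp add: scalar_prod_def atLeast0LessThan)

lemma le_Max_indexed:
  fixes f :: "nat \<Rightarrow> nat \<Rightarrow> real"
  assumes "i < N" "q < Q"
  shows "f i q \<le> Max {f i q | i q. i < N \<and> q < Q}"
proof (rule Max_ge)
  have "{f i q | i q. i < N \<and> q < Q} = (\<lambda>(i, q). f i q) ` ({..<N} \<times> {..<Q})" by auto
  then show "finite {f i q | i q. i < N \<and> q < Q}" by simp
qed (use assms in blast)

text \<open>Serves both \<open>Smat\<close> and \<open>S_F\<close>, which are scaled Gram matrices
  over the units.\<close>

lemma gram_bilinear_form:
  fixes g :: "nat \<Rightarrow> nat \<Rightarrow> real"
  assumes "x \<in> carrier_vec n" "y \<in> carrier_vec n"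
  shows "x \<bullet> (mat n n (\<lambda>(k, l). (\<Sum>i<N. g i k * g i l) / c) *\<^sub>v y)
    = (\<Sum>i<N. (\<Sum>k<n. x $ k * g i k) * (\<Sum>l<n. y $ l * g i l)) / c"
proof -
  have "x \<bullet> (mat n n (\<lambda>(k, l). (\<Sum>i<N. g i k * g i l) / c) *\<^sub>v y)
    = (\<Sum>k<n. x $ k * (\<Sum>l<n. (\<Sum>i<N. g i k * g i l) / c * y $ l))"
    using assms by (simp add: scalar_prod_def atLeast0LessThan)
  also have "\<dots> = (\<Sum>k<n. \<Sum>l<n. \<Sum>i<N. x $ k * g i k * (y $ l * g i l) / c)"
    by (simp add: sum_distrib_left sum_distrib_right sum_divide_distrib mult_ac)
  also have "\<dots> = (\<Sum>i<N. \<Sum>k<n. \<Sum>l<n. x $ k * g i k * (y $ l * g i l) / c)"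
  proof -
    have "(\<Sum>k<n. \<Sum>l<n. \<Sum>i<N. x $ k * g i k * (y $ l * g i l) / c)
      = (\<Sum>k<n. \<Sum>i<N. \<Sum>l<n. x $ k * g i k * (y $ l * g i l) / c)"
      by (rule sum.cong[OF refl], rule sum.swap)
    also have "\<dots> = (\<Sum>i<N. \<Sum>k<n. \<Sum>l<n. x $ k * g i k * (y $ l * g i l) / c)" by (rule sum.swap)
    finally show ?thesis .
  qed
  finally show ?thesis by (simp add: sum_product sum_divide_distrib)
qed

section \<open>Scores and the quadratic forms of the covariance\<close>

context
  fixes N Q p H :: nat and Nq :: "nat \<Rightarrow> nat" and Y :: "nat \<Rightarrow> nat \<Rightarrow> real vec" and F :: "nat \<Rightarrow> real mat"
  assumes Nq_pos: "\<forall>q<Q. Nq q \<ge> 1" and NqN: "(\<Sum>q<Q. Nq q) = N"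
    and Y_carrier: "\<forall>i<N. \<forall>q<Q. Y i q \<in> carrier_vec p"
    and F_carrier: "\<forall>q<Q. F q \<in> carrier_mat H p"
begin

lemmas Nq1 = Nq_pos[rule_format] and Yc = Y_carrier[rule_format] and Fc = F_carrier[rule_format]

definition score :: "real vec \<Rightarrow> nat \<Rightarrow> nat \<Rightarrow> real" where
  "score u i q = (u \<bullet> (F q *\<^sub>v Ybreve N p Y i q)) / real (Nq q)"

lemma dual_score:
  assumes "u \<in> carrier_vec H" "q < Q" "y \<in> carrier_vec p"
  shows "u \<bullet> (F q *\<^sub>v y) = (\<Sum>k<p. (transpose_mat (F q) *\<^sub>v u) $ k * y $ k)"
  using transpose_vec_mult_scalar[OF Fc[OF assms(2)] assms(3,1)] assms
  by (simp add: scalar_prod_lessThan)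

lemma F_mult_carrier: "q < Q \<Longrightarrow> F q *\<^sub>v y \<in> carrier_vec H"
  by (rule carrier_vecI) (use Fc[of q] in auto)

lemma Ybreve_carrier [simp]: "Ybreve N p Y i q \<in> carrier_vec p"
  by (simp add: Ybreve_def)

lemma score_eq:
  assumes u: "u \<in> carrier_vec H" and q: "q < Q" and i: "i < N"
  shows "score u i q = u \<bullet> (F q *\<^sub>v Y i q) / real (Nq q)
    - (\<Sum>j<N. u \<bullet> (F q *\<^sub>v Y j q) / real (Nq q)) / real N"
proof -
  let ?f = "\<lambda>k. (transpose_mat (F q) *\<^sub>v u) $ k"
  have "u \<bullet> (F q *\<^sub>v Ybreve N p Y i q) = (\<Sum>k<p. ?f k * (Y i q $ k - (\<Sum>j<N. Y j q $ k) / real N))"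
    unfolding dual_score[OF u q Ybreve_carrier] by (simp add: Ybreve_def Ybar_def)
  also have "\<dots> = (\<Sum>k<p. ?f k * Y i q $ k) - (\<Sum>k<p. \<Sum>j<N. ?f k * Y j q $ k) / real N"
    by (simp add: right_diff_distrib sum_subtractf sum_divide_distrib sum_distrib_left)
  also have "(\<Sum>k<p. \<Sum>j<N. ?f k * Y j q $ k) = (\<Sum>j<N. u \<bullet> (F q *\<^sub>v Y j q))"
    by (subst sum.swap) (simp add: dual_score[OF u q] Yc q)
  finally show ?thesis
    unfolding score_def dual_score[OF u q Yc[OF i q], symmetric]
    by (simp add: diff_divide_distrib sum_divide_distrib mult.commute)
qed

lemma score_centered:
  assumes "u \<in> carrier_vec H" "q < Q"
  shows "(\<Sum>i<N. score u i q) = 0"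
  using assms by (cases "N = 0") (simp_all add: score_eq sum_subtractf)

text \<open>Each level is used exactly \<open>Nq q\<close> times, so undoing the centring of the
  scores contributes the same constant for every assignment.\<close>

lemma gamma_hat_score:
  assumes u: "u \<in> carrier_vec H" and z: "z \<in> assignments N Q Nq"
  shows "u \<bullet> gamma_hat N Q p H Nq Y F z
    = (\<Sum>i<N. score u i (z i)) + (\<Sum>q<Q. \<Sum>j<N. u \<bullet> (F q *\<^sub>v Y j q)) / real N"
proof -
  let ?f = "\<lambda>q k. (transpose_mat (F q) *\<^sub>v u) $ k"
  let ?I = "\<lambda>q. {i. i < N \<and> z i = q}"
  have "u \<bullet> gamma_hat N Q p H Nq Y F z = (\<Sum>h<H. \<Sum>q<Q. u $ h * (F q *\<^sub>v Yhat N p Nq Y z q) $ h)"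
    by (subst scalar_prod_lessThan[of _ H]) (simp_all add: gamma_hat_def sum_distrib_left)
  also have "\<dots> = (\<Sum>q<Q. u \<bullet> (F q *\<^sub>v Yhat N p Nq Y z q))"
    by (subst sum.swap) (simp add: scalar_prod_lessThan[OF F_mult_carrier])
  also have "\<dots> = (\<Sum>q<Q. \<Sum>i\<in>?I q. u \<bullet> (F q *\<^sub>v Y i q) / real (Nq q))"
  proof (rule sum.cong[OF refl])
    fix q assume "q \<in> {..<Q}"
    then have q: "q < Q" by simp
    have "u \<bullet> (F q *\<^sub>v Yhat N p Nq Y z q) = (\<Sum>k<p. \<Sum>i\<in>?I q. ?f q k * Y i q $ k / real (Nq q))"
      by (subst dual_score[OF u q]) (simp_all add: Yhat_def sum_distrib_left sum_divide_distrib)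
    also have "\<dots> = (\<Sum>i\<in>?I q. u \<bullet> (F q *\<^sub>v Y i q) / real (Nq q))"
      by (subst sum.swap) (simp add: dual_score[OF u q] Yc q sum_divide_distrib)
    finally show "u \<bullet> (F q *\<^sub>v Yhat N p Nq Y z q) = (\<Sum>i\<in>?I q. u \<bullet> (F q *\<^sub>v Y i q) / real (Nq q))" .
  qed
  also have "\<dots> = (\<Sum>i<N. u \<bullet> (F (z i) *\<^sub>v Y i (z i)) / real (Nq (z i)))"
    unfolding sum_group_assignment[OF z] by (intro sum.cong refl) auto
  also have "\<dots> = (\<Sum>i<N. score u i (z i) + (\<Sum>j<N. u \<bullet> (F (z i) *\<^sub>v Y j (z i)) / real (Nq (z i))) / real N)"
    using z by (intro sum.cong refl) (simp add: score_eq u assignments_def)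
  also have "\<dots> = (\<Sum>i<N. score u i (z i)) + (\<Sum>q<Q. real (Nq q) * ((\<Sum>j<N. u \<bullet> (F q *\<^sub>v Y j q) / real (Nq q)) / real N))"
    by (simp add: sum.distrib sum_over_assignment[OF z, of "\<lambda>q. (\<Sum>j<N. u \<bullet> (F q *\<^sub>v Y j q) / real (Nq q)) / real N"])
  also have "(\<Sum>q<Q. real (Nq q) * ((\<Sum>j<N. u \<bullet> (F q *\<^sub>v Y j q) / real (Nq q)) / real N))
     = (\<Sum>q<Q. \<Sum>j<N. u \<bullet> (F q *\<^sub>v Y j q)) / real N"
    unfolding sum_divide_distrib[of _ "{..<Q}"]
  proof (rule sum.cong[OF refl])
    fix q assume "q \<in> {..<Q}"
    then have "Nq q \<noteq> 0" using Nq1[of q] by simp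
    then show "real (Nq q) * ((\<Sum>j<N. u \<bullet> (F q *\<^sub>v Y j q) / real (Nq q)) / real N)
       = (\<Sum>j<N. u \<bullet> (F q *\<^sub>v Y j q)) / real N"
      by (simp flip: sum_divide_distrib)
  qed
  finally show ?thesis .
qed

text \<open>The constant in \<open>gamma_hat_score\<close> is the mean, since the score sum itself
  has mean zero; subtraction removes it.\<close>

lemma gamma_hat_centered_score:
  assumes u: "u \<in> carrier_vec H" and z: "z \<in> assignments N Q Nq" and N: "N \<ge> 1"
  shows "u \<bullet> (gamma_hat N Q p H Nq Y F z - gamma_hat_mean N Q p H Nq Y F) = (\<Sum>i<N. score u i (z i))"
proof -
  let ?O = "assignments N Q Nq" and ?g = "gamma_hat N Q p H Nq Y F" and ?m = "gamma_hat_mean N Q p H Nq Y F"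
  let ?K = "(\<Sum>q<Q. \<Sum>j<N. u \<bullet> (F q *\<^sub>v Y j q)) / real N"
  have g: "?g w \<in> carrier_vec H" for w by (simp add: gamma_hat_def)
  have m: "?m \<in> carrier_vec H" by (simp add: gamma_hat_mean_def)
  have O0: "card ?O > 0" using z finite_assignments by (auto simp: card_gt_0_iff)
  have "u \<bullet> ?m = (\<Sum>h<H. \<Sum>w\<in>?O. u $ h * ?g w $ h / real (card ?O))"
    by (subst scalar_prod_lessThan[OF m]) (simp add: gamma_hat_mean_def sum_distrib_left sum_divide_distrib)
  also have "\<dots> = (\<Sum>w\<in>?O. u \<bullet> ?g w) / real (card ?O)"
    by (subst sum.swap) (simp add: scalar_prod_lessThan[OF g] sum_divide_distrib)
  also have "(\<Sum>w\<in>?O. u \<bullet> ?g w) = (\<Sum>w\<in>?O. (\<Sum>i<N. score u i (w i)) + ?K)"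
    by (intro sum.cong refl gamma_hat_score u)
  also have "\<dots> = real (card ?O) * ?K"
    using assignment_sum_mean[OF NqN N score_centered[OF u]] by (simp add: sum.distrib)
  finally have "u \<bullet> ?m = ?K" using O0 by simp
  then show ?thesis
    using scalar_prod_minus_distrib[OF u g m, of z] gamma_hat_score[OF u z] by simp
qed

lemma Smat_carrier [simp]: "Smat N p Y q q' \<in> carrier_mat p p"
  by (simp add: Smat_def)

lemma Smat_bilinear_form:
  assumes "x \<in> carrier_vec p" "y \<in> carrier_vec p"
  shows "x \<bullet> (Smat N p Y q q *\<^sub>v y) = (\<Sum>i<N. (\<Sum>k<p. x $ k * Ybreve N p Y i q $ k)
     * (\<Sum>k<p. y $ k * Ybreve N p Y i q $ k)) / (real N - 1)"
  unfolding Smat_def by (rule gram_bilinear_form[where g = "\<lambda>i k. Ybreve N p Y i q $ k", OF assms])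

text \<open>Two readings of one form: by levels, so that a single summand can be bounded through the
  Loewner order, and by units, to match the variance of the permutation statistic.\<close>

lemma SumFSF_quadratic_form:
  assumes u: "u \<in> carrier_vec H"
  shows "u \<bullet> (SumFSF N Q p H Nq Y F *\<^sub>v u)
    = (\<Sum>q<Q. ((transpose_mat (F q) *\<^sub>v u) \<bullet> (Smat N p Y q q *\<^sub>v (transpose_mat (F q) *\<^sub>v u))) / real (Nq q))"
    and "u \<bullet> (SumFSF N Q p H Nq Y F *\<^sub>v u) = (\<Sum>i<N. \<Sum>q<Q. real (Nq q) * (score u i q)\<^sup>2) / (real N - 1)"
proof -
  let ?M = "\<lambda>q. F q * Smat N p Y q q * transpose_mat (F q)"
  have "u \<bullet> (SumFSF N Q p H Nq Y F *\<^sub>v u)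
     = (\<Sum>h<H. \<Sum>h'<H. \<Sum>q<Q. u $ h * ?M q $$ (h, h') * u $ h' / real (Nq q))"
    using u by (simp add: SumFSF_def scalar_prod_def atLeast0LessThan sum_distrib_left sum_distrib_right mult_ac)
  also have "\<dots> = (\<Sum>h<H. \<Sum>q<Q. \<Sum>h'<H. u $ h * ?M q $$ (h, h') * u $ h' / real (Nq q))"
    by (rule sum.cong[OF refl], rule sum.swap)
  also have "\<dots> = (\<Sum>q<Q. \<Sum>h<H. \<Sum>h'<H. u $ h * ?M q $$ (h, h') * u $ h' / real (Nq q))"
    by (rule sum.swap)
  also have "\<dots> = (\<Sum>q<Q. u \<bullet> (?M q *\<^sub>v u) / real (Nq q))"
  proof (rule sum.cong[OF refl])
    fix q assume "q \<in> {..<Q}"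
    then have M: "?M q \<in> carrier_mat H H"
      using Fc[of q] mult_carrier_mat[OF Fc Smat_carrier] by (intro mult_carrier_mat[of _ H p]) auto
    have "(?M q *\<^sub>v u) $ h = (\<Sum>h'<H. ?M q $$ (h, h') * u $ h')" if "h < H" for h
      by (rule mult_mat_vec_entry[OF M u that])
    moreover have "?M q *\<^sub>v u \<in> carrier_vec H" using M u by (rule mult_mat_vec_carrier)
    ultimately show "(\<Sum>h<H. \<Sum>h'<H. u $ h * ?M q $$ (h, h') * u $ h' / real (Nq q)) = u \<bullet> (?M q *\<^sub>v u) / real (Nq q)"
      by (simp add: scalar_prod_lessThan[of _ H] sum_distrib_left sum_divide_distrib mult.assoc del: index_mult_mat(1))
  qed
  also have "\<dots> = (\<Sum>q<Q. ((transpose_mat (F q) *\<^sub>v u) \<bullet> (Smat N p Y q q *\<^sub>v (transpose_mat (F q) *\<^sub>v u))) / real (Nq q))"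
  proof (rule sum.cong[OF refl])
    fix q assume "q \<in> {..<Q}"
    then have Fq: "F q \<in> carrier_mat H p" using Fc by simp
    let ?f = "transpose_mat (F q) *\<^sub>v u"
    have f: "?f \<in> carrier_vec p" using Fq u by simp
    have Sf: "Smat N p Y q q *\<^sub>v ?f \<in> carrier_vec p" by (rule mult_mat_vec_carrier[OF Smat_carrier f])
    have "?M q *\<^sub>v u = F q *\<^sub>v (Smat N p Y q q *\<^sub>v ?f)"
      using assoc_mult_mat_vec[OF mult_carrier_mat[OF Fq Smat_carrier], of "transpose_mat (F q)" H u q q]
        assoc_mult_mat_vec[OF Fq Smat_carrier f] Fq u by simp
    then show "u \<bullet> (?M q *\<^sub>v u) / real (Nq q) = ?f \<bullet> (Smat N p Y q q *\<^sub>v ?f) / real (Nq q)"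
      using transpose_vec_mult_scalar[OF Fq Sf u] by simp
  qed
  finally show eq: "u \<bullet> (SumFSF N Q p H Nq Y F *\<^sub>v u)
    = (\<Sum>q<Q. ((transpose_mat (F q) *\<^sub>v u) \<bullet> (Smat N p Y q q *\<^sub>v (transpose_mat (F q) *\<^sub>v u))) / real (Nq q))" .
  also have "\<dots> = (\<Sum>q<Q. \<Sum>i<N. real (Nq q) * (score u i q)\<^sup>2 / (real N - 1))"
  proof (rule sum.cong[OF refl])
    fix q assume "q \<in> {..<Q}"
    then have q: "q < Q" by simp
    then have n: "real (Nq q) \<noteq> 0" using Nq1[of q] by simp
    have f: "transpose_mat (F q) *\<^sub>v u \<in> carrier_vec p" using Fc[OF q] u by simp
    have "(\<Sum>k<p. (transpose_mat (F q) *\<^sub>v u) $ k * Ybreve N p Y i q $ k) = real (Nq q) * score u i q" for i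
      using n by (simp add: score_def dual_score[OF u q])
    then show "((transpose_mat (F q) *\<^sub>v u) \<bullet> (Smat N p Y q q *\<^sub>v (transpose_mat (F q) *\<^sub>v u))) / real (Nq q)
      = (\<Sum>i<N. real (Nq q) * (score u i q)\<^sup>2 / (real N - 1))"
      unfolding Smat_bilinear_form[OF f f] using n
      by (simp add: sum_divide_distrib power2_eq_square mult_ac)
  qed
  finally show "u \<bullet> (SumFSF N Q p H Nq Y F *\<^sub>v u) = (\<Sum>i<N. \<Sum>q<Q. real (Nq q) * (score u i q)\<^sup>2) / (real N - 1)"
    by (subst (asm) sum.swap) (simp add: sum_divide_distrib)
qed

text \<open>The factors \<open>Nq q\<close> undo the division in \<open>score\<close>, so the
  centred projections of \<open>gamma_unit\<close> are the row sums that correct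
  \<open>perm_stat_variance\<close>.\<close>

lemma S_F_quadratic_form:
  assumes u: "u \<in> carrier_vec H"
  shows "u \<bullet> (S_F N Q H Y F *\<^sub>v u) = (\<Sum>i<N. (\<Sum>q<Q. real (Nq q) * score u i q)\<^sup>2) / (real N - 1)"
proof -
  have "u \<bullet> gamma_unit Q H Y F i = (\<Sum>q<Q. u \<bullet> (F q *\<^sub>v Y i q))" for i
  proof -
    have "u \<bullet> gamma_unit Q H Y F i = (\<Sum>h<H. \<Sum>q<Q. u $ h * (F q *\<^sub>v Y i q) $ h)"
      by (subst scalar_prod_lessThan[of _ H]) (simp_all add: gamma_unit_def sum_distrib_left)
    also have "\<dots> = (\<Sum>q<Q. u \<bullet> (F q *\<^sub>v Y i q))"
      by (subst sum.swap) (simp add: scalar_prod_lessThan[OF F_mult_carrier])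
    finally show ?thesis .
  qed
  then have gu: "(\<Sum>h<H. u $ h * gamma_unit Q H Y F i $ h) = (\<Sum>q<Q. u \<bullet> (F q *\<^sub>v Y i q))" for i
    by (subst (asm) scalar_prod_lessThan[of _ H]) (simp_all add: gamma_unit_def)
  have "(\<Sum>h<H. u $ h * (gamma_unit Q H Y F i $ h - gamma_bar N Q H Y F $ h)) = (\<Sum>q<Q. real (Nq q) * score u i q)"
    if i: "i < N" for i
  proof -
    have "(\<Sum>h<H. u $ h * (gamma_unit Q H Y F i $ h - gamma_bar N Q H Y F $ h))
      = (\<Sum>h<H. u $ h * gamma_unit Q H Y F i $ h) - (\<Sum>h<H. \<Sum>j<N. u $ h * gamma_unit Q H Y F j $ h) / real N"
      by (simp add: gamma_bar_def right_diff_distrib sum_subtractf sum_divide_distrib sum_distrib_left)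
    also have "(\<Sum>h<H. \<Sum>j<N. u $ h * gamma_unit Q H Y F j $ h) = (\<Sum>q<Q. \<Sum>j<N. u \<bullet> (F q *\<^sub>v Y j q))"
      by (subst sum.swap) (simp only: gu, rule sum.swap)
    finally have "(\<Sum>h<H. u $ h * (gamma_unit Q H Y F i $ h - gamma_bar N Q H Y F $ h))
      = (\<Sum>q<Q. u \<bullet> (F q *\<^sub>v Y i q) - (\<Sum>j<N. u \<bullet> (F q *\<^sub>v Y j q)) / real N)"
      by (simp only: gu sum_subtractf sum_divide_distrib[of _ "{..<Q}"])
    also have "\<dots> = (\<Sum>q<Q. real (Nq q) * score u i q)"
    proof (rule sum.cong[OF refl])
      fix q assume "q \<in> {..<Q}"
      then have q: "q < Q" by simp
      then have n: "Nq q \<noteq> 0" using Nq1[of q] by simp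
      show "u \<bullet> (F q *\<^sub>v Y i q) - (\<Sum>j<N. u \<bullet> (F q *\<^sub>v Y j q)) / real N = real (Nq q) * score u i q"
        unfolding score_eq[OF u q i] using n by (simp add: right_diff_distrib flip: sum_divide_distrib)
    qed
    finally show ?thesis .
  qed
  then show ?thesis
    unfolding S_F_def
    by (subst gram_bilinear_form[where g = "\<lambda>i h. gamma_unit Q H Y F i $ h - gamma_bar N Q H Y F $ h", OF u u])
      (simp add: power2_eq_square)
qed

text \<open>Up to the factor \<open>real N - 1\<close> this is the left side of \<open>var\<close>
  in \<open>assignment_berry_esseen\<close>.\<close>

lemma V_gamma_quadratic_form:
  assumes u: "u \<in> carrier_vec H"
  shows "u \<bullet> (V_gamma N Q p H Nq Y F *\<^sub>v u) = ((\<Sum>i<N. \<Sum>q<Q. real (Nq q) * (score u i q)\<^sup>2)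
    - (\<Sum>i<N. (\<Sum>q<Q. real (Nq q) * score u i q)\<^sup>2) / real N) / (real N - 1)"
proof -
  let ?A = "SumFSF N Q p H Nq Y F" and ?B = "S_F N Q H Y F"
  have "u \<bullet> (V_gamma N Q p H Nq Y F *\<^sub>v u) = u \<bullet> (?A *\<^sub>v u) - u \<bullet> (?B *\<^sub>v u) / real N"
    using u by (simp add: V_gamma_def SumFSF_def S_F_def scalar_prod_def atLeast0LessThan
        left_diff_distrib right_diff_distrib sum_subtractf sum_divide_distrib sum_distrib_left mult_ac)
  then show ?thesis
    unfolding SumFSF_quadratic_form(2)[OF u] S_F_quadratic_form[OF u] by (simp add: diff_divide_distrib)
qed

lemma V_gamma_carrier: "V_gamma N Q p H Nq Y F \<in> carrier_mat H H"
  by (simp add: V_gamma_def)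

lemma V_gamma_symmetric: "transpose_mat (V_gamma N Q p H Nq Y F) = V_gamma N Q p H Nq Y F"
proof -
  let ?M = "\<lambda>q. F q * Smat N p Y q q * transpose_mat (F q)"
  have M: "?M q $$ (j, i) = ?M q $$ (i, j)" if q: "q < Q" and ij: "i < H" "j < H" for q i j
  proof -
    note Fq = Fc[OF q]
    have FT: "transpose_mat (F q) \<in> carrier_mat p H" using Fq by simp
    have "transpose_mat (Smat N p Y q q) = Smat N p Y q q"
      by (rule eq_matI) (auto simp: Smat_def mult.commute)
    then have "transpose_mat (?M q) = F q * (Smat N p Y q q * transpose_mat (F q))"
      by (simp add: transpose_mult[OF mult_carrier_mat[OF Fq Smat_carrier] FT] transpose_mult[OF Fq Smat_carrier])
    also have "\<dots> = ?M q" by (rule assoc_mult_mat[OF Fq Smat_carrier FT, symmetric])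
    finally have t: "transpose_mat (?M q) = ?M q" .
    have "dim_row (?M q) = H" "dim_col (?M q) = H" using Fq by auto
    then have "?M q $$ (j, i) = transpose_mat (?M q) $$ (i, j)" using ij by (simp del: index_mult_mat(1))
    then show ?thesis unfolding t .
  qed
  show ?thesis
    by (rule eq_matI) (auto simp: V_gamma_def SumFSF_def S_F_def M mult.commute simp del: index_mult_mat(1))
qed

text \<open>Cauchy-Schwarz with the weights \<open>Nq q\<close>, which add up to
  \<open>N\<close>.\<close>

lemma V_gamma_pos_semidef:
  assumes u: "u \<in> carrier_vec H"
  shows "0 \<le> u \<bullet> (V_gamma N Q p H Nq Y F *\<^sub>v u)"
proof (cases "N = 0")
  case True
  then show ?thesis unfolding V_gamma_quadratic_form[OF u] by simp
next
  case False
  have "(\<Sum>q<Q. real (Nq q) * score u i q)\<^sup>2 / real N \<le> (\<Sum>q<Q. real (Nq q) * (score u i q)\<^sup>2)" for i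
  proof -
    have "(\<Sum>q<Q. sqrt (real (Nq q)) * (sqrt (real (Nq q)) * score u i q))\<^sup>2
      \<le> (\<Sum>q<Q. (sqrt (real (Nq q)))\<^sup>2) * (\<Sum>q<Q. (sqrt (real (Nq q)) * score u i q)\<^sup>2)"
      by (rule Cauchy_Schwarz_ineq_sum)
    moreover have "(\<Sum>q<Q. real (Nq q)) = real N" unfolding NqN[symmetric] by simp
    ultimately have "(\<Sum>q<Q. real (Nq q) * score u i q)\<^sup>2 \<le> real N * (\<Sum>q<Q. real (Nq q) * (score u i q)\<^sup>2)"
      by (simp add: power_mult_distrib flip: mult.assoc)
    then show ?thesis using False by (simp add: field_simps)
  qed
  then have "(\<Sum>i<N. (\<Sum>q<Q. real (Nq q) * score u i q)\<^sup>2) / real N \<le> (\<Sum>i<N. \<Sum>q<Q. real (Nq q) * (score u i q)\<^sup>2)"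
    unfolding sum_divide_distrib by (intro sum_mono)
  then show ?thesis
    unfolding V_gamma_quadratic_form[OF u] using False by (intro divide_nonneg_nonneg) auto
qed

section \<open>Standardized directions and the two bounds\<close>

context
  assumes inv: "invertible_mat (V_gamma N Q p H Nq Y F)"
begin

abbreviation (input) "V \<equiv> V_gamma N Q p H Nq Y F"

lemma V_psd: "\<forall>u\<in>carrier_vec H. 0 \<le> u \<bullet> (V *\<^sub>v u)"
  using V_gamma_pos_semidef by blast

lemmas inv_sqrt = mat_inv_sqrt_props[OF V_gamma_carrier V_gamma_symmetric inv V_psd]

text \<open>Moving the symmetric inverse square root onto \<open>b\<close> replaces the standardised
  statistic by a plain projection with unit variance. The unit norm of \<open>b\<close> also
  excludes the degenerate sizes.\<close>

lemma standardized_direction: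
  assumes b: "b \<in> carrier_vec H" "norm2_vec b = 1"
  shows "mat_inv_sqrt H V *\<^sub>v b \<in> carrier_vec H"
    and "x \<in> carrier_vec H \<Longrightarrow> b \<bullet> (mat_inv_sqrt H V *\<^sub>v x) = (mat_inv_sqrt H V *\<^sub>v b) \<bullet> x"
    and "(mat_inv_sqrt H V *\<^sub>v b) \<bullet> (V *\<^sub>v (mat_inv_sqrt H V *\<^sub>v b)) = 1"
    and "H > 0"
    and "N \<ge> 2"
proof -
  let ?W = "mat_inv_sqrt H V" and ?u = "mat_inv_sqrt H V *\<^sub>v b"
  have bb: "b \<bullet> b = 1" using b(2) by (simp add: norm2_vec_def)
  show u: "?u \<in> carrier_vec H" by (rule mult_mat_vec_carrier[OF inv_sqrt(1) b(1)])
  show tr: "b \<bullet> (?W *\<^sub>v x) = ?u \<bullet> x" if "x \<in> carrier_vec H" for x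
    using transpose_vec_mult_scalar[OF inv_sqrt(1) that b(1)] unfolding inv_sqrt(2) by simp
  have Vu: "V *\<^sub>v ?u \<in> carrier_vec H" by (rule mult_mat_vec_carrier[OF V_gamma_carrier u])
  have "?W *\<^sub>v (V *\<^sub>v ?u) = (?W * V * ?W) *\<^sub>v b"
    using assoc_mult_mat_vec[OF inv_sqrt(1) V_gamma_carrier u]
      assoc_mult_mat_vec[OF mult_carrier_square[OF inv_sqrt(1) V_gamma_carrier] inv_sqrt(1) b(1)] by simp
  also have "\<dots> = b" unfolding inv_sqrt(3) using b(1) by simp
  finally show uVu: "?u \<bullet> (V *\<^sub>v ?u) = 1" using tr[OF Vu] bb by simp
  show "H > 0"
  proof (rule ccontr)
    assume "\<not> H > 0"
    then have "b \<bullet> b = 0" using b(1) by (simp add: scalar_prod_def)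
    then show False using bb by simp
  qed
  \<comment> \<open>For \<open>N = 0\<close> the sums are empty and for \<open>N = 1\<close> the
    division by \<open>real N - 1\<close> yields 0, so the form would vanish, contrary to its value
    1.\<close>
  show "N \<ge> 2"
  proof (rule ccontr)
    assume "\<not> N \<ge> 2"
    then have "N = 0 \<or> N = 1" by auto
    then have "?u \<bullet> (V *\<^sub>v ?u) = 0" unfolding V_gamma_quadratic_form[OF u] by auto
    then show False using uVu by simp
  qed
qed

text \<open>Common core of both estimates, which differ only in how the scores are bounded.\<close>

theorem prob_le_berry_esseen:
  assumes b: "b \<in> carrier_vec H" "norm2_vec b = 1"
    and bnd: "\<And>i q. i < N \<Longrightarrow> q < Q \<Longrightarrow> \<bar>score (mat_inv_sqrt H V *\<^sub>v b) i q\<bar> \<le> \<delta>"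
  shows "\<bar>prob_le N Q p H Nq Y F b t - Phi t\<bar> \<le> 46 * \<delta>"
proof -
  let ?u = "mat_inv_sqrt H V *\<^sub>v b"
  note u = standardized_direction(1)[OF b] and N = standardized_direction(5)[OF b]
  have N1: "N \<ge> 1" using N by simp
  have "b \<bullet> (mat_inv_sqrt H V *\<^sub>v (gamma_hat N Q p H Nq Y F z - gamma_hat_mean N Q p H Nq Y F))
     = (\<Sum>i<N. score ?u i (z i))" if "z \<in> assignments N Q Nq" for z
    using standardized_direction(2)[OF b, of "gamma_hat N Q p H Nq Y F z - gamma_hat_mean N Q p H Nq Y F"]
      gamma_hat_centered_score[OF u that N1] by (simp add: gamma_hat_def gamma_hat_mean_def)
  then have "prob_le N Q p H Nq Y F b t = real (card {z \<in> assignments N Q Nq. (\<Sum>i<N. score ?u i (z i)) \<le> t})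
      / real (card (assignments N Q Nq))"
    unfolding prob_le_def by (metis (mono_tags, lifting))
  moreover have "\<bar>real (card {z \<in> assignments N Q Nq. (\<Sum>i<N. score ?u i (z i)) \<le> t})
      / real (card (assignments N Q Nq)) - Phi t\<bar> \<le> 46 * \<delta>"
  proof (rule assignment_berry_esseen[OF NqN N score_centered[OF u] _ bnd])
    have "real N - 1 \<noteq> 0" using N by simp
    then show "(\<Sum>i<N. \<Sum>q<Q. real (Nq q) * (score ?u i q)\<^sup>2) - (\<Sum>i<N. (\<Sum>q<Q. real (Nq q) * score ?u i q)\<^sup>2) / real N
      = real N - 1"
      using standardized_direction(3)[OF b] unfolding V_gamma_quadratic_form[OF u] by simp
  qed
  ultimately show ?thesis by simp
qed

text \<open>Up to the factor \<open>Nq q\<close>, the score is the product of \<open>f\<close> and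
  \<open>s\<close> in the form of \<open>?S\<close>, because \<open>?S\<close> maps \<open>s\<close>
  to \<open>?y\<close>. Cauchy-Schwarz separates the Mahalanobis norm of \<open>?y\<close> from the
  form at \<open>f\<close>, which over \<open>Nq q\<close> is one summand of the form of
  \<open>SumFSF\<close> and hence at most \<sigma>^2.\<close>

lemma score_le_mahalanobis:
  assumes b: "b \<in> carrier_vec H" "norm2_vec b = 1"
    and i: "i < N" and q: "q < Q" and S: "invertible_mat (Smat N p Y q q)" and \<sigma>: "\<sigma> \<ge> 1"
    and le: "loewner_le H (SumFSF N Q p H Nq Y F) (\<sigma>\<^sup>2 \<cdot>\<^sub>m V)"
  shows "\<bar>score (mat_inv_sqrt H V *\<^sub>v b) i q\<bar> \<le> \<sigma> * sqrt ((1 / real (Nq q)) *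
     (Ybreve N p Y i q \<bullet> (mat_inv p (Smat N p Y q q) *\<^sub>v Ybreve N p Y i q)))"
proof -
  let ?u = "mat_inv_sqrt H V *\<^sub>v b" and ?S = "Smat N p Y q q" and ?y = "Ybreve N p Y i q"
  note u = standardized_direction(1)[OF b] and N = standardized_direction(5)[OF b]
  define f where "f = transpose_mat (F q) *\<^sub>v ?u"
  define s where "s = mat_inv p ?S *\<^sub>v ?y"
  define g where "g = (\<lambda>x j. \<Sum>k<p. x $ k * Ybreve N p Y j q $ k)"
  have n: "real (Nq q) > 0" using Nq1[OF q] by simp
  have N1: "real N - 1 > 0" using N by simp
  note inv_S = mat_inv_invertible[OF Smat_carrier S]
  have f: "f \<in> carrier_vec p" unfolding f_def using Fc[OF q] u by simp
  have s: "s \<in> carrier_vec p" unfolding s_def by (rule mult_mat_vec_carrier[OF inv_S(1) Ybreve_carrier])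
  have Ss: "?S *\<^sub>v s = ?y"
    using assoc_mult_mat_vec[OF Smat_carrier inv_S(1) Ybreve_carrier, of q q i q] unfolding inv_S(3) s_def by simp
  have bil: "x \<bullet> (?S *\<^sub>v y) = (\<Sum>j<N. g x j * g y j) / (real N - 1)"
    if "x \<in> carrier_vec p" "y \<in> carrier_vec p" for x y
    unfolding g_def by (rule Smat_bilinear_form[OF that])
  have ys: "s \<bullet> (?S *\<^sub>v s) = ?y \<bullet> s" unfolding Ss by (rule comm_scalar_prod[OF s Ybreve_carrier])
  have fy: "?u \<bullet> (F q *\<^sub>v ?y) = f \<bullet> (?S *\<^sub>v s)"
    unfolding Ss f_def by (rule transpose_vec_mult_scalar[OF Fc[OF q] Ybreve_carrier u, symmetric])
  \<comment> \<open>Cauchy-Schwarz is applied to the sums over units behind the form, so no square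
    root of \<open>?S\<close> is involved.\<close>
  have "(f \<bullet> (?S *\<^sub>v s))\<^sup>2 \<le> (f \<bullet> (?S *\<^sub>v f)) * (s \<bullet> (?S *\<^sub>v s))"
  proof -
    have "(\<Sum>j<N. g f j * g s j)\<^sup>2 / (real N - 1)\<^sup>2 \<le> ((\<Sum>j<N. (g f j)\<^sup>2) * (\<Sum>j<N. (g s j)\<^sup>2)) / (real N - 1)\<^sup>2"
      by (intro divide_right_mono Cauchy_Schwarz_ineq_sum) simp
    then show ?thesis
      unfolding bil[OF f s] bil[OF f f] bil[OF s s] by (simp add: power_divide power2_eq_square)
  qed
  also have "\<dots> \<le> (real (Nq q) * \<sigma>\<^sup>2) * (?y \<bullet> s)"
    unfolding ys
  proof (rule mult_right_mono)
    show "0 \<le> ?y \<bullet> s" unfolding ys[symmetric] bil[OF s s] using N1 by (intro divide_nonneg_pos sum_nonneg) auto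
    have "f \<bullet> (?S *\<^sub>v f) / real (Nq q) \<le> ?u \<bullet> (SumFSF N Q p H Nq Y F *\<^sub>v ?u)"
      unfolding SumFSF_quadratic_form(1)[OF u] f_def
    proof (rule member_le_sum)
      fix r assume "r \<in> {..<Q} - {q}"
      then have r: "r < Q" by simp
      have fr: "transpose_mat (F r) *\<^sub>v ?u \<in> carrier_vec p" using Fc[OF r] u by simp
      show "0 \<le> (transpose_mat (F r) *\<^sub>v ?u) \<bullet> (Smat N p Y r r *\<^sub>v (transpose_mat (F r) *\<^sub>v ?u)) / real (Nq r)"
        unfolding Smat_bilinear_form[OF fr fr] using N1
        by (intro divide_nonneg_nonneg sum_nonneg) auto
    qed (use q in auto)
    also have "\<dots> \<le> ?u \<bullet> ((\<sigma>\<^sup>2 \<cdot>\<^sub>m V) *\<^sub>v ?u)" using le u by (simp add: loewner_le_def)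
    also have "\<dots> = \<sigma>\<^sup>2 * (?u \<bullet> (V *\<^sub>v ?u))"
    proof -
      have "(\<sigma>\<^sup>2 \<cdot>\<^sub>m V) *\<^sub>v ?u = \<sigma>\<^sup>2 \<cdot>\<^sub>v (V *\<^sub>v ?u)"
        using carrier_vecD[OF u] carrier_matD[OF V_gamma_carrier]
        by (intro eq_vecI) (auto simp: scalar_prod_def sum_distrib_left mult.assoc)
      then show ?thesis
        using u mult_mat_vec_carrier[OF V_gamma_carrier u] by simp
    qed
    finally show "f \<bullet> (?S *\<^sub>v f) \<le> real (Nq q) * \<sigma>\<^sup>2"
      unfolding standardized_direction(3)[OF b] using n by (simp add: field_simps)
  qed
  finally have "(score ?u i q)\<^sup>2 \<le> (real (Nq q) * \<sigma>\<^sup>2) * (?y \<bullet> s) / (real (Nq q))\<^sup>2"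
    unfolding score_def fy power_divide by (rule divide_right_mono) simp
  also have "\<dots> = \<sigma>\<^sup>2 * ((1 / real (Nq q)) * (?y \<bullet> s))" using n by (simp add: power2_eq_square)
  finally have "sqrt ((score ?u i q)\<^sup>2) \<le> sqrt (\<sigma>\<^sup>2 * ((1 / real (Nq q)) * (?y \<bullet> s)))"
    by (rule real_sqrt_le_mono)
  then show ?thesis unfolding real_sqrt_mult[of "\<sigma>\<^sup>2"] s_def using \<sigma> by simp
qed

text \<open>The covariance form at the direction is 1, so its squared length is at most
  \<open>1 / min_eig V\<close>. Cauchy-Schwarz handles each column of \<open>F q\<close>, and the
  entries of the centred outcome are replaced by the largest one.\<close>

lemma score_le_norm21:
  assumes b: "b \<in> carrier_vec H" "norm2_vec b = 1" and i: "i < N" and q: "q < Q"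
  shows "\<bar>score (mat_inv_sqrt H V *\<^sub>v b) i q\<bar>
    \<le> norm21 (F q) * (1 / real (Nq q)) * norm_inf_vec (Ybreve N p Y i q) / sqrt (min_eig V)"
proof -
  let ?u = "mat_inv_sqrt H V *\<^sub>v b" and ?y = "Ybreve N p Y i q"
  note u = standardized_direction(1)[OF b] and H = standardized_direction(4)[OF b]
  note eig = min_eig_quadratic_form[OF V_gamma_carrier V_gamma_symmetric inv H V_psd]
  have "min_eig V * (?u \<bullet> ?u) \<le> 1" using eig(2)[OF u] standardized_direction(3)[OF b] by simp
  then have "?u \<bullet> ?u \<le> 1 / min_eig V" using eig(1) by (simp add: field_simps)
  then have nu: "sqrt (?u \<bullet> ?u) \<le> 1 / sqrt (min_eig V)"
    using real_sqrt_le_mono by (fastforce simp: real_sqrt_divide)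
  have Fq: "dim_row (F q) = H" "dim_col (F q) = p" using Fc[OF q] by auto
  have col: "\<bar>(transpose_mat (F q) *\<^sub>v ?u) $ k\<bar> \<le> sqrt (\<Sum>h<H. (F q $$ (h, k))\<^sup>2) * sqrt (?u \<bullet> ?u)" if k: "k < p" for k
  proof -
    have "(transpose_mat (F q) *\<^sub>v ?u) $ k = (\<Sum>h<H. F q $$ (h, k) * ?u $ h)"
      using Fc[OF q] k u by (subst mult_mat_vec_entry[of _ p H]) auto
    then have "((transpose_mat (F q) *\<^sub>v ?u) $ k)\<^sup>2 \<le> (\<Sum>h<H. (F q $$ (h, k))\<^sup>2) * (\<Sum>h<H. (?u $ h)\<^sup>2)"
      using Cauchy_Schwarz_ineq_sum[of "\<lambda>h. F q $$ (h, k)" "\<lambda>h. ?u $ h" "{..<H}"] by simp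
    also have "(\<Sum>h<H. (?u $ h)\<^sup>2) = ?u \<bullet> ?u" by (simp add: scalar_prod_lessThan[OF u] power2_eq_square)
    finally have "sqrt (((transpose_mat (F q) *\<^sub>v ?u) $ k)\<^sup>2) \<le> sqrt ((\<Sum>h<H. (F q $$ (h, k))\<^sup>2) * (?u \<bullet> ?u))"
      by (rule real_sqrt_le_mono)
    then show ?thesis by (simp add: real_sqrt_mult)
  qed
  have yk: "\<bar>?y $ k\<bar> \<le> norm_inf_vec ?y" if "k < p" for k
    unfolding norm_inf_vec_def using that by (intro Max_ge) (auto simp: Ybreve_def)
  have y0: "0 \<le> norm_inf_vec ?y" unfolding norm_inf_vec_def by (intro Max_ge) auto
  have "\<bar>?u \<bullet> (F q *\<^sub>v ?y)\<bar> \<le> (\<Sum>k<p. \<bar>(transpose_mat (F q) *\<^sub>v ?u) $ k\<bar> * \<bar>?y $ k\<bar>)"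
    unfolding dual_score[OF u q Ybreve_carrier] by (rule order_trans[OF sum_abs]) (simp add: abs_mult)
  also have "\<dots> \<le> (\<Sum>k<p. (sqrt (\<Sum>h<H. (F q $$ (h, k))\<^sup>2) * sqrt (?u \<bullet> ?u)) * norm_inf_vec ?y)"
    by (intro sum_mono mult_mono col yk) (auto simp: real_scalar_prod_self_nonneg sum_nonneg)
  also have "\<dots> = norm21 (F q) * sqrt (?u \<bullet> ?u) * norm_inf_vec ?y"
    by (simp add: norm21_def Fq sum_distrib_right)
  also have "\<dots> \<le> norm21 (F q) * (1 / sqrt (min_eig V)) * norm_inf_vec ?y"
    using nu y0 by (intro mult_right_mono mult_left_mono) (auto simp: norm21_def sum_nonneg)
  finally have "\<bar>?u \<bullet> (F q *\<^sub>v ?y)\<bar> / real (Nq q) \<le> norm21 (F q) * (1 / sqrt (min_eig V)) * norm_inf_vec ?y / real (Nq q)"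
    by (rule divide_right_mono) simp
  then show ?thesis by (simp add: score_def field_simps)
qed

theorem berry_esseen_direction:
  assumes b: "b \<in> carrier_vec H" "norm2_vec b = 1"
  shows "\<bar>prob_le N Q p H Nq Y F b t - Phi t\<bar>
    \<le> 46 * Max {\<bar>b \<bullet> (mat_inv_sqrt H V *\<^sub>v ((1 / real (Nq q)) \<cdot>\<^sub>v (F q *\<^sub>v Ybreve N p Y i q)))\<bar> | i q. i < N \<and> q < Q}"
proof (rule prob_le_berry_esseen[OF b])
  fix i q assume iq: "i < N" "q < Q"
  have "b \<bullet> (mat_inv_sqrt H V *\<^sub>v ((1 / real (Nq q)) \<cdot>\<^sub>v (F q *\<^sub>v Ybreve N p Y i q)))
     = score (mat_inv_sqrt H V *\<^sub>v b) i q"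
    using standardized_direction(1,2)[OF b] F_mult_carrier[OF iq(2)] by (simp add: score_def)
  then show "\<bar>score (mat_inv_sqrt H V *\<^sub>v b) i q\<bar>
    \<le> Max {\<bar>b \<bullet> (mat_inv_sqrt H V *\<^sub>v ((1 / real (Nq q)) \<cdot>\<^sub>v (F q *\<^sub>v Ybreve N p Y i q)))\<bar> | i q. i < N \<and> q < Q}"
    using le_Max_indexed[OF iq, of "\<lambda>i q. \<bar>b \<bullet> (mat_inv_sqrt H V *\<^sub>v ((1 / real (Nq q)) \<cdot>\<^sub>v (F q *\<^sub>v Ybreve N p Y i q)))\<bar>"]
    by simp
qed

theorem berry_esseen_uniform:
  assumes b: "b \<in> carrier_vec H" "norm2_vec b = 1"
    and S: "\<forall>q<Q. invertible_mat (Smat N p Y q q)" and \<sigma>: "\<sigma> \<ge> 1"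
    and le: "loewner_le H (SumFSF N Q p H Nq Y F) (\<sigma>\<^sup>2 \<cdot>\<^sub>m V)"
  shows "\<bar>prob_le N Q p H Nq Y F b t - Phi t\<bar>
    \<le> 46 * Max {min (2 * \<sigma> * sqrt ((1 / real (Nq q)) *
                (Ybreve N p Y i q \<bullet> (mat_inv p (Smat N p Y q q) *\<^sub>v Ybreve N p Y i q))))
             (norm21 (F q) * (1 / real (Nq q)) * norm_inf_vec (Ybreve N p Y i q) / sqrt (min_eig V))
           | i q. i < N \<and> q < Q}"
    (is "_ \<le> 46 * Max {min (?m i q) (?e i q) | i q. _ i q}")
proof (rule prob_le_berry_esseen[OF b])
  fix i q assume iq: "i < N" "q < Q"
  let ?s = "score (mat_inv_sqrt H V *\<^sub>v b) i q"
  \<comment> \<open>The Mahalanobis estimate carries the factor \<open>\<sigma>\<close>; its right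
    side dominates an absolute value, hence is nonnegative and may be doubled.\<close>
  have "\<bar>?s\<bar> \<le> ?m i q"
    using score_le_mahalanobis[OF b iq _ \<sigma> le] S iq(2) abs_ge_zero[of ?s] by force
  moreover have "\<bar>?s\<bar> \<le> ?e i q" by (rule score_le_norm21[OF b iq])
  ultimately have "\<bar>?s\<bar> \<le> min (?m i q) (?e i q)" by simp
  also have "\<dots> \<le> Max {min (?m i q) (?e i q) | i q. i < N \<and> q < Q}" by (rule le_Max_indexed[OF iq])
  finally show "\<bar>?s\<bar> \<le> Max {min (?m i q) (?e i q) | i q. i < N \<and> q < Q}" .
qed

end

end

theorem theoremS4:
  shows "\<exists>C>0. \<forall>(N::nat) (Q::nat) (p::nat) (H::nat) (Nq::nat \<Rightarrow> nat)
      (Y::nat \<Rightarrow> nat \<Rightarrow> real vec) (F::nat \<Rightarrow> real mat).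
    (\<forall>q<Q. Nq q \<ge> 1) \<and> (\<Sum>q<Q. Nq q) = N
    \<and> (\<forall>i<N. \<forall>q<Q. Y i q \<in> carrier_vec p)
    \<and> (\<forall>q<Q. F q \<in> carrier_mat H p)
    \<and> invertible_mat (V_gamma N Q p H Nq Y F)
    \<longrightarrow>
    (\<forall>b \<in> carrier_vec H. norm2_vec b = 1 \<longrightarrow>
       (\<forall>t. \<bar>prob_le N Q p H Nq Y F b t - Phi t\<bar>
         \<le> C * Max {\<bar>b \<bullet> (mat_inv_sqrt H (V_gamma N Q p H Nq Y F) *\<^sub>v
                          ((1 / real (Nq q)) \<cdot>\<^sub>v (F q *\<^sub>v Ybreve N p Y i q)))\<bar> | i q. i < N \<and> q < Q}))
    \<and>
    (\<forall>\<sigma>F::real. (\<forall>q<Q. invertible_mat (Smat N p Y q q)) \<and> \<sigma>F \<ge> 1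
       \<and> loewner_le H (SumFSF N Q p H Nq Y F) (\<sigma>F\<^sup>2 \<cdot>\<^sub>m V_gamma N Q p H Nq Y F)
       \<longrightarrow>
       (\<forall>b \<in> carrier_vec H. norm2_vec b = 1 \<longrightarrow>
         (\<forall>t. \<bar>prob_le N Q p H Nq Y F b t - Phi t\<bar>
           \<le> C * Max {min (2 * \<sigma>F * sqrt ((1 / real (Nq q)) *
                              (Ybreve N p Y i q \<bullet> (mat_inv p (Smat N p Y q q) *\<^sub>v Ybreve N p Y i q))))
                         (norm21 (F q) * (1 / real (Nq q)) * norm_inf_vec (Ybreve N p Y i q)
                           / sqrt (min_eig (V_gamma N Q p H Nq Y F)))
                       | i q. i < N \<and> q < Q})))"
\<comment> \<open>46 is the constant of \<open>combinatorial_berry_esseen\<close>, passed on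
  unchanged by the reductions.\<close>
proof (intro exI[of _ 46] conjI allI impI ballI, goal_cases)
  case 1
  show ?case by simp
next
  case (2 N Q p H Nq Y F b t)
  then show ?case by (intro berry_esseen_direction) auto
next
  case (3 N Q p H Nq Y F \<sigma>F b t)
  then show ?case by (intro berry_esseen_uniform) auto
qed

end
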